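(* Let $(M,\phi,\xi,\eta,g,\nabla)$ be a Sasaki with torsion manifold. Then $(\phi,\xi,g)$ is co-Kähler-like, i.e. the connection $\nabla$ satisfies the first Bianchi identity $$R^\nabla(X,Y)Z+R^\nabla(Y,Z)X+R^\nabla(Z,X)Y=0\quad\text{for all vector fields }X,Y,Z,$$ if and only if the torsion $3$-form $$H=\eta\wedge d\eta+d^{\phi}F$$ is both closed ($dH=0$) and parallel ($\nabla H=0$).
   Context: An almost contact metric structure $(\phi,\xi,\eta,g)$ on a connected smooth manifold $M$ of dimension $2n+1$ consists of a $(1,1)$-tensor $\phi$, a vector field $\xi$ (Reeb vector field), a $1$-form $\eta$ and a Riemannian metric $g$ with $\phi^2=-\mathrm{Id}+\eta\otimes\xi$, $\eta(\xi)=1$, $g(\phi X,\phi Y)=g(X,Y)-\eta(X)\eta(Y)$ (so $\eta=g(\xi,\cdot)$). Its fundamental form is $F(X,Y)=g(X,\phi Y)$. It is normal if $N_\phi+d\eta\otimes\xi=0$, where $N_\phi(X,Y)=\phi^2[X,Y]+[\phi X,\phi Y]-\phi[\phi X,Y]-\phi[X,\phi Y]$ and $d\eta(X,Y)=X\eta(Y)-Y\eta(X)-\eta([X,Y])$. Put $d^\phi F(X,Y,Z)=-dF(\phi X,\phi Y,\phi Z)$. A Sasaki with torsion manifold is a manifold with a normal almost contact metric structure whose Reeb field $\xi$ is Killing, together with the unique metric connection $\nabla$ with totally skew-symmetric torsion such that $\nabla\phi=0$, $\nabla\eta=0$. It is given by $g(\nabla_XY,Z)=g(\nabla^g_XY,Z)+\frac12(\eta\wedge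 d\eta+d^\phi F)(X,Y,Z)$, with $\nabla^g$ the Levi-Civita connection (wedge convention: $(\eta\wedge d\eta)(\xi,x,y)=d\eta(x,y)$ for $x,y\in\ker\eta$). Its torsion $3$-form is $H=\eta\wedge d\eta+d^\phi F$. $R^\nabla(X,Y)=[\nabla_X,\nabla_Y]-\nabla_{[X,Y]}$ is its curvature. *)

theory Defs
  imports "HOL-Analysis.Analysis" "HOL-Library.Function_Algebras"
begin

text \<open>
  Tangent vectors are functions of type \<open>('a \<Rightarrow> real) \<Rightarrow> real\<close> and vector fields are functions from
  points to tangent vectors; their addition, negation and zero are the pointwise ones of
  \<^theory>\<open>HOL-Library.Function_Algebras\<close>, as are sums and products of real functions on the manifold.
\<close>

section \<open>Smooth manifolds and vector fields\<close>

primrec Ck_on :: "nat \<Rightarrow> 'e::real_normed_vector set \<Rightarrow> ('e \<Rightarrow> 'f::real_normed_vector) \<Rightarrow> bool" where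
  "Ck_on 0 S f \<longleftrightarrow> continuous_on S f"
| "Ck_on (Suc k) S f \<longleftrightarrow>
     (\<forall>x\<in>S. f differentiable (at x)) \<and> (\<forall>v. Ck_on k S (\<lambda>x. frechet_derivative f (at x) v))"

text \<open>Only used for open \<open>S\<close>.\<close>

definition smooth_on :: "'e::real_normed_vector set \<Rightarrow> ('e \<Rightarrow> 'f::real_normed_vector) \<Rightarrow> bool" where
  "smooth_on S f \<longleftrightarrow> (\<forall>k. Ck_on k S f)"

type_synonym ('a, 'e) atlas = "('a set \<times> ('a \<Rightarrow> 'e)) set"

text \<open>
  The manifold is the whole type \<open>'a\<close>; Hausdorffness and second countability are its type classes.
  The atlas need not be maximal.
\<close>

definition smooth_atlas ::
    "('a::{t2_space, second_countable_topology}, 'e::euclidean_space) atlas \<Rightarrow> bool" where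
  "smooth_atlas A \<longleftrightarrow>
     (\<forall>(U, c)\<in>A. open U \<and> open (c ` U) \<and> homeomorphism U (c ` U) c (inv_into U c)) \<and>
     (\<Union>(U, c)\<in>A. U) = UNIV \<and>
     (\<forall>(U, c)\<in>A. \<forall>(V, d)\<in>A. smooth_on (c ` (U \<inter> V)) (d \<circ> inv_into U c))"

definition connected_manifold ::
    "('a::{t2_space, second_countable_topology}, 'e::euclidean_space) atlas \<Rightarrow> bool" where
  "connected_manifold A \<longleftrightarrow> smooth_atlas A \<and> connected (UNIV :: 'a set)"

definition smooth_fun :: "('a, 'e::euclidean_space) atlas \<Rightarrow> ('a \<Rightarrow> real) \<Rightarrow> bool" where
  "smooth_fun A f \<longleftrightarrow> (\<forall>(U, c)\<in>A. smooth_on (c ` U) (f \<circ> inv_into U c))"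

type_synonym 'a tvec = "('a \<Rightarrow> real) \<Rightarrow> real"
type_synonym 'a vfield = "'a \<Rightarrow> 'a tvec"

text \<open>
  A tangent vector at \<open>p\<close> is a derivation at \<open>p\<close> of the algebra of smooth functions. Its value on
  non-smooth functions is fixed to \<open>0\<close>, so that HOL equality is equality of derivations.
\<close>

definition tangent_space :: "('a, 'e::euclidean_space) atlas \<Rightarrow> 'a \<Rightarrow> 'a tvec set" where
  "tangent_space A p = {v.
     (\<forall>f h. smooth_fun A f \<longrightarrow> smooth_fun A h \<longrightarrow>
        (\<forall>a b. v (\<lambda>q. a * f q + b * h q) = a * v f + b * v h) \<and>
        v (f * h) = f p * v h + h p * v f) \<and>
     (\<forall>f. \<not> smooth_fun A f \<longrightarrow> v f = 0)}"

definition tscale :: "real \<Rightarrow> 'a tvec \<Rightarrow> 'a tvec" where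
  "tscale c v = (\<lambda>f. c * v f)"

definition fscale :: "('a \<Rightarrow> real) \<Rightarrow> 'a vfield \<Rightarrow> 'a vfield" where
  "fscale f X = (\<lambda>p. tscale (f p) (X p))"

definition vapply :: "'a vfield \<Rightarrow> ('a \<Rightarrow> real) \<Rightarrow> ('a \<Rightarrow> real)" where
  "vapply X f = (\<lambda>p. X p f)"

definition vector_fields :: "('a, 'e::euclidean_space) atlas \<Rightarrow> 'a vfield set" where
  "vector_fields A =
     {X. (\<forall>p. X p \<in> tangent_space A p) \<and> (\<forall>f. smooth_fun A f \<longrightarrow> smooth_fun A (vapply X f))}"

definition lie_bracket :: "'a vfield \<Rightarrow> 'a vfield \<Rightarrow> 'a vfield" where
  "lie_bracket X Y = (\<lambda>p f. X p (vapply Y f) - Y p (vapply X f))"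


section \<open>Tensor fields and differential forms\<close>

text \<open>
  The structure tensors are given pointwise, e.g. an endomorphism field assigns to \<open>p\<close> a map on the
  tangent space at \<open>p\<close> (its values elsewhere are irrelevant); \<open>ap1\<close>, \<open>ap2\<close> and \<open>apE\<close> let them act on
  vector fields. Differential forms are handled through their values on vector fields.
\<close>

definition ap1 :: "('a \<Rightarrow> 'a tvec \<Rightarrow> real) \<Rightarrow> 'a vfield \<Rightarrow> ('a \<Rightarrow> real)" where
  "ap1 \<alpha> X = (\<lambda>p. \<alpha> p (X p))"

definition ap2 :: "('a \<Rightarrow> 'a tvec \<Rightarrow> 'a tvec \<Rightarrow> real) \<Rightarrow> 'a vfield \<Rightarrow> 'a vfield \<Rightarrow> ('a \<Rightarrow> real)" where
  "ap2 \<beta> X Y = (\<lambda>p. \<beta> p (X p) (Y p))"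

definition apE :: "('a \<Rightarrow> 'a tvec \<Rightarrow> 'a tvec) \<Rightarrow> 'a vfield \<Rightarrow> 'a vfield" where
  "apE \<phi> X = (\<lambda>p. \<phi> p (X p))"

definition one_form :: "('a, 'e::euclidean_space) atlas \<Rightarrow> ('a \<Rightarrow> 'a tvec \<Rightarrow> real) \<Rightarrow> bool" where
  "one_form A \<alpha> \<longleftrightarrow>
     (\<forall>p. \<forall>u\<in>tangent_space A p. \<forall>v\<in>tangent_space A p. \<forall>a b.
        \<alpha> p (tscale a u + tscale b v) = a * \<alpha> p u + b * \<alpha> p v) \<and>
     (\<forall>X\<in>vector_fields A. smooth_fun A (ap1 \<alpha> X))"

definition endo_field :: "('a, 'e::euclidean_space) atlas \<Rightarrow> ('a \<Rightarrow> 'a tvec \<Rightarrow> 'a tvec) \<Rightarrow> bool" where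
  "endo_field A \<phi> \<longleftrightarrow>
     (\<forall>p. \<forall>u\<in>tangent_space A p. \<phi> p u \<in> tangent_space A p) \<and>
     (\<forall>p. \<forall>u\<in>tangent_space A p. \<forall>v\<in>tangent_space A p. \<forall>a b.
        \<phi> p (tscale a u + tscale b v) = tscale a (\<phi> p u) + tscale b (\<phi> p v)) \<and>
     (\<forall>X\<in>vector_fields A. apE \<phi> X \<in> vector_fields A)"

definition riemannian_metric ::
    "('a, 'e::euclidean_space) atlas \<Rightarrow> ('a \<Rightarrow> 'a tvec \<Rightarrow> 'a tvec \<Rightarrow> real) \<Rightarrow> bool" where
  "riemannian_metric A g \<longleftrightarrow>
     (\<forall>p. \<forall>u\<in>tangent_space A p. \<forall>v\<in>tangent_space A p. \<forall>w\<in>tangent_space A p. \<forall>a b.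
        g p (tscale a u + tscale b v) w = a * g p u w + b * g p v w) \<and>
     (\<forall>p. \<forall>u\<in>tangent_space A p. \<forall>v\<in>tangent_space A p. g p u v = g p v u) \<and>
     (\<forall>p. \<forall>u\<in>tangent_space A p. u \<noteq> 0 \<longrightarrow> g p u u > 0) \<and>
     (\<forall>X\<in>vector_fields A. \<forall>Y\<in>vector_fields A. smooth_fun A (ap2 g X Y))"

text \<open>
  Exterior derivatives of forms of degree 1, 2, 3 by the invariant formula, without a factor
  \<open>1/(k+1)\<close>.
\<close>

definition ext_d1 :: "('a vfield \<Rightarrow> 'a \<Rightarrow> real) \<Rightarrow> 'a vfield \<Rightarrow> 'a vfield \<Rightarrow> ('a \<Rightarrow> real)" where
  "ext_d1 \<alpha> X Y = vapply X (\<alpha> Y) - vapply Y (\<alpha> X) - \<alpha> (lie_bracket X Y)"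

definition ext_d2 ::
    "('a vfield \<Rightarrow> 'a vfield \<Rightarrow> 'a \<Rightarrow> real) \<Rightarrow> 'a vfield \<Rightarrow> 'a vfield \<Rightarrow> 'a vfield \<Rightarrow> ('a \<Rightarrow> real)" where
  "ext_d2 \<beta> X Y Z =
     vapply X (\<beta> Y Z) - vapply Y (\<beta> X Z) + vapply Z (\<beta> X Y)
     - \<beta> (lie_bracket X Y) Z + \<beta> (lie_bracket X Z) Y - \<beta> (lie_bracket Y Z) X"

definition ext_d3 ::
    "('a vfield \<Rightarrow> 'a vfield \<Rightarrow> 'a vfield \<Rightarrow> 'a \<Rightarrow> real) \<Rightarrow>
     'a vfield \<Rightarrow> 'a vfield \<Rightarrow> 'a vfield \<Rightarrow> 'a vfield \<Rightarrow> ('a \<Rightarrow> real)" where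
  "ext_d3 \<gamma> X Y Z W =
     vapply X (\<gamma> Y Z W) - vapply Y (\<gamma> X Z W) + vapply Z (\<gamma> X Y W) - vapply W (\<gamma> X Y Z)
     - \<gamma> (lie_bracket X Y) Z W + \<gamma> (lie_bracket X Z) Y W - \<gamma> (lie_bracket X W) Y Z
     - \<gamma> (lie_bracket Y Z) X W + \<gamma> (lie_bracket Y W) X Z - \<gamma> (lie_bracket Z W) X Y"

text \<open>The normalisation is such that \<open>(\<eta> \<and> d\<eta>)(\<xi>, x, y) = d\<eta>(x, y)\<close> for \<open>\<eta>(\<xi>) = 1\<close> and \<open>x, y \<in> ker \<eta>\<close>.\<close>

definition wedge12 ::
    "('a vfield \<Rightarrow> 'a \<Rightarrow> real) \<Rightarrow> ('a vfield \<Rightarrow> 'a vfield \<Rightarrow> 'a \<Rightarrow> real) \<Rightarrow>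
     'a vfield \<Rightarrow> 'a vfield \<Rightarrow> 'a vfield \<Rightarrow> ('a \<Rightarrow> real)" where
  "wedge12 \<alpha> \<beta> X Y Z = \<alpha> X * \<beta> Y Z + \<alpha> Y * \<beta> Z X + \<alpha> Z * \<beta> X Y"


section \<open>Almost contact metric structures\<close>

definition almost_contact_metric ::
    "('a, 'e::euclidean_space) atlas \<Rightarrow> ('a \<Rightarrow> 'a tvec \<Rightarrow> 'a tvec) \<Rightarrow> 'a vfield \<Rightarrow>
     ('a \<Rightarrow> 'a tvec \<Rightarrow> real) \<Rightarrow> ('a \<Rightarrow> 'a tvec \<Rightarrow> 'a tvec \<Rightarrow> real) \<Rightarrow> bool" where
  "almost_contact_metric A \<phi> \<xi> \<eta> g \<longleftrightarrow>
     endo_field A \<phi> \<and> \<xi> \<in> vector_fields A \<and> one_form A \<eta> \<and> riemannian_metric A g \<and>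
     (\<forall>p. \<forall>u\<in>tangent_space A p. \<phi> p (\<phi> p u) = - u + tscale (\<eta> p u) (\<xi> p)) \<and>
     (\<forall>p. \<eta> p (\<xi> p) = 1) \<and>
     (\<forall>p. \<forall>u\<in>tangent_space A p. \<forall>v\<in>tangent_space A p.
        g p (\<phi> p u) (\<phi> p v) = g p u v - \<eta> p u * \<eta> p v)"

definition fundamental_form ::
    "('a \<Rightarrow> 'a tvec \<Rightarrow> 'a tvec) \<Rightarrow> ('a \<Rightarrow> 'a tvec \<Rightarrow> 'a tvec \<Rightarrow> real) \<Rightarrow>
     'a vfield \<Rightarrow> 'a vfield \<Rightarrow> ('a \<Rightarrow> real)" where
  "fundamental_form \<phi> g X Y = ap2 g X (apE \<phi> Y)"

definition nijenhuis :: "('a \<Rightarrow> 'a tvec \<Rightarrow> 'a tvec) \<Rightarrow> 'a vfield \<Rightarrow> 'a vfield \<Rightarrow> 'a vfield" where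
  "nijenhuis \<phi> X Y =
     apE \<phi> (apE \<phi> (lie_bracket X Y)) + lie_bracket (apE \<phi> X) (apE \<phi> Y)
     - apE \<phi> (lie_bracket (apE \<phi> X) Y) - apE \<phi> (lie_bracket X (apE \<phi> Y))"

definition normal_structure ::
    "('a, 'e::euclidean_space) atlas \<Rightarrow> ('a \<Rightarrow> 'a tvec \<Rightarrow> 'a tvec) \<Rightarrow> 'a vfield \<Rightarrow>
     ('a \<Rightarrow> 'a tvec \<Rightarrow> real) \<Rightarrow> bool" where
  "normal_structure A \<phi> \<xi> \<eta> \<longleftrightarrow>
     (\<forall>X\<in>vector_fields A. \<forall>Y\<in>vector_fields A.
        nijenhuis \<phi> X Y + fscale (ext_d1 (ap1 \<eta>) X Y) \<xi> = 0)"

text \<open>\<open>(L\<^sub>K g)(X, Y) = K(g(X, Y)) - g([K, X], Y) - g(X, [K, Y])\<close>\<close>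

definition killing ::
    "('a, 'e::euclidean_space) atlas \<Rightarrow> ('a \<Rightarrow> 'a tvec \<Rightarrow> 'a tvec \<Rightarrow> real) \<Rightarrow> 'a vfield \<Rightarrow> bool" where
  "killing A g K \<longleftrightarrow>
     (\<forall>X\<in>vector_fields A. \<forall>Y\<in>vector_fields A.
        vapply K (ap2 g X Y) - ap2 g (lie_bracket K X) Y - ap2 g X (lie_bracket K Y) = 0)"

definition d_phi_F ::
    "('a \<Rightarrow> 'a tvec \<Rightarrow> 'a tvec) \<Rightarrow> ('a \<Rightarrow> 'a tvec \<Rightarrow> 'a tvec \<Rightarrow> real) \<Rightarrow>
     'a vfield \<Rightarrow> 'a vfield \<Rightarrow> 'a vfield \<Rightarrow> ('a \<Rightarrow> real)" where
  "d_phi_F \<phi> g X Y Z = - ext_d2 (fundamental_form \<phi> g) (apE \<phi> X) (apE \<phi> Y) (apE \<phi> Z)"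

definition torsion_form ::
    "('a \<Rightarrow> 'a tvec \<Rightarrow> 'a tvec) \<Rightarrow> ('a \<Rightarrow> 'a tvec \<Rightarrow> real) \<Rightarrow>
     ('a \<Rightarrow> 'a tvec \<Rightarrow> 'a tvec \<Rightarrow> real) \<Rightarrow> 'a vfield \<Rightarrow> 'a vfield \<Rightarrow> 'a vfield \<Rightarrow> ('a \<Rightarrow> real)" where
  "torsion_form \<phi> \<eta> g X Y Z = wedge12 (ap1 \<eta>) (ext_d1 (ap1 \<eta>)) X Y Z + d_phi_F \<phi> g X Y Z"


section \<open>Connections\<close>

text \<open>\<open>D X Y\<close> is the covariant derivative of \<open>Y\<close> along \<open>X\<close>.\<close>

definition affine_connection ::
    "('a, 'e::euclidean_space) atlas \<Rightarrow> ('a vfield \<Rightarrow> 'a vfield \<Rightarrow> 'a vfield) \<Rightarrow> bool" where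
  "affine_connection A D \<longleftrightarrow>
     (\<forall>X\<in>vector_fields A. \<forall>Y\<in>vector_fields A. D X Y \<in> vector_fields A) \<and>
     (\<forall>X\<in>vector_fields A. \<forall>Y\<in>vector_fields A. \<forall>Z\<in>vector_fields A.
        D (X + Y) Z = D X Z + D Y Z \<and> D X (Y + Z) = D X Y + D X Z) \<and>
     (\<forall>f X Y. smooth_fun A f \<longrightarrow> X \<in> vector_fields A \<longrightarrow> Y \<in> vector_fields A \<longrightarrow>
        D (fscale f X) Y = fscale f (D X Y) \<and>
        D X (fscale f Y) = fscale (vapply X f) Y + fscale f (D X Y))"

definition torsion ::
    "('a vfield \<Rightarrow> 'a vfield \<Rightarrow> 'a vfield) \<Rightarrow> 'a vfield \<Rightarrow> 'a vfield \<Rightarrow> 'a vfield" where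
  "torsion D X Y = D X Y - D Y X - lie_bracket X Y"

definition curvature ::
    "('a vfield \<Rightarrow> 'a vfield \<Rightarrow> 'a vfield) \<Rightarrow> 'a vfield \<Rightarrow> 'a vfield \<Rightarrow> 'a vfield \<Rightarrow> 'a vfield" where
  "curvature D X Y Z = D X (D Y Z) - D Y (D X Z) - D (lie_bracket X Y) Z"

definition metric_connection ::
    "('a, 'e::euclidean_space) atlas \<Rightarrow> ('a \<Rightarrow> 'a tvec \<Rightarrow> 'a tvec \<Rightarrow> real) \<Rightarrow>
     ('a vfield \<Rightarrow> 'a vfield \<Rightarrow> 'a vfield) \<Rightarrow> bool" where
  "metric_connection A g D \<longleftrightarrow>
     affine_connection A D \<and>
     (\<forall>X\<in>vector_fields A. \<forall>Y\<in>vector_fields A. \<forall>Z\<in>vector_fields A.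
        vapply X (ap2 g Y Z) = ap2 g (D X Y) Z + ap2 g Y (D X Z))"

text \<open>
  The map \<open>(X, Y, Z) \<mapsto> g(T(X, Y), Z)\<close> is alternating. Skewness in the first two slots is automatic.
\<close>

definition skew_torsion ::
    "('a, 'e::euclidean_space) atlas \<Rightarrow> ('a \<Rightarrow> 'a tvec \<Rightarrow> 'a tvec \<Rightarrow> real) \<Rightarrow>
     ('a vfield \<Rightarrow> 'a vfield \<Rightarrow> 'a vfield) \<Rightarrow> bool" where
  "skew_torsion A g D \<longleftrightarrow>
     (\<forall>X\<in>vector_fields A. \<forall>Y\<in>vector_fields A. \<forall>Z\<in>vector_fields A.
        ap2 g (torsion D X Y) Z = - ap2 g (torsion D Y X) Z \<and>
        ap2 g (torsion D X Y) Z = - ap2 g (torsion D X Z) Y)"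

text \<open>Covariant derivatives of a 1-form, an endomorphism field and a 3-form.\<close>

definition nabla_form1 ::
    "('a vfield \<Rightarrow> 'a vfield \<Rightarrow> 'a vfield) \<Rightarrow> ('a vfield \<Rightarrow> 'a \<Rightarrow> real) \<Rightarrow>
     'a vfield \<Rightarrow> 'a vfield \<Rightarrow> ('a \<Rightarrow> real)" where
  "nabla_form1 D \<alpha> X Y = vapply X (\<alpha> Y) - \<alpha> (D X Y)"

definition nabla_endo ::
    "('a vfield \<Rightarrow> 'a vfield \<Rightarrow> 'a vfield) \<Rightarrow> ('a \<Rightarrow> 'a tvec \<Rightarrow> 'a tvec) \<Rightarrow>
     'a vfield \<Rightarrow> 'a vfield \<Rightarrow> 'a vfield" where
  "nabla_endo D \<phi> X Y = D X (apE \<phi> Y) - apE \<phi> (D X Y)"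

definition nabla_form3 ::
    "('a vfield \<Rightarrow> 'a vfield \<Rightarrow> 'a vfield) \<Rightarrow> ('a vfield \<Rightarrow> 'a vfield \<Rightarrow> 'a vfield \<Rightarrow> 'a \<Rightarrow> real) \<Rightarrow>
     'a vfield \<Rightarrow> 'a vfield \<Rightarrow> 'a vfield \<Rightarrow> 'a vfield \<Rightarrow> ('a \<Rightarrow> real)" where
  "nabla_form3 D \<gamma> W X Y Z =
     vapply W (\<gamma> X Y Z) - \<gamma> (D W X) Y Z - \<gamma> X (D W Y) Z - \<gamma> X Y (D W Z)"

definition closed_form3 ::
    "('a, 'e::euclidean_space) atlas \<Rightarrow> ('a vfield \<Rightarrow> 'a vfield \<Rightarrow> 'a vfield \<Rightarrow> 'a \<Rightarrow> real) \<Rightarrow> bool" where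
  "closed_form3 A \<gamma> \<longleftrightarrow>
     (\<forall>X\<in>vector_fields A. \<forall>Y\<in>vector_fields A. \<forall>Z\<in>vector_fields A. \<forall>W\<in>vector_fields A.
        ext_d3 \<gamma> X Y Z W = 0)"

definition parallel_form3 ::
    "('a, 'e::euclidean_space) atlas \<Rightarrow> ('a vfield \<Rightarrow> 'a vfield \<Rightarrow> 'a vfield) \<Rightarrow>
     ('a vfield \<Rightarrow> 'a vfield \<Rightarrow> 'a vfield \<Rightarrow> 'a \<Rightarrow> real) \<Rightarrow> bool" where
  "parallel_form3 A D \<gamma> \<longleftrightarrow>
     (\<forall>W\<in>vector_fields A. \<forall>X\<in>vector_fields A. \<forall>Y\<in>vector_fields A. \<forall>Z\<in>vector_fields A.
        nabla_form3 D \<gamma> W X Y Z = 0)"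

definition first_bianchi ::
    "('a, 'e::euclidean_space) atlas \<Rightarrow> ('a vfield \<Rightarrow> 'a vfield \<Rightarrow> 'a vfield) \<Rightarrow> bool" where
  "first_bianchi A D \<longleftrightarrow>
     (\<forall>X\<in>vector_fields A. \<forall>Y\<in>vector_fields A. \<forall>Z\<in>vector_fields A.
        curvature D X Y Z + curvature D Y Z X + curvature D Z X Y = 0)"


section \<open>Sasaki with torsion manifolds\<close>

text \<open>
  The connection \<open>D\<close> is specified by its defining properties, which determine it uniquely;
  that \<open>g(D\<^sub>X Y, Z)\<close> is the Levi-Civita term plus half of \<^const>\<open>torsion_form\<close> is a consequence.
\<close>

definition sasaki_with_torsion ::
    "('a::{t2_space, second_countable_topology}, 'e::euclidean_space) atlas \<Rightarrow>
     ('a \<Rightarrow> 'a tvec \<Rightarrow> 'a tvec) \<Rightarrow> 'a vfield \<Rightarrow> ('a \<Rightarrow> 'a tvec \<Rightarrow> real) \<Rightarrow>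
     ('a \<Rightarrow> 'a tvec \<Rightarrow> 'a tvec \<Rightarrow> real) \<Rightarrow> ('a vfield \<Rightarrow> 'a vfield \<Rightarrow> 'a vfield) \<Rightarrow> bool" where
  "sasaki_with_torsion A \<phi> \<xi> \<eta> g D \<longleftrightarrow>
     connected_manifold A \<and> (\<exists>n::nat. DIM('e) = 2 * n + 1) \<and>
     almost_contact_metric A \<phi> \<xi> \<eta> g \<and> normal_structure A \<phi> \<xi> \<eta> \<and> killing A g \<xi> \<and>
     metric_connection A g D \<and> skew_torsion A g D \<and>
     (\<forall>X\<in>vector_fields A. \<forall>Y\<in>vector_fields A. nabla_endo D \<phi> X Y = 0) \<and>
     (\<forall>X\<in>vector_fields A. \<forall>Y\<in>vector_fields A. nabla_form1 D (ap1 \<eta>) X Y = 0)"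

end

theory Submission
  imports Defs "HOL-Computational_Algebra.Polynomial"
begin

text \<open>
  Parallelism of \<open>\<eta>\<close> and \<open>\<phi>\<close> turns \<open>d\<eta>\<close> and \<open>dF\<close> into contractions of the torsion \<open>T\<close>, and normality then
  identifies \<open>H\<close> with \<open>g(T(X, Y), Z)\<close>. With \<open>a = \<nabla>T\<close> and \<open>\<sigma>\<close> the cyclic sum of
  \<open>g(T(X, Y), T(Z, W))\<close>, the cyclic sum of the curvature is the cyclic sum of \<open>a\<close> plus \<open>\<sigma>\<close>, while
  \<open>dH\<close> is the alternation of \<open>a\<close> plus \<open>2\<sigma>\<close>. If \<open>dH = 0\<close> and \<open>a = 0\<close>, then \<open>\<sigma> = 0\<close> and the Bianchi
  identity holds.

  Conversely the Bianchi identity forces \<open>a = - \<sigma> / 3\<close>, a 4-form, and it remains to show \<open>a = 0\<close>. Since \<open>\<phi>\<close>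
  and \<open>\<eta>\<close> are parallel, \<open>a\<close> is horizontal of type (2,2). Pair symmetry of the curvature gives
  \<open>R(\<phi>X, \<phi>Y) = R(X, Y)\<close>, so the (2,0)-part of the Ricci identity for \<open>T\<close> does not involve the curvature. Let \<open>c\<close>
  be the (2,1)-part of \<open>T\<close>, regarded as a bracket on (1,0)-vectors. It satisfies the Jacobi identity,
  because \<open>\<sigma>\<close> has no (3,1)-part. The derivative of this identity, the Ricci identity and the constancy of \<open>|T|\<close> are
  linear relations between the four full contractions of \<open>c\<close>, its conjugate and \<open>a\<close>, and
  they force these to vanish. Since \<open>3|a|\<^sup>2 = - \<langle>a, \<sigma>\<rangle>\<close> is a combination of such contractions, \<open>a = 0\<close>.
\<close>

section \<open>Contractions of a bracket with a curvature-like tensor\<close>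

text \<open>The Reeb direction is the first obstacle: \<open>T(X, Y, \<xi>) = d\<eta>(X, Y)\<close>
  does not vanish on horizontal vectors, so \<open>\<sigma>\<close> contains products of two values
  of \<open>d\<eta>\<close>, whereas the complex algebra only sees horizontal contractions. Since
  \<open>R(\<xi>, Y) = 0\<close>, the Ricci identity gives
  \<open>a(T(\<xi>, Y), U, V, W) = 0\<close>, and these products drop out of every contraction with
  \<open>a\<close>.

  The second is to produce enough relations. Tracing the upper index of \<open>c\<close> or
  \<open>B\<close> against a lower one and contracting the rest with the conjugate bracket can be
  done in two ways for the Ricci identity and in two for the derived Jacobi identity. Constancy of
  \<open>|T|\<close> removes the terms with the trace of \<open>c\<close>, and the four remaining
  equations in four unknowns have full rank.

  Finally, tensors are given on global fields, without local frames. A finite family of global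
  horizontal fields that is orthonormal at the point serves instead. It exists because a derivation
  at a point is determined by finitely many smooth functions, whence the detour through bump
  functions and Hadamard's lemma.\<close>

text \<open>
  In the application \<open>c k i j\<close> is the (1,0)-bracket with upper index \<open>k\<close>, \<open>d\<close> its conjugate and \<open>B k l i j\<close> the
  (2,2)-form \<open>\<nabla>T\<close> with upper indices \<open>k\<close>, \<open>l\<close>.
\<close>

lemma contraction_vanish:
  fixes c d :: "'i \<Rightarrow> 'i \<Rightarrow> 'i \<Rightarrow> 'b::field_char_0" and B :: "'i \<Rightarrow> 'i \<Rightarrow> 'i \<Rightarrow> 'i \<Rightarrow> 'b"
  assumes c: "\<And>k i j. c k j i = - c k i j" and d: "\<And>k i j. d k j i = - d k i j"
    and B1: "\<And>k l i j. B l k i j = - B k l i j" and B2: "\<And>k l i j. B k l j i = - B k l i j"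
    and ricci: "\<And>k l x y p. (\<Sum>m\<in>I. c k x m * B m l y p + c l x m * B k m y p
        - c k y m * B m l x p - c l y m * B k m x p
        + 2 * c k p m * B m l x y + 2 * c l p m * B k m x y
        + c m y p * B k l x m - c m x p * B k l y m - 3 * c m x y * B k l m p) = 0"
    and cocycle: "\<And>x k i j p. (\<Sum>m\<in>I. B x m i j * c k m p + c m i j * B x k m p
        + B x m j p * c k m i + c m j p * B x k m i + B x m p i * c k m j + c m p i * B x k m j) = 0"
    and ortho: "\<And>x. (\<Sum>i\<in>I. \<Sum>j\<in>I. \<Sum>l\<in>I. B x l i j * d l i j) = 0"
  shows "(\<Sum>x\<in>I. \<Sum>y\<in>I. \<Sum>p\<in>I. \<Sum>l\<in>I. \<Sum>m\<in>I. c l p m * d l x y * B p m x y) = 0"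
    and "(\<Sum>x\<in>I. \<Sum>y\<in>I. \<Sum>p\<in>I. \<Sum>l\<in>I. \<Sum>m\<in>I. c m p x * d l x y * B p l m y) = 0"
proof -
  define S :: "('i \<Rightarrow> 'i \<Rightarrow> 'i \<Rightarrow> 'i \<Rightarrow> 'i \<Rightarrow> 'b) \<Rightarrow> 'b"
    where "S F = (\<Sum>x\<in>I. \<Sum>y\<in>I. \<Sum>p\<in>I. \<Sum>l\<in>I. \<Sum>m\<in>I. F x y p l m)" for F
  have S5: "S F = (\<Sum>(x, y, p, l, m)\<in>I \<times> I \<times> I \<times> I \<times> I. F x y p l m)" for F
    by (simp add: S_def sum.cartesian_product)
  have Sadd: "S (\<lambda>x y p l m. F x y p l m + G x y p l m) = S F + S G" for F G
    by (simp add: S_def sum.distrib)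
  have Ssub: "S (\<lambda>x y p l m. F x y p l m - G x y p l m) = S F - S G" for F G
    by (simp add: S_def sum_subtractf)
  have Scm: "S (\<lambda>x y p l m. a * F x y p l m) = a * S F" for F a
    by (simp add: S_def sum_distrib_left)
  have Sdir: "S F = 0" if "\<And>x y p l. (\<Sum>m\<in>I. F x y p l m) = 0" for F
    by (simp add: S_def that)
  define \<alpha> where "\<alpha> = S (\<lambda>x y p l m. c l p m * d l x y * B p m x y)"
  define \<beta> where "\<beta> = S (\<lambda>x y p l m. c m p x * d l x y * B p l m y)"
  define \<tau>1 where "\<tau>1 = S (\<lambda>x y p l m. c m x y * d l x y * B p l p m)"
  define \<tau>2 where "\<tau>2 = S (\<lambda>x y p l m. c l p m * d l p y * B x m x y)"

  \<comment> \<open>Each skew tensor is written as the antisymmetrisation of an unrestricted one.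
    Expanding with \<open>skew\<close> then settles all signs by terminating rewriting, which the
    symmetry laws used as rewrite rules would not do.\<close>
  obtain c' where c': "\<And>k i j. c k i j = c' k i j - c' k j i"
  proof
    show "c k i j = c k i j / 2 - c k j i / 2" for k i j
      unfolding c[of k j i] by (simp add: field_simps)
  qed
  obtain d' where d': "\<And>k i j. d k i j = d' k i j - d' k j i"
  proof
    show "d k i j = d k i j / 2 - d k j i / 2" for k i j
      unfolding d[of k j i] by (simp add: field_simps)
  qed
  obtain B' where B': "\<And>k l i j. B k l i j = B' k l i j - B' l k i j - B' k l j i + B' l k j i"
  proof
    show "B k l i j = B k l i j / 4 - B l k i j / 4 - B k l j i / 4 + B l k j i / 4" for k l i j
      unfolding B1[of l k] B2[of k l j i] B2[of l k j i] by (simp add: field_simps B1[of l k i j])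
  qed
  define \<theta> where "\<theta> = S (\<lambda>x y p l m. c p p m * d l x y * B m l x y)"
  define \<theta> where "\<theta> = S (\<lambda>x y p l m. c p p m * d l x y * B m l x y)"
  define \<theta> where "\<theta> = S (\<lambda>x y p l m. c p p m * d l x y * B m l x y)"
  note skew = c' d' B' algebra_simps

  \<comment> \<open>The trace \<open>c p p m\<close> occurs only next to the full contraction of
    \<open>B m\<close> with \<open>d\<close>, which \<open>ortho\<close> annihilates. This removes
    \<open>\<theta>\<close> from all relations below.\<close>
  have ortho': "S (\<lambda>x y p l m. f p m * (B m l x y * d l x y)) = 0" for f
  proof -
    have "S (\<lambda>x y p l m. f p m * (B m l x y * d l x y))
        = (\<Sum>(p, m, x, y, l)\<in>I \<times> I \<times> I \<times> I \<times> I. f p m * (B m l x y * d l x y))"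
      unfolding S5
      by (rule sum.reindex_bij_witness[where i="\<lambda>(p, m, x, y, l). (x, y, p, l, m)"
            and j="\<lambda>(x, y, p, l, m). (p, m, x, y, l)"]) auto
    also have "\<dots> = (\<Sum>p\<in>I. \<Sum>m\<in>I. f p m * (\<Sum>x\<in>I. \<Sum>y\<in>I. \<Sum>l\<in>I. B m l x y * d l x y))"
      by (simp add: sum.cartesian_product[symmetric] sum_distrib_left)
    finally show ?thesis by (simp add: ortho)
  qed
  have "\<theta> = 0"
    unfolding \<theta>_def using ortho'[of "\<lambda>p m. c p p m"] by (simp add: mult_ac)
  have "\<theta> = 0"
    unfolding \<theta>_def using ortho'[of "\<lambda>p m. c p p m"] by (simp add: mult_ac)
  have "\<theta> = 0"
    unfolding \<theta>_def using ortho'[of "\<lambda>p m. c p p m"] by (simp add: mult_ac)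

  \<comment> \<open>The Ricci identity with \<open>k\<close> traced against \<open>p\<close>, the
    remaining indices contracted with \<open>d l x y\<close>. Each of its nine terms is one of the
    unknowns up to sign.\<close>
  have r10: "S (\<lambda>x y p l m. c p x m * d l x y * B m l y p) = \<beta>"
    unfolding \<beta>_def S5
    by (rule sum.reindex_bij_witness[where i="\<lambda>(x, y, p, l, m). (x, y, m, l, p)"
          and j="\<lambda>(x, y, p, l, m). (x, y, m, l, p)"]) (auto simp: skew)
  have r11: "S (\<lambda>x y p l m. c l x m * d l x y * B p m y p) = - \<tau>2"
    unfolding \<tau>2_def sum_negf[symmetric] S5
    by (rule sum.reindex_bij_witness[where i="\<lambda>(x, y, p, l, m). (p, y, x, l, m)"
          and j="\<lambda>(x, y, p, l, m). (p, y, x, l, m)"]) (auto simp: skew)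
  have r12: "S (\<lambda>x y p l m. c p y m * d l x y * B m l x p) = - \<beta>"
    unfolding \<beta>_def sum_negf[symmetric] S5
    by (rule sum.reindex_bij_witness[where i="\<lambda>(x, y, p, l, m). (y, x, m, l, p)"
          and j="\<lambda>(x, y, p, l, m). (y, x, m, l, p)"]) (auto simp: skew)
  have r13: "S (\<lambda>x y p l m. c l y m * d l x y * B p m x p) = \<tau>2"
    unfolding \<tau>2_def S5
    by (rule sum.reindex_bij_witness[where i="\<lambda>(x, y, p, l, m). (y, p, x, l, m)"
          and j="\<lambda>(x, y, p, l, m). (p, x, y, l, m)"]) (auto simp: skew)
  have r14: "S (\<lambda>x y p l m. c p p m * d l x y * B m l x y) = \<theta>"
    unfolding \<theta>_def S5
    by (rule sum.reindex_bij_witness[where i="\<lambda>(x, y, p, l, m). (x, y, p, l, m)"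
          and j="\<lambda>(x, y, p, l, m). (x, y, p, l, m)"]) (auto simp: skew)
  have r15: "S (\<lambda>x y p l m. c l p m * d l x y * B p m x y) = \<alpha>"
    unfolding \<alpha>_def S5
    by (rule sum.reindex_bij_witness[where i="\<lambda>(x, y, p, l, m). (x, y, p, l, m)"
          and j="\<lambda>(x, y, p, l, m). (x, y, p, l, m)"]) (auto simp: skew)
  have r16: "S (\<lambda>x y p l m. c m y p * d l x y * B p l x m) = - \<beta>"
    unfolding \<beta>_def sum_negf[symmetric] S5
    by (rule sum.reindex_bij_witness[where i="\<lambda>(x, y, p, l, m). (y, x, p, l, m)"
          and j="\<lambda>(x, y, p, l, m). (y, x, p, l, m)"]) (auto simp: skew)
  have r17: "S (\<lambda>x y p l m. c m x p * d l x y * B p l y m) = \<beta>"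
    unfolding \<beta>_def S5
    by (rule sum.reindex_bij_witness[where i="\<lambda>(x, y, p, l, m). (x, y, p, l, m)"
          and j="\<lambda>(x, y, p, l, m). (x, y, p, l, m)"]) (auto simp: skew)
  have r18: "S (\<lambda>x y p l m. c m x y * d l x y * B p l m p) = - \<tau>1"
    unfolding \<tau>1_def sum_negf[symmetric] S5
    by (rule sum.reindex_bij_witness[where i="\<lambda>(x, y, p, l, m). (x, y, p, l, m)"
          and j="\<lambda>(x, y, p, l, m). (x, y, p, l, m)"]) (auto simp: skew)
  have "S (\<lambda>x y p l m. d l x y *
      (c p x m * B m l y p + c l x m * B p m y p - c p y m * B m l x p - c l y m * B p m x p
       + 2 * c p p m * B m l x y + 2 * c l p m * B p m x y + c m y p * B p l x m
       - c m x p * B p l y m - 3 * c m x y * B p l m p)) = 0"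
    by (rule Sdir) (simp only: sum_distrib_left[symmetric] ricci mult_zero_right)
  moreover have "S (\<lambda>x y p l m. d l x y *
      (c p x m * B m l y p + c l x m * B p m y p - c p y m * B m l x p - c l y m * B p m x p
       + 2 * c p p m * B m l x y + 2 * c l p m * B p m x y + c m y p * B p l x m
       - c m x p * B p l y m - 3 * c m x y * B p l m p)) =
      S (\<lambda>x y p l m. c p x m * d l x y * B m l y p)
      + S (\<lambda>x y p l m. c l x m * d l x y * B p m y p)
      - S (\<lambda>x y p l m. c p y m * d l x y * B m l x p)
      - S (\<lambda>x y p l m. c l y m * d l x y * B p m x p)
      + 2 * S (\<lambda>x y p l m. c p p m * d l x y * B m l x y)
      + 2 * S (\<lambda>x y p l m. c l p m * d l x y * B p m x y)
      + S (\<lambda>x y p l m. c m y p * d l x y * B p l x m)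
      - S (\<lambda>x y p l m. c m x p * d l x y * B p l y m)
      - 3 * S (\<lambda>x y p l m. c m x y * d l x y * B p l m p)"
    unfolding Scm[symmetric] Sadd[symmetric] Ssub[symmetric]
    by (rule arg_cong[of _ _ S]) (simp add: algebra_simps)
  ultimately have r1: "2 * \<alpha> - 2 * \<tau>2 + 3 * \<tau>1 = 0"
    unfolding r10 r11 r12 r13 r14 r15 r16 r17 r18 using \<open>\<theta> = 0\<close> by (simp add: algebra_simps)

  \<comment> \<open>The Ricci identity again, now with \<open>k\<close> traced against
    \<open>x\<close> and the rest contracted with \<open>d l p y\<close>.\<close>
  have r20: "S (\<lambda>x y p l m. c x x m * d l p y * B m l y p) = - \<theta>"
    unfolding \<theta>_def sum_negf[symmetric] S5
    by (rule sum.reindex_bij_witness[where i="\<lambda>(x, y, p, l, m). (p, x, y, l, m)"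
          and j="\<lambda>(x, y, p, l, m). (y, p, x, l, m)"]) (auto simp: skew)
  have r21: "S (\<lambda>x y p l m. c l x m * d l p y * B x m y p) = - \<alpha>"
    unfolding \<alpha>_def sum_negf[symmetric] S5
    by (rule sum.reindex_bij_witness[where i="\<lambda>(x, y, p, l, m). (p, x, y, l, m)"
          and j="\<lambda>(x, y, p, l, m). (y, p, x, l, m)"]) (auto simp: skew)
  have r22: "S (\<lambda>x y p l m. c x y m * d l p y * B m l x p) = \<beta>"
    unfolding \<beta>_def S5
    by (rule sum.reindex_bij_witness[where i="\<lambda>(x, y, p, l, m). (m, x, y, l, p)"
          and j="\<lambda>(x, y, p, l, m). (y, p, m, l, x)"]) (auto simp: skew)
  have r23: "S (\<lambda>x y p l m. c l y m * d l p y * B x m x p) = - \<tau>2"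
    unfolding \<tau>2_def sum_negf[symmetric] S5
    by (rule sum.reindex_bij_witness[where i="\<lambda>(x, y, p, l, m). (x, p, y, l, m)"
          and j="\<lambda>(x, y, p, l, m). (x, p, y, l, m)"]) (auto simp: skew)
  have r24: "S (\<lambda>x y p l m. c x p m * d l p y * B m l x y) = - \<beta>"
    unfolding \<beta>_def sum_negf[symmetric] S5
    by (rule sum.reindex_bij_witness[where i="\<lambda>(x, y, p, l, m). (m, y, x, l, p)"
          and j="\<lambda>(x, y, p, l, m). (p, y, m, l, x)"]) (auto simp: skew)
  have r25: "S (\<lambda>x y p l m. c l p m * d l p y * B x m x y) = \<tau>2"
    unfolding \<tau>2_def S5
    by (rule sum.reindex_bij_witness[where i="\<lambda>(x, y, p, l, m). (x, y, p, l, m)"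
          and j="\<lambda>(x, y, p, l, m). (x, y, p, l, m)"]) (auto simp: skew)
  have r26: "S (\<lambda>x y p l m. c m y p * d l p y * B x l x m) = - \<tau>1"
    unfolding \<tau>1_def sum_negf[symmetric] S5
    by (rule sum.reindex_bij_witness[where i="\<lambda>(x, y, p, l, m). (p, x, y, l, m)"
          and j="\<lambda>(x, y, p, l, m). (y, p, x, l, m)"]) (auto simp: skew)
  have r27: "S (\<lambda>x y p l m. c m x p * d l p y * B x l y m) = - \<beta>"
    unfolding \<beta>_def sum_negf[symmetric] S5
    by (rule sum.reindex_bij_witness[where i="\<lambda>(x, y, p, l, m). (p, y, x, l, m)"
          and j="\<lambda>(x, y, p, l, m). (p, y, x, l, m)"]) (auto simp: skew)
  have r28: "S (\<lambda>x y p l m. c m x y * d l p y * B x l m p) = - \<beta>"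
    unfolding \<beta>_def sum_negf[symmetric] S5
    by (rule sum.reindex_bij_witness[where i="\<lambda>(x, y, p, l, m). (p, x, y, l, m)"
          and j="\<lambda>(x, y, p, l, m). (y, p, x, l, m)"]) (auto simp: skew)
  have "S (\<lambda>x y p l m. d l p y *
      (c x x m * B m l y p + c l x m * B x m y p - c x y m * B m l x p - c l y m * B x m x p
       + 2 * c x p m * B m l x y + 2 * c l p m * B x m x y + c m y p * B x l x m
       - c m x p * B x l y m - 3 * c m x y * B x l m p)) = 0"
    by (rule Sdir) (simp only: sum_distrib_left[symmetric] ricci mult_zero_right)
  moreover have "S (\<lambda>x y p l m. d l p y *
      (c x x m * B m l y p + c l x m * B x m y p - c x y m * B m l x p - c l y m * B x m x p
       + 2 * c x p m * B m l x y + 2 * c l p m * B x m x y + c m y p * B x l x m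
       - c m x p * B x l y m - 3 * c m x y * B x l m p)) =
      S (\<lambda>x y p l m. c x x m * d l p y * B m l y p)
      + S (\<lambda>x y p l m. c l x m * d l p y * B x m y p)
      - S (\<lambda>x y p l m. c x y m * d l p y * B m l x p)
      - S (\<lambda>x y p l m. c l y m * d l p y * B x m x p)
      + 2 * S (\<lambda>x y p l m. c x p m * d l p y * B m l x y)
      + 2 * S (\<lambda>x y p l m. c l p m * d l p y * B x m x y)
      + S (\<lambda>x y p l m. c m y p * d l p y * B x l x m)
      - S (\<lambda>x y p l m. c m x p * d l p y * B x l y m)
      - 3 * S (\<lambda>x y p l m. c m x y * d l p y * B x l m p)"
    unfolding Scm[symmetric] Sadd[symmetric] Ssub[symmetric]
    by (rule arg_cong[of _ _ S]) (simp add: algebra_simps)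
  ultimately have r2: "- \<alpha> + \<beta> + 3 * \<tau>2 - \<tau>1 = 0"
    unfolding r20 r21 r22 r23 r24 r25 r26 r27 r28 using \<open>\<theta> = 0\<close> by (simp add: algebra_simps)

  \<comment> \<open>The cocycle identity with the free upper index of \<open>B\<close> traced
    against \<open>p\<close> and that of \<open>c\<close> contracted with \<open>d\<close>.\<close>
  have k10: "S (\<lambda>x y p l m. c l m p * d l x y * B p m x y) = - \<alpha>"
    unfolding \<alpha>_def sum_negf[symmetric] S5
    by (rule sum.reindex_bij_witness[where i="\<lambda>(x, y, p, l, m). (x, y, p, l, m)"
          and j="\<lambda>(x, y, p, l, m). (x, y, p, l, m)"]) (auto simp: skew)
  have k11: "S (\<lambda>x y p l m. c m x y * d l x y * B p l m p) = - \<tau>1"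
    unfolding \<tau>1_def sum_negf[symmetric] S5
    by (rule sum.reindex_bij_witness[where i="\<lambda>(x, y, p, l, m). (x, y, p, l, m)"
          and j="\<lambda>(x, y, p, l, m). (x, y, p, l, m)"]) (auto simp: skew)
  have k12: "S (\<lambda>x y p l m. c l m x * d l x y * B p m y p) = \<tau>2"
    unfolding \<tau>2_def S5
    by (rule sum.reindex_bij_witness[where i="\<lambda>(x, y, p, l, m). (p, y, x, l, m)"
          and j="\<lambda>(x, y, p, l, m). (p, y, x, l, m)"]) (auto simp: skew)
  have k13: "S (\<lambda>x y p l m. c m y p * d l x y * B p l m x) = \<beta>"
    unfolding \<beta>_def S5
    by (rule sum.reindex_bij_witness[where i="\<lambda>(x, y, p, l, m). (y, x, p, l, m)"
          and j="\<lambda>(x, y, p, l, m). (y, x, p, l, m)"]) (auto simp: skew)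
  have k14: "S (\<lambda>x y p l m. c l m y * d l x y * B p m p x) = \<tau>2"
    unfolding \<tau>2_def S5
    by (rule sum.reindex_bij_witness[where i="\<lambda>(x, y, p, l, m). (y, p, x, l, m)"
          and j="\<lambda>(x, y, p, l, m). (p, x, y, l, m)"]) (auto simp: skew)
  have k15: "S (\<lambda>x y p l m. c m p x * d l x y * B p l m y) = \<beta>"
    unfolding \<beta>_def S5
    by (rule sum.reindex_bij_witness[where i="\<lambda>(x, y, p, l, m). (x, y, p, l, m)"
          and j="\<lambda>(x, y, p, l, m). (x, y, p, l, m)"]) (auto simp: skew)
  have "S (\<lambda>x y p l m. d l x y *
      (B p m x y * c l m p + c m x y * B p l m p + B p m y p * c l m x + c m y p * B p l m x
       + B p m p x * c l m y + c m p x * B p l m y)) = 0"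
    by (rule Sdir) (simp only: sum_distrib_left[symmetric] cocycle mult_zero_right)
  moreover have "S (\<lambda>x y p l m. d l x y *
      (B p m x y * c l m p + c m x y * B p l m p + B p m y p * c l m x + c m y p * B p l m x
       + B p m p x * c l m y + c m p x * B p l m y)) =
      S (\<lambda>x y p l m. c l m p * d l x y * B p m x y)
      + S (\<lambda>x y p l m. c m x y * d l x y * B p l m p)
      + S (\<lambda>x y p l m. c l m x * d l x y * B p m y p)
      + S (\<lambda>x y p l m. c m y p * d l x y * B p l m x)
      + S (\<lambda>x y p l m. c l m y * d l x y * B p m p x)
      + S (\<lambda>x y p l m. c m p x * d l x y * B p l m y)"
    unfolding Scm[symmetric] Sadd[symmetric] Ssub[symmetric]
    by (rule arg_cong[of _ _ S]) (simp add: algebra_simps)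
  ultimately have k1: "2 * \<tau>2 + 2 * \<beta> - \<alpha> - \<tau>1 = 0"
    unfolding k10 k11 k12 k13 k14 k15 using \<open>\<theta> = 0\<close> by (simp add: algebra_simps)

  \<comment> \<open>The cocycle identity with the two upper indices exchanged: that of
    \<open>c\<close> is traced, that of \<open>B\<close> meets \<open>d\<close>. All
    \<open>\<beta>\<close>-terms cancel and \<open>\<tau>1\<close> is isolated.\<close>
  have k20: "S (\<lambda>x y p l m. c p m p * d l x y * B l m x y) = \<theta>"
    unfolding \<theta>_def S5
    by (rule sum.reindex_bij_witness[where i="\<lambda>(x, y, p, l, m). (x, y, p, l, m)"
          and j="\<lambda>(x, y, p, l, m). (x, y, p, l, m)"]) (auto simp: skew)
  have k21: "S (\<lambda>x y p l m. c m x y * d l x y * B l p m p) = \<tau>1"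
    unfolding \<tau>1_def S5
    by (rule sum.reindex_bij_witness[where i="\<lambda>(x, y, p, l, m). (x, y, p, l, m)"
          and j="\<lambda>(x, y, p, l, m). (x, y, p, l, m)"]) (auto simp: skew)
  have k22: "S (\<lambda>x y p l m. c p m x * d l x y * B l m y p) = \<beta>"
    unfolding \<beta>_def S5
    by (rule sum.reindex_bij_witness[where i="\<lambda>(x, y, p, l, m). (x, y, m, l, p)"
          and j="\<lambda>(x, y, p, l, m). (x, y, m, l, p)"]) (auto simp: skew)
  have k23: "S (\<lambda>x y p l m. c m y p * d l x y * B l p m x) = - \<beta>"
    unfolding \<beta>_def sum_negf[symmetric] S5
    by (rule sum.reindex_bij_witness[where i="\<lambda>(x, y, p, l, m). (y, x, p, l, m)"
          and j="\<lambda>(x, y, p, l, m). (y, x, p, l, m)"]) (auto simp: skew)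
  have k24: "S (\<lambda>x y p l m. c p m y * d l x y * B l m p x) = \<beta>"
    unfolding \<beta>_def S5
    by (rule sum.reindex_bij_witness[where i="\<lambda>(x, y, p, l, m). (y, x, m, l, p)"
          and j="\<lambda>(x, y, p, l, m). (y, x, m, l, p)"]) (auto simp: skew)
  have k25: "S (\<lambda>x y p l m. c m p x * d l x y * B l p m y) = - \<beta>"
    unfolding \<beta>_def sum_negf[symmetric] S5
    by (rule sum.reindex_bij_witness[where i="\<lambda>(x, y, p, l, m). (x, y, p, l, m)"
          and j="\<lambda>(x, y, p, l, m). (x, y, p, l, m)"]) (auto simp: skew)
  have "S (\<lambda>x y p l m. d l x y *
      (B l m x y * c p m p + c m x y * B l p m p + B l m y p * c p m x + c m y p * B l p m x
       + B l m p x * c p m y + c m p x * B l p m y)) = 0"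
    by (rule Sdir) (simp only: sum_distrib_left[symmetric] cocycle mult_zero_right)
  moreover have "S (\<lambda>x y p l m. d l x y *
      (B l m x y * c p m p + c m x y * B l p m p + B l m y p * c p m x + c m y p * B l p m x
       + B l m p x * c p m y + c m p x * B l p m y)) =
      S (\<lambda>x y p l m. c p m p * d l x y * B l m x y)
      + S (\<lambda>x y p l m. c m x y * d l x y * B l p m p)
      + S (\<lambda>x y p l m. c p m x * d l x y * B l m y p)
      + S (\<lambda>x y p l m. c m y p * d l x y * B l p m x)
      + S (\<lambda>x y p l m. c p m y * d l x y * B l m p x)
      + S (\<lambda>x y p l m. c m p x * d l x y * B l p m y)"
    unfolding Scm[symmetric] Sadd[symmetric] Ssub[symmetric]
    by (rule arg_cong[of _ _ S]) (simp add: algebra_simps)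
  ultimately have k2: "\<tau>1 = 0"
    unfolding k20 k21 k22 k23 k24 k25 using \<open>\<theta> = 0\<close> by (simp add: algebra_simps)

  from r1 k2 have t: "\<tau>2 = \<alpha>" by simp
  have b: "\<beta> = - 2 * \<alpha>" using r2 unfolding t k2 by (simp add: eq_neg_iff_add_eq_0 algebra_simps)
  have "3 * \<alpha> = 0" using k1 unfolding t k2 b by (simp add: algebra_simps)
  then have "\<alpha> = 0" by simp
  with b have "\<alpha> = 0" "\<beta> = 0" by simp_all
  then show
    "(\<Sum>x\<in>I. \<Sum>y\<in>I. \<Sum>p\<in>I. \<Sum>l\<in>I. \<Sum>m\<in>I. c l p m * d l x y * B p m x y) = 0"
    "(\<Sum>x\<in>I. \<Sum>y\<in>I. \<Sum>p\<in>I. \<Sum>l\<in>I. \<Sum>m\<in>I. c m p x * d l x y * B p l m y) = 0"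
    by (simp_all add: \<alpha>_def \<beta>_def S_def)
qed

lemma sum_rotate: "(\<Sum>k\<in>A. \<Sum>j\<in>L. \<Sum>i\<in>M. X k j i) = (\<Sum>i\<in>M. \<Sum>k\<in>A. \<Sum>j\<in>L. X k j i)"
  by (subst sum.swap[of _ M L], subst sum.swap[of _ M A]) (rule refl)

section \<open>The pointwise algebra of the torsion\<close>

text \<open>
  The type \<open>'v\<close> of vectors carries no linear structure: all linearity that is needed is contained in the
  behaviour of \<open>T\<close> and \<open>a\<close> under \<open>J\<close> and in the contractions over the family \<open>E\<close>. The identities
  \<open>T_type\<close> and \<open>a_type\<close> exclude the types (3,0) and (0,3).
\<close>

locale pointwise_torsion =
  fixes T :: "'v \<Rightarrow> 'v \<Rightarrow> 'v \<Rightarrow> real" and a :: "'v \<Rightarrow> 'v \<Rightarrow> 'v \<Rightarrow> 'v \<Rightarrow> real"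
    and J :: "'v \<Rightarrow> 'v" and E :: "'i \<Rightarrow> 'v" and I :: "'i set"
  assumes T12: "T y x z = - T x y z" and T23: "T x z y = - T x y z"
    and a12: "a y x z w = - a x y z w" and a23: "a x z y w = - a x y z w"
    and a34: "a x y w z = - a x y z w"
    and TJ: "T (J (J x)) y z = - T x y z" and aJ: "a (J (J x)) y z w = - a x y z w"
    and T_type: "T x y z = T (J x) (J y) z + T (J x) y (J z) + T x (J y) (J z)"
    and a_type: "a w x y z = a w (J x) (J y) z + a w (J x) y (J z) + a w x (J y) (J z)"
    and TT_frame: "(\<Sum>i\<in>I. T x y (J (E i)) * T z w (J (E i))) = (\<Sum>i\<in>I. T x y (E i) * T z w (E i))"
    and aT_frame: "(\<Sum>i\<in>I. a x y z (J (E i)) * T u v (J (E i))) = (\<Sum>i\<in>I. a x y z (E i) * T u v (E i))"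
begin

definition K :: "'v \<Rightarrow> 'v \<Rightarrow> 'v \<Rightarrow> 'v \<Rightarrow> 'v \<Rightarrow> real" where
  "K x y z u v = (\<Sum>i\<in>I. a x y z (E i) * T u v (E i))"

text \<open>\<open>K\<close> is \<open>g(a(x, y, z), T(u, v))\<close>, and \<open>dsigma w\<close> is the derivative of \<open>\<sigma>\<close> if \<open>a w\<close> is that of \<open>T\<close>.\<close>

definition dsigma :: "'v \<Rightarrow> 'v \<Rightarrow> 'v \<Rightarrow> 'v \<Rightarrow> 'v \<Rightarrow> real" where
  "dsigma w x y z v =
     K w x y z v + K w z v x y + K w y z x v + K w x v y z + K w z x y v + K w y v z x"

text \<open>
  Restricts a functional to vectors of type (1,0) (\<open>True\<close>) or (0,1) (\<open>False\<close>); it is twice the projection,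
  whence the powers of 4 in the contraction formulas.
\<close>

definition pr :: "bool \<Rightarrow> ('v \<Rightarrow> complex) \<Rightarrow> 'v \<Rightarrow> complex" where
  "pr b f x = (if b then f x - \<i> * f (J x) else f x + \<i> * f (J x))"

section \<open>Complex components and their contraction over the frame\<close>

definition Th :: "bool \<Rightarrow> bool \<Rightarrow> bool \<Rightarrow> 'v \<Rightarrow> 'v \<Rightarrow> 'v \<Rightarrow> complex" where
  "Th p q r x y z = pr r (\<lambda>z. pr q (\<lambda>y. pr p (\<lambda>x. of_real (T x y z)) x) y) z"

definition ah :: "bool \<Rightarrow> bool \<Rightarrow> bool \<Rightarrow> bool \<Rightarrow> 'v \<Rightarrow> 'v \<Rightarrow> 'v \<Rightarrow> 'v \<Rightarrow> complex" where
  "ah p q r s x y z w =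
     pr s (\<lambda>w. pr r (\<lambda>z. pr q (\<lambda>y. pr p (\<lambda>x. of_real (a x y z w)) x) y) z) w"

definition ext5 :: "('v \<Rightarrow> 'v \<Rightarrow> 'v \<Rightarrow> 'v \<Rightarrow> 'v \<Rightarrow> real) \<Rightarrow> bool \<Rightarrow> bool \<Rightarrow> bool \<Rightarrow> bool \<Rightarrow> bool \<Rightarrow>
    'v \<Rightarrow> 'v \<Rightarrow> 'v \<Rightarrow> 'v \<Rightarrow> 'v \<Rightarrow> complex" where
  "ext5 F p q r s t x y z u v =
     pr t (\<lambda>v. pr s (\<lambda>u. pr r (\<lambda>z. pr q (\<lambda>y. pr p (\<lambda>x. of_real (F x y z u v)) x) y) z) u) v"

text \<open>The two products of components of equal type add up to
  \<open>2 (f g - (f J) (g J))\<close>. This invariance is therefore exactly what makes them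
  disappear under the sum, as for the complex bilinear extension of a Hermitian metric.\<close>

definition compat :: "('v \<Rightarrow> complex) \<Rightarrow> ('v \<Rightarrow> complex) \<Rightarrow> bool" where
  "compat f g \<longleftrightarrow> (\<Sum>i\<in>I. f (J (E i)) * g (J (E i))) = (\<Sum>i\<in>I. f (E i) * g (E i))"

lemma compat_sym: "compat f g \<Longrightarrow> compat g f"
  by (simp add: compat_def mult.commute)

lemma compat_scale1: "compat f g \<Longrightarrow> compat (\<lambda>m. c * f m) g"
  "compat f g \<Longrightarrow> compat (\<lambda>m. f m * c) g"
  unfolding compat_def by (simp_all add: ac_simps sum_distrib_left[symmetric])

lemma compat_add1: "compat f g \<Longrightarrow> compat h g \<Longrightarrow> compat (\<lambda>m. f m + h m) g"
  and compat_diff1: "compat f g \<Longrightarrow> compat h g \<Longrightarrow> compat (\<lambda>m. f m - h m) g"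
  unfolding compat_def by (simp_all add: algebra_simps sum.distrib sum_subtractf)

lemma compat_pr1: "(\<And>x. compat (\<lambda>m. F x m) g) \<Longrightarrow> compat (\<lambda>m. pr b (\<lambda>x. F x m) x) g"
  unfolding pr_def by (cases b) (simp_all add: compat_add1 compat_diff1 compat_scale1)

lemma compat_pr2: "(\<And>x. compat f (\<lambda>m. F x m)) \<Longrightarrow> compat f (\<lambda>m. pr b (\<lambda>x. F x m) x)"
  by (rule compat_sym, rule compat_pr1, rule compat_sym)

lemma compat_sum1: "(\<And>x. compat (\<lambda>m. F x m) g) \<Longrightarrow> compat (\<lambda>m. \<Sum>x\<in>X. F x m) g"
  unfolding compat_def
  by (simp add: sum_distrib_right sum.swap[of _ X])

text \<open>The two products of opposite types add up to \<open>2 f g + 2 (f J) (g J)\<close> at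
  each frame vector, and \<open>compat\<close> equates the sums of both parts.\<close>

lemma contract:
  assumes "compat f g"
  shows "(\<Sum>i\<in>I. f (E i) * g (E i)) =
    (\<Sum>i\<in>I. pr True f (E i) * pr False g (E i) + pr False f (E i) * pr True g (E i)) / 4"
proof -
  have "(\<Sum>i\<in>I. pr True f (E i) * pr False g (E i) + pr False f (E i) * pr True g (E i))
      = (\<Sum>i\<in>I. 2 * (f (E i) * g (E i)) + 2 * (f (J (E i)) * g (J (E i))))"
    by (intro sum.cong refl) (simp add: pr_def algebra_simps)
  also have "\<dots> = 4 * (\<Sum>i\<in>I. f (E i) * g (E i))"
    using assms unfolding compat_def sum.distrib sum_distrib_left[symmetric] by simp
  finally show ?thesis by simp
qed

lemma compat_TT: "compat (\<lambda>m. of_real (T x y m)) (\<lambda>m. of_real (T z w m))"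
  unfolding compat_def by (simp add: TT_frame flip: of_real_mult of_real_sum)

lemma compat_aT: "compat (\<lambda>m. of_real (a x y z m)) (\<lambda>m. of_real (T u v m))"
  unfolding compat_def by (simp add: aT_frame flip: of_real_mult of_real_sum)

lemma pr_sum: "pr b (\<lambda>x. \<Sum>i\<in>I. F i x) x = (\<Sum>i\<in>I. pr b (F i) x)"
  by (simp add: pr_def sum.distrib sum_subtractf sum_distrib_left)

lemma pr_scale: "pr b (\<lambda>x. c * f x) x = c * pr b f x" "pr b (\<lambda>x. f x * c) x = pr b f x * c"
  by (simp_all add: pr_def algebra_simps)

lemma pr_add: "pr b (\<lambda>x. f x + g x) x = pr b f x + pr b g x"
  and pr_diff: "pr b (\<lambda>x. f x - g x) x = pr b f x - pr b g x"
  by (simp_all add: pr_def algebra_simps)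

lemma ext5_K:
  "ext5 K p q r s t x y z u v =
    (\<Sum>i\<in>I. ah p q r True x y z (E i) * Th s t False u v (E i)
           + ah p q r False x y z (E i) * Th s t True u v (E i)) / 4"
proof -
  have "ext5 K p q r s t x y z u v =
     (\<Sum>i\<in>I. pr r (\<lambda>z. pr q (\<lambda>y. pr p (\<lambda>x. of_real (a x y z (E i))) x) y) z *
        pr t (\<lambda>v. pr s (\<lambda>u. of_real (T u v (E i))) u) v)"
    unfolding ext5_def K_def by (simp add: pr_sum pr_scale)
  also have "\<dots> = (\<Sum>i\<in>I. ah p q r True x y z (E i) * Th s t False u v (E i)
           + ah p q r False x y z (E i) * Th s t True u v (E i)) / 4"
    unfolding ah_def Th_def
    by (rule contract) (intro compat_pr1 compat_pr2 compat_aT)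
  finally show ?thesis .
qed

lemma TJ2: "T x (J (J y)) z = - T x y z" by (metis T12 TJ)
lemma TJ3: "T x y (J (J z)) = - T x y z" by (metis T23 TJ2)
lemma aJ2: "a x (J (J y)) z w = - a x y z w" by (metis a12 aJ)
lemma aJ3: "a x y (J (J z)) w = - a x y z w" by (metis a23 aJ2)
lemma aJ4: "a x y z (J (J w)) = - a x y z w" by (metis a34 aJ3)

lemma Th_swap: "Th q p r y x z = - Th p q r x y z" "Th p r q x z y = - Th p q r x y z"
  unfolding Th_def pr_def
  by (simp_all add: T12[of x y] T12[of "J x" y] T12[of x "J y"] T12[of "J x" "J y"] T23[of _ z y] T23[of _ z "J y"] T23[of _ "J z" y] T23[of _ "J z" "J y"] algebra_simps)

lemma ah_swap: "ah q p r s y x z w = - ah p q r s x y z w" "ah p r q s x z y w = - ah p q r s x y z w"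
  "ah p q s r x y w z = - ah p q r s x y z w"
  unfolding ah_def pr_def
  by (simp_all add: a12[of x y] a12[of "J x" y] a12[of x "J y"] a12[of "J x" "J y"]
     a23[of _ z y] a23[of _ z "J y"] a23[of _ "J z" y] a23[of _ "J z" "J y"]
     a34[of _ _ w z] a34[of _ _ w "J z"] a34[of _ _ "J w" z] a34[of _ _ "J w" "J z"] algebra_simps)

text \<open>The real and imaginary parts of this component are, up to sign, \<open>T_type\<close> at
  \<open>x, y, z\<close> and at \<open>J x, J y, J z\<close>; in the latter \<open>TJ\<close>
  removes the double applications of \<open>J\<close>.\<close>

lemma Th_same: "Th b b b x y z = 0"
proof -
  have 1: "T x y z - T (J x) (J y) z - T (J x) y (J z) - T x (J y) (J z) = 0"
    using T_type[of x y z] by simp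
  have 2: "T (J x) (J y) (J z) - T (J x) y z - T x (J y) z - T x y (J z) = 0"
    using T_type[of "J x" "J y" "J z"] by (simp add: TJ TJ2 TJ3)
  show ?thesis
    using 1 2 by (auto simp: Th_def pr_def complex_eq_iff)
qed

text \<open>As for \<open>T\<close> in the last three slots. The projection in the first slot mixes
  the equations at \<open>w\<close> and at \<open>J w\<close>, which all hold.\<close>

lemma ah_same: "ah p b b b w x y z = 0"
proof -
  have 1: "a w x y z - a w (J x) (J y) z - a w (J x) y (J z) - a w x (J y) (J z) = 0" for w
    using a_type[of w x y z] by simp
  have 2: "a w (J x) (J y) (J z) - a w (J x) y z - a w x (J y) z - a w x y (J z) = 0" for w
    using a_type[of w "J x" "J y" "J z"] by (simp add: aJ aJ2 aJ3 aJ4)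
  show ?thesis
    using 1[of w] 1[of "J w"] 2[of w] 2[of "J w"] by (auto simp: ah_def pr_def complex_eq_iff)
qed

text \<open>Skew-symmetry moves the exceptional slot to any position, so only components with two
  slots of each type survive.\<close>

lemma ah_same': "ah b p b b x w y z = 0" "ah b b p b x y w z = 0" "ah b b b p x y z w = 0"
proof -
  show 1: "ah b p b b x w y z = 0" for x y w z
    using ah_swap(1)[where q=b and p=p] by (simp add: ah_same)
  show 2: "ah b b p b x y w z = 0" for x y w z
    using ah_swap(2)[where q=p and p=b and r=b] by (simp add: 1)
  show "ah b b b p x y z w = 0"
    using ah_swap(3)[where s=b and r=p] by (simp add: 2)
qed

text \<open>The metric pairs types (1,0) and (0,1), so an upper (1,0)-index becomes an argument of
  type (0,1): hence \<open>k\<close> stands in the third slot with flag \<open>False\<close>. The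
  same convention is used for \<open>C'\<close> and for \<open>B\<close>.\<close>

definition C :: "'i \<Rightarrow> 'i \<Rightarrow> 'i \<Rightarrow> complex" where
  "C k i j = Th True True False (E i) (E j) (E k)"

definition C' :: "'i \<Rightarrow> 'i \<Rightarrow> 'i \<Rightarrow> complex" where
  "C' k i j = Th False False True (E i) (E j) (E k)"

definition B :: "'i \<Rightarrow> 'i \<Rightarrow> 'i \<Rightarrow> 'i \<Rightarrow> complex" where
  "B k l i j = ah False False True True (E k) (E l) (E i) (E j)"

lemma Th_C:
  "Th True True False (E i) (E j) (E k) = C k i j"
  "Th True False True (E i) (E j) (E k) = - C j i k"
  "Th False True True (E i) (E j) (E k) = C i j k"
  "Th False False True (E i) (E j) (E k) = C' k i j"
  "Th False True False (E i) (E j) (E k) = - C' j i k"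
  "Th True False False (E i) (E j) (E k) = C' i j k"
proof -
  show 1: "Th True True False (E i) (E j) (E k) = C k i j" for i j k by (simp add: C_def)
  show 2: "Th True False True (E i) (E j) (E k) = - C j i k" for i j k
    using Th_swap(2)[of True False True "E i" "E j" "E k"] 1 by simp
  show "Th False True True (E i) (E j) (E k) = C i j k"
    using Th_swap(1)[of False True True "E i" "E j" "E k"] 2 by simp
  show 1: "Th False False True (E i) (E j) (E k) = C' k i j" for i j k by (simp add: C'_def)
  show 2: "Th False True False (E i) (E j) (E k) = - C' j i k" for i j k
    using Th_swap(2)[of False True False "E i" "E j" "E k"] 1 by simp
  show "Th True False False (E i) (E j) (E k) = C' i j k"
    using Th_swap(1)[of True False False "E i" "E j" "E k"] 2 by simp
qed

lemma ah_B:
  "ah False False True True (E i) (E j) (E k) (E l) = B i j k l"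
  "ah False True False True (E i) (E j) (E k) (E l) = - B i k j l"
  "ah False True True False (E i) (E j) (E k) (E l) = B i l j k"
  "ah True False False True (E i) (E j) (E k) (E l) = B j k i l"
  "ah True False True False (E i) (E j) (E k) (E l) = - B j l i k"
  "ah True True False False (E i) (E j) (E k) (E l) = B k l i j"
proof -
  show 1: "ah False False True True (E i) (E j) (E k) (E l) = B i j k l" for i j k l
    by (simp add: B_def)
  show 2: "ah False True False True (E i) (E j) (E k) (E l) = - B i k j l" for i j k l
    using ah_swap(2)[of False True False True "E i" "E j" "E k" "E l"] 1 by simp
  show "ah False True True False (E i) (E j) (E k) (E l) = B i l j k" for i j k l
    using ah_swap(3)[of False True True False "E i" "E j" "E k" "E l"] 2 by simp
  show 3: "ah True False False True (E i) (E j) (E k) (E l) = B j k i l" for i j k l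
    using ah_swap(1)[of True False False True "E i" "E j" "E k" "E l"] 2 by simp
  show 4: "ah True False True False (E i) (E j) (E k) (E l) = - B j l i k" for i j k l
    using ah_swap(3)[of True False True False "E i" "E j" "E k" "E l"] 3 by simp
  show "ah True True False False (E i) (E j) (E k) (E l) = B k l i j" for i j k l
    using ah_swap(2)[of True True False False "E i" "E j" "E k" "E l"] 4 by simp
qed

lemma C_skew: "C k j i = - C k i j" and C'_skew: "C' k j i = - C' k i j"
  unfolding C_def C'_def by (rule Th_swap)+

lemma B_skew: "B l k i j = - B k l i j" "B k l j i = - B k l i j"
  unfolding B_def by (rule ah_swap)+

lemmas types = Th_same ah_same ah_same' Th_C ah_B

lemma ext5_add: "ext5 (\<lambda>x y z u v. F x y z u v + G x y z u v) p q r s t x y z u v =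
    ext5 F p q r s t x y z u v + ext5 G p q r s t x y z u v"
  and ext5_diff: "ext5 (\<lambda>x y z u v. F x y z u v - G x y z u v) p q r s t x y z u v =
    ext5 F p q r s t x y z u v - ext5 G p q r s t x y z u v"
  and ext5_scale: "ext5 (\<lambda>x y z u v. c * F x y z u v) p q r s t x y z u v =
    of_real c * ext5 F p q r s t x y z u v"
  unfolding ext5_def by (simp_all add: pr_add pr_diff pr_scale)

lemma pr_commute: "pr b (\<lambda>x. pr b' (\<lambda>y. F x y) y) x = pr b' (\<lambda>y. pr b (\<lambda>x. F x y) x) y"
  by (simp add: pr_def algebra_simps)

lemma ext5_permute:
  "ext5 (\<lambda>w x y z v. K w z v x y) p q r s t w x y z v = ext5 K p s t q r w z v x y"
  "ext5 (\<lambda>w x y z v. K w y z x v) p q r s t w x y z v = ext5 K p r s q t w y z x v"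
  "ext5 (\<lambda>w x y z v. K w x v y z) p q r s t w x y z v = ext5 K p q t r s w x v y z"
  "ext5 (\<lambda>w x y z v. K w z x y v) p q r s t w x y z v = ext5 K p s q r t w z x y v"
  "ext5 (\<lambda>w x y z v. K w y v z x) p q r s t w x y z v = ext5 K p r t s q w y v z x"
  "ext5 (\<lambda>x y u v w. K u v w x y) p q r s t x y z u v = ext5 K r s t p q z u v x y"
  unfolding ext5_def by (simp_all add: pr_def algebra_simps)

lemma dsigma_J: "dsigma (J (J w)) x y z v = - dsigma w x y z v"
  "dsigma w (J (J x)) y z v = - dsigma w x y z v" "dsigma w x (J (J y)) z v = - dsigma w x y z v"
  "dsigma w x y (J (J z)) v = - dsigma w x y z v" "dsigma w x y z (J (J v)) = - dsigma w x y z v"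
  by (simp_all add: dsigma_def K_def aJ aJ2 aJ3 aJ4 TJ TJ2 TJ3 sum_negf)

lemma ext5_dsigma:
  "ext5 dsigma p q r s t w x y z v =
    ext5 K p q r s t w x y z v + ext5 K p s t q r w z v x y + ext5 K p r s q t w y z x v
    + ext5 K p q t r s w x v y z + ext5 K p s q r t w z x y v + ext5 K p r t s q w y v z x"
proof -
  have "dsigma = (\<lambda>w x y z v. K w x y z v + K w z v x y + K w y z x v + K w x v y z + K w z x y v + K w y v z x)"
    by (simp add: dsigma_def fun_eq_iff)
  then show ?thesis
    by (simp only: ext5_add ext5_permute)
qed

end

section \<open>Consequences of the Bianchi identity by type\<close>

text \<open>What the Bianchi identity provides at a point. With \<open>3 a = - \<sigma>\<close>,
  \<open>dsigma\<close> is a multiple of the second derivative of \<open>T\<close>, which explains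
  \<open>dsigma_type\<close>; \<open>ricci\<close> is the Ricci identity with the curvature
  eliminated; \<open>ortho\<close> says that \<open>|T|\<close> is constant. In \<open>norm\<close>
  the three terms of \<open>\<sigma>\<close> contribute equally, so the factor 3 cancels and one
  term remains.\<close>

locale bianchi_torsion = pointwise_torsion +
  assumes dsigma_type: "dsigma w x y z v =
      dsigma w x (J y) (J z) v + dsigma w x (J y) z (J v) + dsigma w x y (J z) (J v)"
    and ricci: "dsigma (J y) (J x) u v w - dsigma (J x) (J y) u v w - 3 * K u v w (J x) (J y)
      = dsigma y x u v w - dsigma x y u v w - 3 * K u v w x y"
    and ortho: "(\<Sum>k\<in>I. \<Sum>j\<in>I. \<Sum>i\<in>I. a x (E i) (E j) (E k) * T (E i) (E j) (E k)) = 0"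
    and norm: "(\<Sum>l\<in>I. \<Sum>k\<in>I. \<Sum>j\<in>I. \<Sum>i\<in>I. (a (E i) (E j) (E k) (E l))\<^sup>2) =
      - (\<Sum>l\<in>I. \<Sum>k\<in>I. \<Sum>j\<in>I. \<Sum>i\<in>I. a (E i) (E j) (E k) (E l) *
          (\<Sum>m\<in>I. T (E i) (E j) (E m) * T (E k) (E l) (E m)))"
begin
text \<open>Projections in different slots commute, so the last three can be carried out first.
  There the argument for \<open>Th_same\<close> applies to \<open>dsigma_type\<close>, and
  projecting zero in the other slots changes nothing.\<close>

lemma dsigma_same: "ext5 dsigma p q True True True w x y z v = 0"
proof -
  have 1: "dsigma w x y z v - dsigma w x (J y) (J z) v - dsigma w x (J y) z (J v)
      - dsigma w x y (J z) (J v) = 0" for w x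
    using dsigma_type[of w x y z v] by simp
  have 2: "dsigma w x (J y) (J z) (J v) - dsigma w x (J y) z v - dsigma w x y (J z) v
      - dsigma w x y z (J v) = 0" for w x
    using dsigma_type[of w x "J y" "J z" "J v"] by (simp add: dsigma_J)
  have 3: "pr True (\<lambda>v. pr True (\<lambda>z. pr True (\<lambda>y. of_real (dsigma w x y z v)) y) z) v = 0" for w x
    using 1[of w x] 2[of w x] by (auto simp: pr_def complex_eq_iff)
  have "ext5 dsigma p q True True True w x y z v = pr q (\<lambda>x. pr p (\<lambda>w.
      pr True (\<lambda>v. pr True (\<lambda>z. pr True (\<lambda>y. of_real (dsigma w x y z v)) y) z) v) w) x"
    unfolding ext5_def by (simp add: pr_def algebra_simps)
  then show ?thesis by (simp add: 3) (simp add: pr_def)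
qed

text \<open>Fractions of the components whose antisymmetrisations give the components back, for the
  same sign normalisation as in \<open>contraction_vanish\<close>.\<close>

definition C2 where "C2 k i j = C k i j / 2"
definition C2' where "C2' k i j = C' k i j / 2"
definition B2 where "B2 k l i j = B k l i j / 4"
lemma skew_repr: "C k i j = C2 k i j - C2 k j i"
   "C' k i j = C2' k i j - C2' k j i"
   "B k l i j = B2 k l i j - B2 l k i j - B2 k l j i + B2 l k j i"
  unfolding C2_def C_skew[of k j i] C2'_def C'_skew[of k j i] B2_def B_skew(1)[of l k] B_skew(2)[of k l j i] by (simp_all add: B_skew(1)[of l k i j] field_simps)

text \<open>The (3,1)-part of \<open>\<sigma>\<close> is the Jacobi expression of the bracket
  \<open>C\<close>; this is its derivative in a (0,1)-direction, hence zero by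
  \<open>dsigma_same\<close>. In each of the six terms the types leave one of the two products of
  \<open>ext5_K\<close>, and the factor 4 clears the denominator there.\<close>

lemma cocycle: "(\<Sum>m\<in>I. B x m i j * C k m p + C m i j * B x k m p
        + B x m j p * C k m i + C m j p * B x k m i + B x m p i * C k m j + C m p i * B x k m j) = 0"
proof -
  have "0 = 4 * ext5 dsigma False False True True True (E x) (E k) (E i) (E j) (E p)"
    by (simp add: dsigma_same)
  also have "\<dots> = - (\<Sum>m\<in>I. B x m i j * C k m p + C m i j * B x k m p
        + B x m j p * C k m i + C m j p * B x k m i + B x m p i * C k m j + C m p i * B x k m j)"
    unfolding ext5_dsigma ext5_K add_divide_distrib[symmetric] sum.distrib[symmetric]
    by (simp add: types, simp flip: sum_negf, rule sum.cong[OF refl], simp add: skew_repr algebra_simps)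
  finally show ?thesis by simp
qed

lemma ext5_swap: "ext5 (\<lambda>x y. F y x) p q r s t x y z u v = ext5 F q p r s t y x z u v"
  unfolding ext5_def by (subst pr_commute) (rule refl)

text \<open>By the Ricci identity this is a multiple of the action of \<open>R(x, y)\<close> on
  \<open>T\<close>, written without curvature.\<close>

definition ric where "ric x y u v w = dsigma y x u v w - dsigma x y u v w - 3 * K u v w x y"

text \<open>Invariance under simultaneous application of \<open>J\<close> to the first two arguments
  means type (1,1) in them, so the (2,0)-component is zero.\<close>

lemma ric_same: "ext5 ric True True r s t x y u v w = 0"
proof -
  have J: "ric (J (J x)) y u v w = - ric x y u v w" for x y u v w
    by (simp add: ric_def dsigma_J) (simp add: K_def TJ sum_negf)
  have JJ: "ric (J x) (J y) u v w = ric x y u v w" for x y u v w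
    using ricci unfolding ric_def .
  have J2: "ric x (J y) u v w = - ric (J x) y u v w" for x y u v w
    using JJ[of "J x" y u v w] J[of x "J y" u v w] by simp
  show ?thesis unfolding ext5_def by (simp add: pr_def JJ J2 J algebra_simps)
qed

text \<open>The component of \<open>ric\<close> in which \<open>x, y, p\<close> are of type (1,0)
  and \<open>k, l\<close> of type (0,1). The first two make the curvature disappear; the other three
  are chosen so that what remains pairs \<open>C\<close> with \<open>B\<close>.\<close>

lemma ricci_C: "(\<Sum>m\<in>I. C k x m * B m l y p + C l x m * B k m y p
        - C k y m * B m l x p - C l y m * B k m x p
        + 2 * C k p m * B m l x y + 2 * C l p m * B k m x y
        + C m y p * B k l x m - C m x p * B k l y m - 3 * C m x y * B k l m p) = 0"
proof -
  have r: "ric = (\<lambda>x y u v w. dsigma y x u v w - dsigma x y u v w - 3 * K u v w x y)"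
    by (simp add: ric_def fun_eq_iff)
  have "0 = 4 * ext5 ric True True True False False (E x) (E y) (E p) (E k) (E l)"
    by (simp add: ric_same)
  also have "\<dots> = - (\<Sum>m\<in>I. C k x m * B m l y p + C l x m * B k m y p
        - C k y m * B m l x p - C l y m * B k m x p
        + 2 * C k p m * B m l x y + 2 * C l p m * B k m x y
        + C m y p * B k l x m - C m x p * B k l y m - 3 * C m x y * B k l m p)"
    unfolding r ext5_diff ext5_scale ext5_permute ext5_swap[of dsigma] ext5_dsigma ext5_K
    by (simp add: types, simp add: sum_distrib_left sum_distrib_right sum_divide_distrib flip: sum.distrib sum_negf sum_subtractf,
        rule sum.cong[OF refl], simp add: skew_repr algebra_simps)
  finally show ?thesis by simp
qed

section \<open>Contractions in several slots and the vanishing of \<open>a\<close>\<close>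

lemma contract_sum:
  assumes "compat f g"
  shows "(\<Sum>i\<in>I. f (E i) * g (E i)) = (\<Sum>b\<in>UNIV. \<Sum>i\<in>I. pr b f (E i) * pr (\<not> b) g (E i)) / 4"
  unfolding contract[OF assms] by (simp add: UNIV_bool sum.distrib)

text \<open>Projections in other slots preserve \<open>compat\<close>, so the slots can be split one
  after the other, each contributing a factor 1/4.\<close>

lemma contract3:
  assumes 1: "\<And>y z u v. compat (\<lambda>m. F m y z) (\<lambda>m. G m u v)"
    and 2: "\<And>y z u v. compat (\<lambda>m. F y m z) (\<lambda>m. G u m v)"
    and 3: "\<And>y z u v. compat (\<lambda>m. F y z m) (\<lambda>m. G u v m)"
  shows "(\<Sum>k\<in>I. \<Sum>j\<in>I. \<Sum>i\<in>I. F (E i) (E j) (E k) * G (E i) (E j) (E k)) =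
    (\<Sum>p\<in>UNIV. \<Sum>q\<in>UNIV. \<Sum>r\<in>UNIV. \<Sum>i\<in>I. \<Sum>j\<in>I. \<Sum>k\<in>I.
      pr r (\<lambda>z. pr q (\<lambda>y. pr p (\<lambda>x. F x y z) (E i)) (E j)) (E k) *
      pr (\<not> r) (\<lambda>z. pr (\<not> q) (\<lambda>y. pr (\<not> p) (\<lambda>x. G x y z) (E i)) (E j)) (E k)) / 64"
proof -
  have c1: "compat (\<lambda>m. pr p (\<lambda>x. F x m z) y) (\<lambda>m. pr q (\<lambda>x. G x m v) u)" for p q y z u v
    by (intro compat_pr1 compat_pr2 2)
  have c2: "compat (\<lambda>m. pr q (\<lambda>y. pr p (\<lambda>x. F x y m) x) y) (\<lambda>m. pr s (\<lambda>y. pr r (\<lambda>x. G x y m) u) v)"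
    for p q r s x y u v
    by (intro compat_pr1 compat_pr2 3)
  let ?F1 = "\<lambda>p k j i. pr p (\<lambda>x. F x j k) i" and ?G1 = "\<lambda>p k j i. pr p (\<lambda>x. G x j k) i"
  let ?F2 = "\<lambda>p q k j i. pr q (\<lambda>y. ?F1 p k y i) j" and ?G2 = "\<lambda>p q k j i. pr q (\<lambda>y. ?G1 p k y i) j"
  let ?F3 = "\<lambda>p q r k j i. pr r (\<lambda>z. ?F2 p q z j i) k" and ?G3 = "\<lambda>p q r k j i. pr r (\<lambda>z. ?G2 p q z j i) k"
  have "(\<Sum>k\<in>I. \<Sum>j\<in>I. \<Sum>i\<in>I. F (E i) (E j) (E k) * G (E i) (E j) (E k)) =
    (\<Sum>k\<in>I. \<Sum>j\<in>I. \<Sum>p\<in>UNIV. \<Sum>i\<in>I. ?F1 p (E k) (E j) (E i) * ?G1 (\<not> p) (E k) (E j) (E i)) / 4"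
    by (subst contract_sum[OF 1]) (simp add: sum_divide_distrib)
  also have "\<dots> = (\<Sum>p\<in>UNIV. \<Sum>k\<in>I. \<Sum>j\<in>I. \<Sum>i\<in>I. ?F1 p (E k) (E j) (E i) * ?G1 (\<not> p) (E k) (E j) (E i)) / 4"
    by (simp add: UNIV_bool sum.distrib)
  also have "\<dots> = (\<Sum>p\<in>UNIV. \<Sum>i\<in>I. \<Sum>k\<in>I. \<Sum>j\<in>I. ?F1 p (E k) (E j) (E i) * ?G1 (\<not> p) (E k) (E j) (E i)) / 4"
    by (subst sum_rotate) (rule refl)
  also have "\<dots> = (\<Sum>p\<in>UNIV. \<Sum>i\<in>I. \<Sum>k\<in>I. \<Sum>q\<in>UNIV. \<Sum>j\<in>I.
      ?F2 p q (E k) (E j) (E i) * ?G2 (\<not> p) (\<not> q) (E k) (E j) (E i)) / 16"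
    by (subst contract_sum[OF c1]) (simp add: sum_divide_distrib)
  also have "\<dots> = (\<Sum>p\<in>UNIV. \<Sum>q\<in>UNIV. \<Sum>i\<in>I. \<Sum>k\<in>I. \<Sum>j\<in>I.
      ?F2 p q (E k) (E j) (E i) * ?G2 (\<not> p) (\<not> q) (E k) (E j) (E i)) / 16"
    by (simp add: UNIV_bool sum.distrib)
  also have "\<dots> = (\<Sum>p\<in>UNIV. \<Sum>q\<in>UNIV. \<Sum>i\<in>I. \<Sum>j\<in>I. \<Sum>k\<in>I.
      ?F2 p q (E k) (E j) (E i) * ?G2 (\<not> p) (\<not> q) (E k) (E j) (E i)) / 16"
    by (rule arg_cong[of _ _ "\<lambda>x. x / 16"], rule sum.cong[OF refl], rule sum.cong[OF refl], rule sum.cong[OF refl], rule sum.swap)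
  also have "\<dots> = (\<Sum>p\<in>UNIV. \<Sum>q\<in>UNIV. \<Sum>i\<in>I. \<Sum>j\<in>I. \<Sum>r\<in>UNIV. \<Sum>k\<in>I.
      ?F3 p q r (E k) (E j) (E i) * ?G3 (\<not> p) (\<not> q) (\<not> r) (E k) (E j) (E i)) / 64"
  proof -
    have "(\<Sum>k\<in>I. ?F2 p q (E k) (E j) (E i) * ?G2 (\<not> p) (\<not> q) (E k) (E j) (E i)) =
      (\<Sum>r\<in>UNIV. \<Sum>k\<in>I. ?F3 p q r (E k) (E j) (E i) * ?G3 (\<not> p) (\<not> q) (\<not> r) (E k) (E j) (E i)) / 4"
      for p q i j
      by (rule contract_sum) (rule c2)
    then show ?thesis by (simp add: sum_divide_distrib)
  qed
  also have "\<dots> = (\<Sum>p\<in>UNIV. \<Sum>q\<in>UNIV. \<Sum>r\<in>UNIV. \<Sum>i\<in>I. \<Sum>j\<in>I. \<Sum>k\<in>I.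
      ?F3 p q r (E k) (E j) (E i) * ?G3 (\<not> p) (\<not> q) (\<not> r) (E k) (E j) (E i)) / 64"
    by (simp add: UNIV_bool sum.distrib)
  finally show ?thesis .
qed

lemma a_cyc: "a x m y z = a x y z m" "a m x y z = - a x y z m" "a x y m z = - a x y z m"
  by (metis a23 a34 minus_minus, metis a12 a23 a34 minus_minus, metis a34)

lemma T_cyc: "T m x y = T x y m" "T x m y = - T x y m"
  by (metis T12 T23 minus_minus, metis T23)

lemma compat_uminus: "compat f g \<Longrightarrow> compat (\<lambda>m. - f m) g" "compat f g \<Longrightarrow> compat f (\<lambda>m. - g m)"
  by (simp_all add: compat_def sum_negf)

lemma compat_aT_slots:
  "compat (\<lambda>m. of_real (a m x y z)) (\<lambda>m. of_real (T u v m))"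
  "compat (\<lambda>m. of_real (a x m y z)) (\<lambda>m. of_real (T u v m))"
  "compat (\<lambda>m. of_real (a x y m z)) (\<lambda>m. of_real (T u v m))"
  by (simp_all only: a_cyc(1)[of x _ y z] a_cyc(2)[of _ x y z] a_cyc(3)[of x y _ z] of_real_minus compat_aT compat_uminus)

lemma compat_T_slots:
  assumes "\<And>u v. compat f (\<lambda>m. of_real (T u v m))"
  shows "compat f (\<lambda>m. of_real (T m u v))" "compat f (\<lambda>m. of_real (T u m v))"
  by (simp_all only: T_cyc(1)[of _ u v] T_cyc(2)[of u _ v] of_real_minus assms compat_uminus)

text \<open>Take the first slot of \<open>a\<close> of type (0,1). Type (2,2) then leaves three of
  the eight patterns in the summed slots, namely those with exactly one \<open>False\<close>. By the
  symmetry of both factors they give the same sum, so three times the claim is zero.\<close>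

lemma ortho_C: "(\<Sum>i\<in>I. \<Sum>j\<in>I. \<Sum>l\<in>I. B x l i j * C' l i j) = 0"
proof -
  define F where "F u v w = pr False (\<lambda>y. of_real (a y u v w)) (E x)" for u v w
  define G where "G u v w = complex_of_real (T u v w)" for u v w
  have 1: "(\<Sum>k\<in>I. \<Sum>j\<in>I. \<Sum>i\<in>I. of_real (a y (E i) (E j) (E k)) * G (E i) (E j) (E k)) = 0" for y
    using ortho[of y] by (simp only: G_def flip: of_real_mult of_real_sum) simp
  have "0 = (\<Sum>k\<in>I. \<Sum>j\<in>I. \<Sum>i\<in>I. F (E i) (E j) (E k) * G (E i) (E j) (E k))"
    using 1[of "E x"] 1[of "J (E x)"]
    by (simp add: F_def pr_def sum.distrib distrib_right sum_distrib_left[symmetric] mult.assoc)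
  also have "\<dots> = (\<Sum>p\<in>UNIV. \<Sum>q\<in>UNIV. \<Sum>r\<in>UNIV. \<Sum>i\<in>I. \<Sum>j\<in>I. \<Sum>k\<in>I.
      pr r (\<lambda>z. pr q (\<lambda>y. pr p (\<lambda>x. F x y z) (E i)) (E j)) (E k) *
      pr (\<not> r) (\<lambda>z. pr (\<not> q) (\<lambda>y. pr (\<not> p) (\<lambda>x. G x y z) (E i)) (E j)) (E k)) / 64"
  proof (rule contract3)
    show "compat (\<lambda>m. F m y z) (\<lambda>m. G m u v)" "compat (\<lambda>m. F y m z) (\<lambda>m. G u m v)"
      "compat (\<lambda>m. F y z m) (\<lambda>m. G u v m)" for y z u v
      unfolding F_def G_def by (intro compat_pr1 compat_aT_slots compat_aT compat_T_slots)+
  qed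
  also have "\<dots> = (\<Sum>p\<in>UNIV. \<Sum>q\<in>UNIV. \<Sum>r\<in>UNIV. \<Sum>i\<in>I. \<Sum>j\<in>I. \<Sum>k\<in>I.
      ah False p q r (E x) (E i) (E j) (E k) * Th (\<not> p) (\<not> q) (\<not> r) (E i) (E j) (E k)) / 64"
    by (simp add: F_def G_def ah_def Th_def)
  finally have "0 = (\<Sum>i\<in>I. \<Sum>j\<in>I. \<Sum>k\<in>I. B x i j k * C' i j k)
    + (\<Sum>i\<in>I. \<Sum>j\<in>I. \<Sum>k\<in>I. B x j i k * C' j i k) + (\<Sum>i\<in>I. \<Sum>j\<in>I. \<Sum>k\<in>I. B x k i j * C' k i j)"
    by (simp add: types UNIV_bool add.assoc)
  moreover have "(\<Sum>i\<in>I. \<Sum>j\<in>I. \<Sum>k\<in>I. B x j i k * C' j i k) = (\<Sum>i\<in>I. \<Sum>j\<in>I. \<Sum>k\<in>I. B x i j k * C' i j k)"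
    by (rule sum.swap)
  moreover have "(\<Sum>i\<in>I. \<Sum>j\<in>I. \<Sum>k\<in>I. B x k i j * C' k i j) = (\<Sum>i\<in>I. \<Sum>j\<in>I. \<Sum>k\<in>I. B x i j k * C' i j k)"
    by (rule sum_rotate)
  ultimately show ?thesis by simp
qed

lemma contract4:
  assumes 1: "\<And>y z w u v t. compat (\<lambda>m. F m y z w) (\<lambda>m. G m u v t)"
    and 2: "\<And>y z w u v t. compat (\<lambda>m. F y m z w) (\<lambda>m. G u m v t)"
    and 3: "\<And>y z w u v t. compat (\<lambda>m. F y z m w) (\<lambda>m. G u v m t)"
    and 4: "\<And>y z w u v t. compat (\<lambda>m. F y z w m) (\<lambda>m. G u v t m)"
  shows "(\<Sum>l\<in>I. \<Sum>k\<in>I. \<Sum>j\<in>I. \<Sum>i\<in>I. F (E i) (E j) (E k) (E l) * G (E i) (E j) (E k) (E l)) =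
    (\<Sum>p\<in>UNIV. \<Sum>q\<in>UNIV. \<Sum>r\<in>UNIV. \<Sum>s\<in>UNIV. \<Sum>i\<in>I. \<Sum>j\<in>I. \<Sum>k\<in>I. \<Sum>l\<in>I.
      pr s (\<lambda>w. pr r (\<lambda>z. pr q (\<lambda>y. pr p (\<lambda>x. F x y z w) (E i)) (E j)) (E k)) (E l) *
      pr (\<not> s) (\<lambda>w. pr (\<not> r) (\<lambda>z. pr (\<not> q) (\<lambda>y. pr (\<not> p) (\<lambda>x. G x y z w) (E i)) (E j)) (E k)) (E l)) / 256"
proof -
  let ?F3 = "\<lambda>p q r i j k w. pr r (\<lambda>z. pr q (\<lambda>y. pr p (\<lambda>x. F x y z w) i) j) k"
  let ?G3 = "\<lambda>p q r i j k w. pr r (\<lambda>z. pr q (\<lambda>y. pr p (\<lambda>x. G x y z w) i) j) k"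
  have c: "compat (?F3 p q r i j k) (?G3 p' q' r' i' j' k')" for p q r i j k p' q' r' i' j' k'
    by (intro compat_pr1 compat_pr2 4)
  have l3: "(\<Sum>k\<in>I. \<Sum>j\<in>I. \<Sum>i\<in>I. F (E i) (E j) (E k) w * G (E i) (E j) (E k) w) =
      (\<Sum>p\<in>UNIV. \<Sum>q\<in>UNIV. \<Sum>r\<in>UNIV. \<Sum>i\<in>I. \<Sum>j\<in>I. \<Sum>k\<in>I.
        ?F3 p q r (E i) (E j) (E k) w * ?G3 (\<not> p) (\<not> q) (\<not> r) (E i) (E j) (E k) w) / 64" for w
    by (rule contract3) (rule 1 2 3)+
  have rot: "(\<Sum>l\<in>I. \<Sum>i\<in>I. \<Sum>j\<in>I. \<Sum>k\<in>I. X i j k l) = (\<Sum>i\<in>I. \<Sum>j\<in>I. \<Sum>k\<in>I. \<Sum>l\<in>I. X i j k l)"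
    for X :: "'b \<Rightarrow> 'b \<Rightarrow> 'b \<Rightarrow> 'b \<Rightarrow> complex"
  proof -
    have "(\<Sum>l\<in>I. \<Sum>i\<in>I. \<Sum>j\<in>I. \<Sum>k\<in>I. X i j k l) = (\<Sum>i\<in>I. \<Sum>l\<in>I. \<Sum>j\<in>I. \<Sum>k\<in>I. X i j k l)"
      by (rule sum.swap)
    also have "\<dots> = (\<Sum>i\<in>I. \<Sum>j\<in>I. \<Sum>l\<in>I. \<Sum>k\<in>I. X i j k l)"
      by (rule sum.cong[OF refl], rule sum.swap)
    also have "\<dots> = (\<Sum>i\<in>I. \<Sum>j\<in>I. \<Sum>k\<in>I. \<Sum>l\<in>I. X i j k l)"
      by (rule sum.cong[OF refl], rule sum.cong[OF refl], rule sum.swap)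
    finally show ?thesis .
  qed
  have l4: "(\<Sum>l\<in>I. ?F3 p q r i j k (E l) * ?G3 (\<not> p) (\<not> q) (\<not> r) i j k (E l)) =
      (\<Sum>s\<in>UNIV. \<Sum>l\<in>I. pr s (?F3 p q r i j k) (E l) * pr (\<not> s) (?G3 (\<not> p) (\<not> q) (\<not> r) i j k) (E l)) / 4"
    for p q r i j k
    by (rule contract_sum) (rule c)
  have "(\<Sum>l\<in>I. \<Sum>k\<in>I. \<Sum>j\<in>I. \<Sum>i\<in>I. F (E i) (E j) (E k) (E l) * G (E i) (E j) (E k) (E l)) =
      (\<Sum>p\<in>UNIV. \<Sum>q\<in>UNIV. \<Sum>r\<in>UNIV. \<Sum>l\<in>I. \<Sum>i\<in>I. \<Sum>j\<in>I. \<Sum>k\<in>I.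
        ?F3 p q r (E i) (E j) (E k) (E l) * ?G3 (\<not> p) (\<not> q) (\<not> r) (E i) (E j) (E k) (E l)) / 64"
    by (simp only: l3) (simp add: UNIV_bool sum.distrib sum_divide_distrib add_divide_distrib)
  also have "\<dots> = (\<Sum>p\<in>UNIV. \<Sum>q\<in>UNIV. \<Sum>r\<in>UNIV. \<Sum>i\<in>I. \<Sum>j\<in>I. \<Sum>k\<in>I. \<Sum>s\<in>UNIV. \<Sum>l\<in>I.
        pr s (?F3 p q r (E i) (E j) (E k)) (E l) * pr (\<not> s) (?G3 (\<not> p) (\<not> q) (\<not> r) (E i) (E j) (E k)) (E l)) / 256"
    by (simp only: rot l4) (simp add: sum_divide_distrib)
  also have "\<dots> = (\<Sum>p\<in>UNIV. \<Sum>q\<in>UNIV. \<Sum>r\<in>UNIV. \<Sum>s\<in>UNIV. \<Sum>i\<in>I. \<Sum>j\<in>I. \<Sum>k\<in>I. \<Sum>l\<in>I.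
        pr s (?F3 p q r (E i) (E j) (E k)) (E l) * pr (\<not> s) (?G3 (\<not> p) (\<not> q) (\<not> r) (E i) (E j) (E k)) (E l)) / 256"
    by (simp add: UNIV_bool sum.distrib)
  finally show ?thesis .
qed

text \<open>Splitting the right-hand side of \<open>norm\<close> by types leaves the six
  (2,2)-patterns of \<open>a\<close>. Each pattern with its first two types equal gives one product
  of brackets, each of the other four gives two. Of these ten terms two are \<open>\<alpha>\<close>
  and eight are \<open>- \<beta>\<close>, so \<open>contraction_vanish\<close> makes a sum of real
  squares zero.\<close>

lemma a_eq_0:
  assumes "finite I" "i \<in> I" "j \<in> I" "k \<in> I" "l \<in> I"
  shows "a (E i) (E j) (E k) (E l) = 0"
proof -
  define F where "F x y z w = complex_of_real (a x y z w)" for x y z w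
  define G where "G x y z w = (\<Sum>m\<in>I. complex_of_real (T x y (E m)) * of_real (T z w (E m)))" for x y z w
  have G: "pr s (\<lambda>w. pr r (\<lambda>z. pr q (\<lambda>y. pr p (\<lambda>x. G x y z w) x) y) z) w =
     (\<Sum>m\<in>I. Th p q True x y (E m) * Th r s False z w (E m) + Th p q False x y (E m) * Th r s True z w (E m)) / 4"
    for p q r s x y z w
  proof -
    have "pr s (\<lambda>w. pr r (\<lambda>z. pr q (\<lambda>y. pr p (\<lambda>x. G x y z w) x) y) z) w =
      (\<Sum>m\<in>I. pr q (\<lambda>y. pr p (\<lambda>x. of_real (T x y (E m))) x) y * pr s (\<lambda>w. pr r (\<lambda>z. of_real (T z w (E m))) z) w)"
      unfolding G_def by (simp add: pr_sum pr_scale)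
    also have "\<dots> = (\<Sum>m\<in>I. Th p q True x y (E m) * Th r s False z w (E m) + Th p q False x y (E m) * Th r s True z w (E m)) / 4"
      unfolding Th_def by (rule contract) (intro compat_pr1 compat_pr2 compat_TT)
    finally show ?thesis .
  qed
  have "complex_of_real (\<Sum>l\<in>I. \<Sum>k\<in>I. \<Sum>j\<in>I. \<Sum>i\<in>I. (a (E i) (E j) (E k) (E l))\<^sup>2)
    = - (\<Sum>l\<in>I. \<Sum>k\<in>I. \<Sum>j\<in>I. \<Sum>i\<in>I. F (E i) (E j) (E k) (E l) * G (E i) (E j) (E k) (E l))"
    unfolding norm by (simp add: F_def G_def)
  also have "(\<Sum>l\<in>I. \<Sum>k\<in>I. \<Sum>j\<in>I. \<Sum>i\<in>I. F (E i) (E j) (E k) (E l) * G (E i) (E j) (E k) (E l)) =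
    (\<Sum>p\<in>UNIV. \<Sum>q\<in>UNIV. \<Sum>r\<in>UNIV. \<Sum>s\<in>UNIV. \<Sum>i\<in>I. \<Sum>j\<in>I. \<Sum>k\<in>I. \<Sum>l\<in>I.
      pr s (\<lambda>w. pr r (\<lambda>z. pr q (\<lambda>y. pr p (\<lambda>x. F x y z w) (E i)) (E j)) (E k)) (E l) *
      pr (\<not> s) (\<lambda>w. pr (\<not> r) (\<lambda>z. pr (\<not> q) (\<lambda>y. pr (\<not> p) (\<lambda>x. G x y z w) (E i)) (E j)) (E k)) (E l)) / 256"
  proof (rule contract4)
    show "compat (\<lambda>m. F m y z w) (\<lambda>m. G m u v t)" "compat (\<lambda>m. F y m z w) (\<lambda>m. G u m v t)"
       "compat (\<lambda>m. F y z m w) (\<lambda>m. G u v m t)" "compat (\<lambda>m. F y z w m) (\<lambda>m. G u v t m)" for y z w u v t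
      unfolding F_def G_def
      by (rule compat_sym, rule compat_sum1, intro compat_scale1, rule compat_sym,
          intro compat_T_slots compat_aT_slots compat_aT)+
  qed
  also have "\<dots> = (\<Sum>p\<in>UNIV. \<Sum>q\<in>UNIV. \<Sum>r\<in>UNIV. \<Sum>s\<in>UNIV. \<Sum>i\<in>I. \<Sum>j\<in>I. \<Sum>k\<in>I. \<Sum>l\<in>I.
      ah p q r s (E i) (E j) (E k) (E l) *
     ((\<Sum>m\<in>I. Th (\<not> p) (\<not> q) True (E i) (E j) (E m) * Th (\<not> r) (\<not> s) False (E k) (E l) (E m)
       + Th (\<not> p) (\<not> q) False (E i) (E j) (E m) * Th (\<not> r) (\<not> s) True (E k) (E l) (E m)))) / 1024"
    by (simp only: G) (simp add: F_def ah_def flip: sum_divide_distrib)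
  also have "\<dots> = 0" (is "?lhs = 0")
  proof -
    define W where "W f = (\<Sum>i\<in>I. \<Sum>j\<in>I. \<Sum>k\<in>I. \<Sum>l\<in>I. \<Sum>m\<in>I. f i j k l m)"
      for f :: "'b \<Rightarrow> 'b \<Rightarrow> 'b \<Rightarrow> 'b \<Rightarrow> 'b \<Rightarrow> complex"
    have W5: "W f = (\<Sum>(i, j, k, l, m)\<in>I \<times> I \<times> I \<times> I \<times> I. f i j k l m)" for f
      by (simp add: W_def sum.cartesian_product)
    have Wadd: "W (\<lambda>i j k l m. f i j k l m + h i j k l m) = W f + W h" for f h
      by (simp add: W_def sum.distrib)
    define \<alpha> where "\<alpha> = W (\<lambda>x y p l m. C l p m * C' l x y * B p m x y)"
    define \<beta> where "\<beta> = W (\<lambda>x y p l m. C m p x * C' l x y * B p l m y)"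
    have "\<alpha> = 0" "\<beta> = 0"
      unfolding \<alpha>_def \<beta>_def W_def
      by (rule contraction_vanish[of C C' B I, OF C_skew C'_skew B_skew ricci_C cocycle ortho_C])+
    have w0: "W (\<lambda>i j k l m. B i j k l * C m i j * C' m k l) = \<alpha>"
      unfolding \<alpha>_def W5
      by (rule sum.reindex_bij_witness[where i="\<lambda>(x, y, p, l, m). (p, m, x, y, l)" and j="\<lambda>(i, j, k, l, m). (k, l, i, m, j)"])
        (auto simp: skew_repr algebra_simps)
    have w1: "W (\<lambda>i j k l m. B i k j l * C j i m * C' k l m) = - \<beta>"
      unfolding \<beta>_def sum_negf[symmetric] W5
      by (rule sum.reindex_bij_witness[where i="\<lambda>(x, y, p, l, m). (p, m, l, y, x)" and j="\<lambda>(i, j, k, l, m). (m, l, i, k, j)"])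
        (auto simp: skew_repr algebra_simps)
    have w2: "W (\<lambda>i j k l m. B i k j l * C' i j m * C l k m) = - \<beta>"
      unfolding \<beta>_def sum_negf[symmetric] W5
      by (rule sum.reindex_bij_witness[where i="\<lambda>(x, y, p, l, m). (l, y, p, m, x)" and j="\<lambda>(i, j, k, l, m). (m, j, k, i, l)"])
        (auto simp: skew_repr algebra_simps)
    have w3: "W (\<lambda>i j k l m. B i l j k * C' i j m * C k l m) = - \<beta>"
      unfolding \<beta>_def sum_negf[symmetric] W5
      by (rule sum.reindex_bij_witness[where i="\<lambda>(x, y, p, l, m). (l, y, m, p, x)" and j="\<lambda>(i, j, k, l, m). (m, j, l, i, k)"])
        (auto simp: skew_repr algebra_simps)
    have w4: "W (\<lambda>i j k l m. B i l j k * C j i m * C' l k m) = - \<beta>"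
      unfolding \<beta>_def sum_negf[symmetric] W5
      by (rule sum.reindex_bij_witness[where i="\<lambda>(x, y, p, l, m). (p, m, y, l, x)" and j="\<lambda>(i, j, k, l, m). (m, k, i, l, j)"])
        (auto simp: skew_repr algebra_simps)
    have w5: "W (\<lambda>i j k l m. B j k i l * C i j m * C' k l m) = - \<beta>"
      unfolding \<beta>_def sum_negf[symmetric] W5
      by (rule sum.reindex_bij_witness[where i="\<lambda>(x, y, p, l, m). (m, p, l, y, x)" and j="\<lambda>(i, j, k, l, m). (m, l, j, k, i)"])
        (auto simp: skew_repr algebra_simps)
    have w6: "W (\<lambda>i j k l m. B j k i l * C' j i m * C l k m) = - \<beta>"
      unfolding \<beta>_def sum_negf[symmetric] W5
      by (rule sum.reindex_bij_witness[where i="\<lambda>(x, y, p, l, m). (y, l, p, m, x)" and j="\<lambda>(i, j, k, l, m). (m, i, k, j, l)"])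
        (auto simp: skew_repr algebra_simps)
    have w7: "W (\<lambda>i j k l m. B j l i k * C' j i m * C k l m) = - \<beta>"
      unfolding \<beta>_def sum_negf[symmetric] W5
      by (rule sum.reindex_bij_witness[where i="\<lambda>(x, y, p, l, m). (y, l, m, p, x)" and j="\<lambda>(i, j, k, l, m). (m, i, l, j, k)"])
        (auto simp: skew_repr algebra_simps)
    have w8: "W (\<lambda>i j k l m. B j l i k * C i j m * C' l k m) = - \<beta>"
      unfolding \<beta>_def sum_negf[symmetric] W5
      by (rule sum.reindex_bij_witness[where i="\<lambda>(x, y, p, l, m). (m, p, y, l, x)" and j="\<lambda>(i, j, k, l, m). (m, k, j, l, i)"])
        (auto simp: skew_repr algebra_simps)
    have w9: "W (\<lambda>i j k l m. B k l i j * C' m i j * C m k l) = \<alpha>"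
      unfolding \<alpha>_def W5
      by (rule sum.reindex_bij_witness[where i="\<lambda>(x, y, p, l, m). (x, y, p, m, l)" and j="\<lambda>(i, j, k, l, m). (i, j, k, m, l)"])
        (auto simp: skew_repr algebra_simps)
    have "?lhs = W (\<lambda>i j k l m. B i j k l * C m i j * C' m k l + B i k j l * C j i m * C' k l m + B i k j l * C' i j m * C l k m + B i l j k * C' i j m * C k l m + B i l j k * C j i m * C' l k m + B j k i l * C i j m * C' k l m + B j k i l * C' j i m * C l k m + B j l i k * C' j i m * C k l m + B j l i k * C i j m * C' l k m + B k l i j * C' m i j * C m k l) / 1024"
      by (simp add: types UNIV_bool)
        (simp add: W_def sum.distrib sum_distrib_left sum_subtractf sum_negf algebra_simps)
    then show ?thesis
      unfolding Wadd using w0 w1 w2 w3 w4 w5 w6 w7 w8 w9 \<open>\<alpha> = 0\<close> \<open>\<beta> = 0\<close> by (simp add: mult.assoc)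
  qed
  finally have "(\<Sum>l\<in>I. \<Sum>k\<in>I. \<Sum>j\<in>I. \<Sum>i\<in>I. (a (E i) (E j) (E k) (E l))\<^sup>2) = 0"
    by (simp only: minus_zero of_real_eq_0_iff)
  then show ?thesis
    using assms by (simp add: sum_nonneg_eq_0_iff sum_nonneg)
qed

end

section \<open>Smooth functions on Euclidean spaces\<close>

lemma Ck_on_cong:
  assumes "open S" "\<And>x. x \<in> S \<Longrightarrow> f x = g x" "Ck_on k S f"
  shows "Ck_on k S g"
  using assms(2,3)
proof (induction k arbitrary: f g)
  case 0
  then show ?case using continuous_on_cong[of S S f g] by simp
next
  case (Suc k)
  have iff: "(f has_derivative f') (at x) \<longleftrightarrow> (g has_derivative f') (at x)" if x: "x \<in> S" for x f'
    using has_derivative_transform_within_open[OF _ assms(1) x, of f f' UNIV g]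
      has_derivative_transform_within_open[OF _ assms(1) x, of g f' UNIV f] Suc.prems(1) by auto
  then have "frechet_derivative f (at x) = frechet_derivative g (at x)" if "x \<in> S" for x
    using that by (simp add: frechet_derivative_def)
  then show ?case
    using Suc.prems(2) Suc.IH[of "\<lambda>x. frechet_derivative f (at x) v" "\<lambda>x. frechet_derivative g (at x) v" for v] iff
    by (auto simp: differentiable_def)
qed

text \<open>\<open>frechet_derivative\<close> is defined by choice. Uniqueness of the derivative
  identifies it with the explicit \<open>f'\<close> on \<open>S\<close>, and openness lets
  \<open>Ck_on_cong\<close> transfer regularity.\<close>

lemma Ck_onI:
  assumes "open S" "\<And>x. x \<in> S \<Longrightarrow> (f has_derivative f' x) (at x)"
    and "\<And>v. Ck_on k S (\<lambda>x. f' x v)"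
  shows "Ck_on (Suc k) S f"
proof -
  have "frechet_derivative f (at x) = f' x" if "x \<in> S" for x
    using frechet_derivative_at[OF assms(2)[OF that]] by simp
  then have "Ck_on k S (\<lambda>x. frechet_derivative f (at x) v)" for v
    using Ck_on_cong[OF assms(1) _ assms(3)[of v], of "\<lambda>x. frechet_derivative f (at x) v"] by simp
  then show ?thesis
    using assms(2) by (auto simp: differentiable_def)
qed

lemma Ck_on_SucD:
  "Ck_on (Suc k) S f \<Longrightarrow> x \<in> S \<Longrightarrow> (f has_derivative frechet_derivative f (at x)) (at x)"
  "Ck_on (Suc k) S f \<Longrightarrow> Ck_on k S (\<lambda>x. frechet_derivative f (at x) v)"
  by (simp_all flip: frechet_derivative_works)

lemma Ck_on_Suc: "Ck_on (Suc k) S f \<Longrightarrow> Ck_on k S f"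
proof (induction k arbitrary: f)
  case 0
  then show ?case
    by (simp add: continuous_at_imp_continuous_on differentiable_imp_continuous_within)
next
  case (Suc k)
  show ?case
    unfolding Ck_on.simps(2)[of k]
  proof (intro conjI allI)
    show "\<forall>x\<in>S. f differentiable (at x)" using Suc.prems by simp
    show "Ck_on k S (\<lambda>x. frechet_derivative f (at x) v)" for v
      by (rule Suc.IH) (use Suc.prems in \<open>simp only: Ck_on.simps(2)[of "Suc k"]\<close>)
  qed
qed

lemma Ck_on_subset: "Ck_on k S f \<Longrightarrow> R \<subseteq> S \<Longrightarrow> Ck_on k R f"
  by (induction k arbitrary: f) (auto intro: continuous_on_subset)

lemma Ck_on_local:
  assumes "\<And>x. x \<in> S \<Longrightarrow> \<exists>U. open U \<and> x \<in> U \<and> Ck_on k U f"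
  shows "Ck_on k S f"
  using assms
proof (induction k arbitrary: f)
  case 0
  then have "continuous (at x) f" if "x \<in> S" for x
    using 0 that continuous_on_eq_continuous_at by fastforce
  then show ?case by (simp add: continuous_at_imp_continuous_on)
next
  case (Suc k)
  have "Ck_on k S (\<lambda>x. frechet_derivative f (at x) v)" for v
  proof (rule Suc.IH)
    fix x assume "x \<in> S"
    then obtain U where "open U" "x \<in> U" "Ck_on (Suc k) U f" using Suc.prems by blast
    then show "\<exists>U. open U \<and> x \<in> U \<and> Ck_on k U (\<lambda>x. frechet_derivative f (at x) v)" by auto
  qed
  moreover have "f differentiable (at x)" if "x \<in> S" for x
    using Suc.prems[OF that] by auto
  ultimately show ?case by simp
qed

lemma Ck_on_const: "open S \<Longrightarrow> Ck_on k S (\<lambda>x. c)"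
proof (induction k arbitrary: c)
  case (Suc k)
  then show ?case by (auto intro: Ck_onI[where f'="\<lambda>_ _. 0"])
qed simp

lemma Ck_on_bounded_linear:
  assumes "open S" "bounded_linear L"
  shows "Ck_on k S L"
proof (cases k)
  case 0
  then show ?thesis using assms by (simp add: linear_continuous_on)
next
  case (Suc j)
  show ?thesis
    unfolding Suc
    by (rule Ck_onI[where f'="\<lambda>_. L"]) (use assms in \<open>auto intro: bounded_linear_imp_has_derivative Ck_on_const\<close>)
qed

lemma Ck_on_add:
  assumes "open S" "Ck_on k S f" "Ck_on k S g"
  shows "Ck_on k S (\<lambda>x. f x + g x)"
  using assms(2,3)
proof (induction k arbitrary: f g)
  case 0
  then show ?case by (simp add: continuous_on_add)
next
  case (Suc k)
  show ?case
    by (rule Ck_onI[where f'="\<lambda>x v. frechet_derivative f (at x) v + frechet_derivative g (at x) v"])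
      (intro assms(1) has_derivative_add Ck_on_SucD(1)[OF Suc.prems(1)] Ck_on_SucD(1)[OF Suc.prems(2)]
        Suc.IH Ck_on_SucD(2)[OF Suc.prems(1)] Ck_on_SucD(2)[OF Suc.prems(2)]; assumption)+
qed

lemma Ck_on_sum:
  assumes "open S" "\<And>i. i \<in> I \<Longrightarrow> Ck_on k S (f i)"
  shows "Ck_on k S (\<lambda>x. \<Sum>i\<in>I. f i x)"
  using assms(2)
  by (induction I rule: infinite_finite_induct) (simp_all add: assms(1) Ck_on_const Ck_on_add)

lemma (in bounded_bilinear) Ck_on_prod:
  assumes "open S" "Ck_on k S f" "Ck_on k S g"
  shows "Ck_on k S (\<lambda>x. prod (f x) (g x))"
  using assms(2,3)
proof (induction k arbitrary: f g)
  case 0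
  then show ?case by (simp add: continuous_on)
next
  case (Suc k)
  show ?case
    by (rule Ck_onI[where f'="\<lambda>x v. prod (f x) (frechet_derivative g (at x) v)
            + prod (frechet_derivative f (at x) v) (g x)"])
      (intro assms(1) FDERIV Ck_on_SucD(1)[OF Suc.prems(1)] Ck_on_SucD(1)[OF Suc.prems(2)] Ck_on_add
        Suc.IH Ck_on_SucD(2)[OF Suc.prems(1)] Ck_on_SucD(2)[OF Suc.prems(2)]
        Ck_on_Suc[OF Suc.prems(1)] Ck_on_Suc[OF Suc.prems(2)]; assumption)+
qed

lemmas Ck_on_mult = bounded_bilinear.Ck_on_prod[OF bounded_bilinear_mult]
lemmas Ck_on_scaleR = bounded_bilinear.Ck_on_prod[OF bounded_bilinear_scaleR]
lemmas Ck_on_inner = bounded_bilinear.Ck_on_prod[OF bounded_bilinear_inner]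

lemma Ck_on_compose:
  fixes g :: "'e::real_normed_vector \<Rightarrow> 'f::euclidean_space" and f :: "'f \<Rightarrow> 'h::real_normed_vector"
  assumes "open S" "open R" "g ` S \<subseteq> R" "Ck_on k R f" "Ck_on k S g"
  shows "Ck_on k S (\<lambda>x. f (g x))"
  using assms(4,5)
proof (induction k arbitrary: f)
  case 0
  then show ?case using assms(3) by (simp add: continuous_on_compose2)
next
  case (Suc k)
  let ?f' = "\<lambda>x v. frechet_derivative f (at x) v" and ?g' = "\<lambda>x v. frechet_derivative g (at x) v"
  \<comment> \<open>The induction hypothesis concerns derivatives of \<open>f\<close> in a fixed
    direction, but the chain rule produces the moving direction \<open>?g' x v\<close>. Expanding it
    in \<open>Basis\<close> separates the two.\<close>
  have lin: "?f' (g x) (?g' x v) = (\<Sum>b\<in>Basis. (?g' x v \<bullet> b) *\<^sub>R ?f' (g x) b)" if "x \<in> S" for x v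
  proof -
    have "linear (frechet_derivative f (at (g x)))"
      using Ck_on_SucD(1)[OF Suc.prems(1), of "g x"] assms(3) that
      by (auto intro!: bounded_linear.linear has_derivative_bounded_linear)
    then have "?f' (g x) (\<Sum>b\<in>Basis. (?g' x v \<bullet> b) *\<^sub>R b) = (\<Sum>b\<in>Basis. (?g' x v \<bullet> b) *\<^sub>R ?f' (g x) b)"
      by (simp add: linear_sum linear_cmul)
    then show ?thesis by (simp add: euclidean_representation)
  qed
  have "Ck_on k S (\<lambda>x. (?g' x v \<bullet> b) *\<^sub>R ?f' (g x) b)" for v b
    by (intro Ck_on_scaleR assms(1) Ck_on_inner Ck_on_SucD(2)[OF Suc.prems(2)] Ck_on_const
        Suc.IH Ck_on_SucD(2)[OF Suc.prems(1)] Ck_on_Suc[OF Suc.prems(2)])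
  then have "Ck_on k S (\<lambda>x. \<Sum>b\<in>Basis. (?g' x v \<bullet> b) *\<^sub>R ?f' (g x) b)" for v
    by (intro Ck_on_sum assms(1))
  then have "Ck_on k S (\<lambda>x. ?f' (g x) (?g' x v))" for v
    using Ck_on_cong[OF assms(1), of "\<lambda>x. \<Sum>b\<in>Basis. (?g' x v \<bullet> b) *\<^sub>R ?f' (g x) b" "\<lambda>x. ?f' (g x) (?g' x v)"]
    by (simp add: lin)
  moreover have "((\<lambda>x. f (g x)) has_derivative (\<lambda>v. ?f' (g x) (?g' x v))) (at x)" if "x \<in> S" for x
    using Ck_on_SucD(1)[OF Suc.prems(2) that] Ck_on_SucD(1)[OF Suc.prems(1), of "g x"] assms(3) that
    by (auto intro: has_derivative_compose)
  ultimately show ?case using Ck_onI[OF assms(1), of "\<lambda>x. f (g x)" "\<lambda>x v. ?f' (g x) (?g' x v)"] by blast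
qed

text \<open>The family \<open>p(1/x) exp(-1/x)\<close> is closed under differentiation, which gives smoothness by induction.\<close>

definition flat :: "real poly \<Rightarrow> real \<Rightarrow> real" where
  "flat p x = (if x \<le> 0 then 0 else poly p (1 / x) * exp (- (1 / x)))"

lemma poly_exp_tendsto_0: "((\<lambda>y. poly p y * exp (- y)) \<longlongrightarrow> 0) at_top" for p :: "real poly"
proof -
  have "((\<lambda>y. \<Sum>i\<le>degree p. coeff p i * (y ^ i / exp y)) \<longlongrightarrow> (\<Sum>i\<le>degree p. coeff p i * 0)) at_top"
    by (intro tendsto_intros tendsto_power_div_exp_0)
  then show ?thesis
    by (simp add: poly_altdef sum_distrib_right exp_minus divide_inverse mult.assoc)
qed

text \<open>With \<open>y = 1 / x\<close>, differentiation turns \<open>p\<close> into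
  \<open>y^2 (p - p')\<close>, which is the polynomial in the statement. At 0 the difference
  quotient from the right belongs to the polynomial \<open>y p\<close>, and the exponential decay
  beats it.\<close>

lemma flat_has_derivative:
  "(flat p has_field_derivative flat ([:0, 0, 1:] * (p - pderiv p)) x) (at x)"
proof -
  consider "x < 0" | "x = 0" | "x > 0" by linarith
  then show ?thesis
  proof cases
    case 1
    have "((\<lambda>_. 0) has_field_derivative 0) (at x)" by simp
    then have "(flat p has_field_derivative 0) (at x)"
      by (rule has_field_derivative_transform_within_open[where S="{..<0}"]) (use 1 in \<open>auto simp: flat_def\<close>)
    then show ?thesis using 1 by (simp add: flat_def)
  next
    case 2
    have "((\<lambda>y. flat p y / y) \<longlongrightarrow> 0) (at_right 0)"
    proof -
      have "((\<lambda>y. poly ([:0, 1:] * p) (inverse y) * exp (- (inverse y))) \<longlongrightarrow> 0) (at_right 0)"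
        by (rule filterlim_compose[OF poly_exp_tendsto_0 filterlim_inverse_at_top_right])
      then show ?thesis
        by (rule Lim_transform_eventually)
          (auto simp: eventually_at_right_field flat_def field_simps intro!: exI[of _ 1])
    qed
    moreover have "((\<lambda>y. flat p y / y) \<longlongrightarrow> 0) (at_left 0)"
      by (rule Lim_transform_eventually[OF tendsto_const])
        (auto simp: eventually_at_left_field flat_def intro!: exI[of _ "-1"])
    ultimately have "((\<lambda>y. flat p y / y) \<longlongrightarrow> 0) (at 0)"
      using filterlim_split_at by blast
    then have "(flat p has_field_derivative 0) (at 0)"
      by (simp add: has_field_derivative_iff flat_def[of p 0])
    then show ?thesis using 2 by (simp add: flat_def)
  next
    case 3
    have i: "((\<lambda>x. 1 / x) has_field_derivative - (1 / x * (1 / x))) (at x)"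
      using 3 by (auto intro!: derivative_eq_intros simp: field_simps)
    have "((\<lambda>x. poly p (1 / x) * exp (- (1 / x))) has_field_derivative
        poly p (1 / x) * (exp (- (1 / x)) * - (- (1 / x * (1 / x))))
        + poly (pderiv p) (1 / x) * - (1 / x * (1 / x)) * exp (- (1 / x))) (at x)"
      by (rule DERIV_mult'[OF DERIV_chain2[OF poly_DERIV i] DERIV_chain2[OF DERIV_exp DERIV_minus[OF i]]])
    also have "poly p (1 / x) * (exp (- (1 / x)) * - (- (1 / x * (1 / x))))
        + poly (pderiv p) (1 / x) * - (1 / x * (1 / x)) * exp (- (1 / x))
        = flat ([:0, 0, 1:] * (p - pderiv p)) x"
      using 3 by (simp add: flat_def algebra_simps)
    finally have "((\<lambda>x. poly p (1 / x) * exp (- (1 / x))) has_field_derivative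
        flat ([:0, 0, 1:] * (p - pderiv p)) x) (at x)" .
    then show ?thesis
      by (rule has_field_derivative_transform_within_open[where S="{0<..}"]) (use 3 in \<open>auto simp: flat_def\<close>)
  qed
qed

lemma Ck_on_flat: "Ck_on k UNIV (flat p)"
proof (induction k arbitrary: p)
  case 0
  then show ?case
    using flat_has_derivative by (auto intro!: DERIV_isCont continuous_at_imp_continuous_on)
next
  case (Suc k)
  show ?case
  proof (rule Ck_onI)
    show "(flat p has_derivative (\<lambda>v. flat ([:0, 0, 1:] * (p - pderiv p)) x * v)) (at x)" for x
      using flat_has_derivative has_field_derivative_def by blast
    show "Ck_on k UNIV (\<lambda>x. flat ([:0, 0, 1:] * (p - pderiv p)) x * v)" for v
      by (intro Ck_on_mult Suc.IH Ck_on_const) auto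
  qed simp
qed

section \<open>Bump functions and Hadamard's lemma\<close>

definition bump :: "'e::euclidean_space \<Rightarrow> real \<Rightarrow> 'e \<Rightarrow> real" where
  "bump c r x = flat 1 (r\<^sup>2 - (x - c) \<bullet> (x - c))"

lemma Ck_on_bump: "Ck_on k UNIV (bump c r)"
proof -
  have "Ck_on k UNIV (\<lambda>x. x - c)"
    using Ck_on_add[OF open_UNIV Ck_on_bounded_linear[OF open_UNIV bounded_linear_ident] Ck_on_const[OF open_UNIV, of k "- c"]]
    by simp
  then have "Ck_on k UNIV (\<lambda>x. r\<^sup>2 + (- 1) * ((x - c) \<bullet> (x - c)))"
    by (intro Ck_on_add Ck_on_mult Ck_on_inner Ck_on_const) auto
  then have "Ck_on k UNIV (\<lambda>x. flat 1 (r\<^sup>2 + (- 1) * ((x - c) \<bullet> (x - c))))"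
    by (rule Ck_on_compose[OF open_UNIV open_UNIV subset_UNIV Ck_on_flat])
  then show ?thesis by (simp add: bump_def[abs_def])
qed

lemma bump_pos: "r > 0 \<Longrightarrow> bump c r c > 0"
  by (simp add: bump_def flat_def)

lemma bump_eq_0:
  assumes "x \<notin> cball c r" "r \<ge> 0"
  shows "bump c r x = 0"
proof -
  have "r \<le> norm (x - c)"
    using assms(1) by (simp add: dist_norm norm_minus_commute)
  then have "r\<^sup>2 \<le> (norm (x - c))\<^sup>2"
    using assms(2) by (intro power_mono)
  then show ?thesis
    by (simp only: bump_def flat_def power2_norm_eq_inner) simp
qed

lemma segment_in_ball:
  fixes c :: "'e::real_normed_vector"
  assumes "x \<in> ball c r" "t \<in> {0..1::real}"
  shows "c + t *\<^sub>R (x - c) \<in> ball c r"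
proof -
  have "norm (t *\<^sub>R (x - c)) \<le> norm (x - c)"
    using assms(2) by (simp add: mult_left_le_one_le)
  then show ?thesis using assms(1) by (simp add: dist_norm norm_minus_commute)
qed

text \<open>For \<open>m = 0\<close> these are the coefficients in Hadamard's lemma. The weight
  \<open>t ^ m\<close> closes the family under differentiation, since the chain rule for
  \<open>c + t (x - c)\<close> raises the exponent by one.\<close>

definition moment :: "'e::euclidean_space \<Rightarrow> nat \<Rightarrow> ('e \<Rightarrow> real) \<Rightarrow> 'e \<Rightarrow> real" where
  "moment c m f x = integral {0..1} (\<lambda>t. t ^ m * f (c + t *\<^sub>R (x - c)))"

lemma continuous_moment_integrand:
  fixes f :: "'e::real_normed_vector \<Rightarrow> real"
  assumes "continuous_on (ball c r) f"
  shows "continuous_on (ball c r \<times> cbox 0 1) (\<lambda>(x, t). t ^ m * f (c + t *\<^sub>R (x - c)))"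
  unfolding split_beta
  by (intro continuous_intros continuous_on_compose2[OF assms]) (auto intro!: segment_in_ball continuous_intros simp: mem_Times_iff simp del: mem_ball)

lemma continuous_line:
  fixes f :: "'e::real_normed_vector \<Rightarrow> real"
  assumes "continuous_on (ball c r) f" "x \<in> ball c r"
  shows "continuous_on {0..1} (\<lambda>t. t ^ m * f (c + t *\<^sub>R (x - c)))"
  using assms(2) by (intro continuous_intros continuous_on_compose2[OF assms(1)]) (auto intro!: segment_in_ball continuous_intros simp del: mem_ball)

lemma Ck_on_moment:
  fixes f :: "'e::euclidean_space \<Rightarrow> real"
  shows "Ck_on k (ball c r) f \<Longrightarrow> Ck_on k (ball c r) (moment c m f)"
proof (induction k arbitrary: f m)
  case 0
  then show ?case
    using integral_continuous_on_param[OF continuous_moment_integrand, of c r f m]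
    by (simp add: moment_def[abs_def])
next
  case (Suc k)
  let ?f' = "\<lambda>x v. frechet_derivative f (at x) v"
  have f': "(f has_derivative ?f' x) (at x)" if "x \<in> ball c r" for x
    using Ck_on_SucD(1)[OF Suc.prems that] .
  \<comment> \<open>\<open>w x t\<close> is the gradient of the integrand with respect to
    \<open>x\<close>. Differentiation under the integral requires derivatives in the form of bounded
    linear functions, here the inner product with this vector.\<close>
  define w where "w x t = t ^ Suc m *\<^sub>R (\<Sum>b\<in>Basis. ?f' (c + t *\<^sub>R (x - c)) b *\<^sub>R b)" for x t
  have cont': "continuous_on (ball c r) (\<lambda>x. ?f' x v)" for v
    using Suc.prems by (cases k) (auto dest: Ck_on_Suc simp: continuous_at_imp_continuous_on differentiable_imp_continuous_within)
  have w: "w x t \<bullet> v = t ^ Suc m * ?f' (c + t *\<^sub>R (x - c)) v" if "x \<in> ball c r" "t \<in> {0..1}" for x t v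
  proof -
    have "linear (?f' (c + t *\<^sub>R (x - c)))"
      using f'[OF segment_in_ball[OF that]] by (intro bounded_linear.linear has_derivative_bounded_linear)
    then have "?f' (c + t *\<^sub>R (x - c)) (\<Sum>b\<in>Basis. (v \<bullet> b) *\<^sub>R b) = (\<Sum>b\<in>Basis. ?f' (c + t *\<^sub>R (x - c)) b * (b \<bullet> v))"
      by (simp add: linear_sum linear_cmul inner_commute mult.commute)
    then show ?thesis by (simp add: w_def inner_sum_left euclidean_representation)
  qed
  have der: "((\<lambda>x. t ^ m * f (c + t *\<^sub>R (x - c))) has_derivative blinfun_inner_right (w x t)) (at x within ball c r)"
    if "x \<in> ball c r" "t \<in> cbox 0 1" for x t
  proof -
    have t: "t \<in> {0..1}" using that(2) by simp
    have "((\<lambda>x. c + t *\<^sub>R (x - c)) has_derivative (\<lambda>v. t *\<^sub>R v)) (at x)"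
      by (auto intro!: derivative_eq_intros)
    from has_derivative_mult_right[OF has_derivative_compose[OF this f'[OF segment_in_ball[OF that(1) t]]]]
    have "((\<lambda>x. t ^ m * f (c + t *\<^sub>R (x - c))) has_derivative (\<lambda>v. t ^ m * ?f' (c + t *\<^sub>R (x - c)) (t *\<^sub>R v))) (at x)" .
    moreover have "t ^ m * ?f' (c + t *\<^sub>R (x - c)) (t *\<^sub>R v) = w x t \<bullet> v" for v
      unfolding w[OF that(1) t]
      using linear_cmul[OF bounded_linear.linear[OF has_derivative_bounded_linear[OF f'[OF segment_in_ball[OF that(1) t]]]]]
      by simp
    ultimately show ?thesis
      by (simp add: has_derivative_at_withinI)
  qed
  have contw: "continuous_on (ball c r \<times> cbox 0 1) (\<lambda>(x, t). blinfun_inner_right (w x t))"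
    unfolding split_beta w_def
    by (intro bounded_linear.continuous_on[OF bounded_linear_blinfun_inner_right] continuous_intros
        continuous_on_compose2[OF cont']) (auto intro!: segment_in_ball continuous_intros simp: mem_Times_iff simp del: mem_ball)
  have "(moment c m f has_derivative (\<lambda>v. moment c (Suc m) (\<lambda>x. ?f' x v) x)) (at x)" if x: "x \<in> ball c r" for x
  proof -
    have cf: "continuous_on (ball c r) f" using Suc.prems
      by (auto simp: continuous_at_imp_continuous_on differentiable_imp_continuous_within)
    have "((\<lambda>x. integral (cbox 0 1) (\<lambda>t. t ^ m * f (c + t *\<^sub>R (x - c)))) has_derivative
        integral (cbox 0 1) (\<lambda>t. blinfun_inner_right (w x t))) (at x within ball c r)"
      by (rule leibniz_rule[OF der _ contw x convex_ball])
        (use continuous_line[OF cf] in \<open>auto intro!: integrable_continuous_real\<close>)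
    moreover
    have "blinfun_apply (integral (cbox 0 1) (\<lambda>t. blinfun_inner_right (w x t))) v = moment c (Suc m) (\<lambda>x. ?f' x v) x" for v
    proof -
      have "continuous_on (cbox 0 1) (\<lambda>t. (\<lambda>(x, t). blinfun_inner_right (w x t)) (x, t))"
        by (rule continuous_on_compose2[OF contw]) (use x in \<open>auto intro!: continuous_intros\<close>)
      then have "continuous_on (cbox 0 1) (\<lambda>t. blinfun_inner_right (w x t))" by simp
      then have "blinfun_apply (integral (cbox 0 1) (\<lambda>t. blinfun_inner_right (w x t))) v = integral (cbox 0 1) (\<lambda>t. w x t \<bullet> v)"
        by (subst blinfun_apply_integral) (auto intro!: integrable_continuous_real)
      also have "\<dots> = moment c (Suc m) (\<lambda>x. ?f' x v) x"
        unfolding moment_def box_real by (rule integral_cong) (rule w[OF x])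
      finally show ?thesis .
    qed
    then have "blinfun_apply (integral (cbox 0 1) (\<lambda>t. blinfun_inner_right (w x t))) =
        (\<lambda>v. moment c (Suc m) (\<lambda>x. ?f' x v) x)"
      by (rule ext)
    ultimately show ?thesis
      using x by (simp only: moment_def[abs_def] at_within_open[OF _ open_ball] box_real)
  qed
  then show ?case
    by (rule Ck_onI[OF open_ball]) (assumption, intro Suc.IH Ck_on_SucD(2)[OF Suc.prems])
qed

text \<open>Integrate the derivative of \<open>f\<close> along the segment from \<open>c\<close> to
  \<open>x\<close> and expand the velocity \<open>x - c\<close> in \<open>Basis\<close>. The point
  is that the coefficients are moments, hence smooth in \<open>x\<close> when \<open>f\<close>
  is.\<close>

lemma hadamard:
  fixes f :: "'e::euclidean_space \<Rightarrow> real"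
  assumes "Ck_on (Suc 0) (ball c r) f" "x \<in> ball c r"
  shows "f x - f c = (\<Sum>b\<in>Basis. ((x - c) \<bullet> b) * moment c 0 (\<lambda>x. frechet_derivative f (at x) b) x)"
proof -
  let ?f' = "\<lambda>x v. frechet_derivative f (at x) v"
  have f': "(f has_derivative ?f' x) (at x)" if "x \<in> ball c r" for x
    using Ck_on_SucD(1)[OF assms(1) that] .
  have "((\<lambda>t. f (c + t *\<^sub>R (x - c))) has_vector_derivative ?f' (c + t *\<^sub>R (x - c)) (x - c)) (at t within {0..1})"
    if "t \<in> {0..1}" for t
  proof -
    have l: "linear (?f' (c + t *\<^sub>R (x - c)))"
      using f'[OF segment_in_ball[OF assms(2) that]] by (intro bounded_linear.linear has_derivative_bounded_linear)
    have "((\<lambda>t. c + t *\<^sub>R (x - c)) has_derivative (\<lambda>s. s *\<^sub>R (x - c))) (at t)"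
      by (auto intro!: derivative_eq_intros)
    from has_derivative_compose[OF this f'[OF segment_in_ball[OF assms(2) that]]]
    have "((\<lambda>t. f (c + t *\<^sub>R (x - c))) has_derivative (\<lambda>s. ?f' (c + t *\<^sub>R (x - c)) (s *\<^sub>R (x - c)))) (at t)" .
    then show ?thesis
      by (simp add: has_vector_derivative_def linear_cmul[OF l] has_derivative_at_withinI)
  qed
  then have "((\<lambda>t. ?f' (c + t *\<^sub>R (x - c)) (x - c)) has_integral f (c + 1 *\<^sub>R (x - c)) - f (c + 0 *\<^sub>R (x - c))) {0..1}"
    by (intro fundamental_theorem_of_calculus) auto
  then have "f x - f c = integral {0..1} (\<lambda>t. ?f' (c + t *\<^sub>R (x - c)) (x - c))"
    by (simp add: integral_unique)
  also have "\<dots> = integral {0..1} (\<lambda>t. \<Sum>b\<in>Basis. ((x - c) \<bullet> b) * (t ^ 0 * ?f' (c + t *\<^sub>R (x - c)) b))"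
  proof (rule integral_cong)
    fix t :: real assume t: "t \<in> {0..1}"
    have "linear (?f' (c + t *\<^sub>R (x - c)))"
      using f'[OF segment_in_ball[OF assms(2) t]] by (intro bounded_linear.linear has_derivative_bounded_linear)
    then have "?f' (c + t *\<^sub>R (x - c)) (\<Sum>b\<in>Basis. ((x - c) \<bullet> b) *\<^sub>R b) = (\<Sum>b\<in>Basis. ((x - c) \<bullet> b) * ?f' (c + t *\<^sub>R (x - c)) b)"
      by (simp only: linear_sum linear_cmul) simp
    then show "?f' (c + t *\<^sub>R (x - c)) (x - c) = (\<Sum>b\<in>Basis. ((x - c) \<bullet> b) * (t ^ 0 * ?f' (c + t *\<^sub>R (x - c)) b))"
      by (simp add: euclidean_representation)
  qed
  also have "\<dots> = (\<Sum>b\<in>Basis. ((x - c) \<bullet> b) * moment c 0 (\<lambda>x. ?f' x b) x)"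
  proof -
    have "continuous_on (ball c r) (\<lambda>x. ?f' x b)" for b
      using Ck_on_SucD(2)[OF assms(1)] by simp
    then have i: "(\<lambda>t. ((x - c) \<bullet> b) * (t ^ 0 * ?f' (c + t *\<^sub>R (x - c)) b)) integrable_on {0..1}" for b
      by (intro integrable_on_mult_right integrable_continuous_real continuous_line[OF _ assms(2)])
    show ?thesis
      by (subst integral_sum) (use i in \<open>simp_all add: moment_def\<close>)
  qed
  finally show ?thesis .
qed

section \<open>Vector fields\<close>

text \<open>A maximal orthonormal family has the Parseval property, because a nonzero residue could
  be normalised and added. \<open>L\<close> maps orthonormal families to independent ones and so
  bounds their size. The elements are to be vector fields paired at one point, so \<open>G\<close>
  is only semidefinite and equations hold up to null elements; \<open>comb\<close> stands for linear
  combinations.\<close>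

lemma finite_parseval_frame:
  fixes G :: "'v \<Rightarrow> 'v \<Rightarrow> real" and L :: "'v \<Rightarrow> 'e::euclidean_space"
  assumes sym: "\<And>X Y. X \<in> S \<Longrightarrow> Y \<in> S \<Longrightarrow> G X Y = G Y X"
    and nonneg: "\<And>X. X \<in> S \<Longrightarrow> G X X \<ge> 0"
    and null: "\<And>X Y. X \<in> S \<Longrightarrow> Y \<in> S \<Longrightarrow> G X X = 0 \<Longrightarrow> G X Y = 0"
    and null_L: "\<And>X Y. X \<in> S \<Longrightarrow> Y \<in> S \<Longrightarrow> L X = 0 \<Longrightarrow> G X Y = 0"
    and comb: "\<And>F u. finite F \<Longrightarrow> F \<subseteq> S \<Longrightarrow>
      \<exists>Z\<in>S. (\<forall>Y\<in>S. G Z Y = (\<Sum>E\<in>F. u E * G E Y)) \<and> L Z = (\<Sum>E\<in>F. u E *\<^sub>R L E)"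
  shows "\<exists>I\<subseteq>S. finite I \<and> (\<forall>X\<in>S. \<forall>Y\<in>S. G X Y = (\<Sum>E\<in>I. G X E * G Y E))"
proof -
  define orth where "orth F \<longleftrightarrow> finite F \<and> F \<subseteq> S \<and> (\<forall>E\<in>F. \<forall>E'\<in>F. G E E' = (if E = E' then 1 else 0))" for F
  have coeff: "u E' = 0" if F: "orth F" and z: "(\<Sum>E\<in>F. u E *\<^sub>R L E) = 0" and "E' \<in> F" for F u E'
  proof -
    obtain Z where Z: "Z \<in> S" "\<And>Y. Y \<in> S \<Longrightarrow> G Z Y = (\<Sum>E\<in>F. u E * G E Y)" "L Z = 0"
      using comb[of F u] F z unfolding orth_def by auto
    have "0 = G Z E'" using null_L[OF Z(1) _ Z(3)] F that(3) unfolding orth_def by auto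
    also have "\<dots> = (\<Sum>E\<in>F. u E * G E E')" using Z(2) F that(3) unfolding orth_def by auto
    also have "\<dots> = (\<Sum>E\<in>F. if E = E' then u E else 0)"
      using F that(3) unfolding orth_def by (intro sum.cong) auto
    also have "\<dots> = u E'" using F that(3) unfolding orth_def by simp
    finally show ?thesis by simp
  qed
  have bound: "card F \<le> DIM('e)" if F: "orth F" for F
  proof -
    have fin: "finite F" using F by (simp add: orth_def)
    have inj: "inj_on L F"
    proof (rule inj_onI, rule ccontr)
      fix a b assume ab: "a \<in> F" "b \<in> F" "L a = L b" "a \<noteq> b"
      have "(\<Sum>E\<in>F. (if E = a then 1 else if E = b then - 1 else 0) *\<^sub>R L E)
          = (\<Sum>E\<in>{a, b}. (if E = a then 1 else if E = b then - 1 else 0) *\<^sub>R L E)"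
        using fin ab by (intro sum.mono_neutral_right) auto
      also have "\<dots> = 0" using ab by simp
      finally show False using coeff[OF F _ ab(1), of "\<lambda>E. if E = a then 1 else if E = b then - 1 else 0"] by simp
    qed
    have "independent (L ` F)"
    proof (rule independent_if_scalars_zero)
      show "finite (L ` F)" using fin by simp
      fix f x assume s: "(\<Sum>x\<in>L ` F. f x *\<^sub>R x) = 0" and x: "x \<in> L ` F"
      then obtain E where E: "E \<in> F" "x = L E" by auto
      have "(\<Sum>E\<in>F. f (L E) *\<^sub>R L E) = 0" using s by (simp add: sum.reindex[OF inj])
      then show "f x = 0" using coeff[OF F _ E(1), of "\<lambda>E. f (L E)"] E(2) by simp
    qed
    then have "card (L ` F) \<le> DIM('e)" using independent_bound by blast
    then show ?thesis by (simp add: card_image inj)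
  qed
  have "orth {}" by (simp add: orth_def)
  then obtain I where I: "orth I" and max: "\<And>F. orth F \<Longrightarrow> card F \<le> card I"
    using ex_has_greatest_nat[of orth "{}" card "Suc DIM('e)"] bound by (auto simp: le_imp_less_Suc)
  have fin: "finite I" and IS: "I \<subseteq> S" using I by (auto simp: orth_def)
  have "G X Y = (\<Sum>E\<in>I. G X E * G Y E)" if X: "X \<in> S" and Y: "Y \<in> S" for X Y
  proof -
    \<comment> \<open>Coefficients of the residue \<open>X - (\<Sum>E\<in>I. G X E E)\<close> over
      \<open>insert X I\<close>. If \<open>X\<close> already belongs to \<open>I\<close>, its own
      projection has to be merged with the leading coefficient 1.\<close>
    let ?u = "\<lambda>E. if E = X then 1 - (if X \<in> I then G X X else 0) else - G X E"
    have "finite (insert X I)" "insert X I \<subseteq> S" using fin IS X by auto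
    from comb[OF this, of ?u] obtain Z where Z: "Z \<in> S"
      "\<And>Y. Y \<in> S \<Longrightarrow> G Z Y = (\<Sum>E\<in>insert X I. ?u E * G E Y)" by auto
    have GZ: "G Z Y = G X Y - (\<Sum>E\<in>I. G X E * G E Y)" if "Y \<in> S" for Y
    proof (cases "X \<in> I")
      case True
      have "(\<Sum>E\<in>I. ?u E * G E Y) = (\<Sum>E\<in>I. (if E = X then G X Y else 0) - G X E * G E Y)"
        using True by (intro sum.cong) (auto simp: algebra_simps)
      then show ?thesis using Z(2)[OF that] True fin by (simp add: insert_absorb sum_subtractf)
    next
      case False
      have "(\<Sum>E\<in>I. ?u E * G E Y) = (\<Sum>E\<in>I. - (G X E * G E Y))"
        using False by (intro sum.cong) auto
      then show ?thesis using Z(2)[OF that] False fin by (simp add: sum_negf)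
    qed
    have ZE: "G Z E = 0" if "E \<in> I" for E
    proof -
      have "(\<Sum>E'\<in>I. G X E' * G E' E) = (\<Sum>E'\<in>I. if E' = E then G X E' else 0)"
        using I that unfolding orth_def by (intro sum.cong) auto
      also have "\<dots> = G X E" using that fin by simp
      finally show ?thesis using GZ[of E] that IS by auto
    qed
    have "G Z Z = 0"
    proof (rule ccontr)
      assume "G Z Z \<noteq> 0"
      then have pos: "G Z Z > 0" using nonneg[OF Z(1)] by simp
      have "finite {Z}" "{Z} \<subseteq> S" using Z by auto
      from comb[OF this, of "\<lambda>_. 1 / sqrt (G Z Z)"] obtain N where N: "N \<in> S"
        "\<And>Y. Y \<in> S \<Longrightarrow> G N Y = G Z Y / sqrt (G Z Z)" by auto
      have "G N Z = sqrt (G Z Z)" using N(2)[OF Z(1)] pos by (simp add: real_div_sqrt)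
      then have NN: "G N N = 1" using N(2)[OF N(1)] sym[OF N(1) Z(1)] pos by simp
      have NE: "G N E = 0" "G E N = 0" if "E \<in> I" for E
        using N(2)[of E] ZE[OF that] that IS sym[OF N(1), of E] by auto
      then have "N \<notin> I" using NN by force
      moreover have "orth (insert N I)"
        using I N(1) NN NE unfolding orth_def by auto
      ultimately show False using max[of "insert N I"] fin by simp
    qed
    then have "G Z Y = 0" using null[OF Z(1) Y] by simp
    then have "G X Y = (\<Sum>E\<in>I. G X E * G E Y)" using GZ[OF Y] by simp
    also have "\<dots> = (\<Sum>E\<in>I. G X E * G Y E)" using sym[OF Y] IS by (intro sum.cong) auto
    finally show ?thesis .
  qed
  then show ?thesis using fin IS by blast
qed

section \<open>Charts and globally defined smooth functions\<close>

locale smooth_manifold =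
  fixes A :: "('a::{t2_space, second_countable_topology}, 'e::euclidean_space) atlas"
  assumes atlas: "smooth_atlas A"
begin

abbreviation "VF \<equiv> vector_fields A"
abbreviation "TS \<equiv> tangent_space A"

lemma chart:
  assumes "(U, c) \<in> A"
  shows "open U" "open (c ` U)" "homeomorphism U (c ` U) c (inv_into U c)" "inj_on c U"
proof -
  show "open U" "open (c ` U)" and h: "homeomorphism U (c ` U) c (inv_into U c)"
    using atlas assms unfolding smooth_atlas_def by auto
  show "inj_on c U" using h unfolding homeomorphism_def by (auto intro: inj_on_inverseI)
qed

lemma chart_open_image:
  assumes "(U, c) \<in> A" "open W" "W \<subseteq> U"
  shows "open (c ` W)"
proof -
  have "openin (top_of_set U) W" using assms(2,3) by (simp add: openin_open_eq chart(1)[OF assms(1)] open_subset)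
  then have "openin (top_of_set (c ` U)) (c ` W)"
    by (rule homeomorphism_imp_open_map[OF chart(3)[OF assms(1)]])
  then show ?thesis using chart(2)[OF assms(1)] openin_open_trans by blast
qed

lemma ex_chart: "\<exists>U c. (U, c) \<in> A \<and> p \<in> U"
proof -
  have "p \<in> (\<Union>(U, c)\<in>A. U)" using atlas by (simp add: smooth_atlas_def)
  then show ?thesis by auto
qed

lemma transition:
  assumes "(U, c) \<in> A" "(V, d) \<in> A"
  shows "Ck_on k (d ` (V \<inter> U)) (c \<circ> inv_into V d)"
  using atlas assms unfolding smooth_atlas_def smooth_on_def by fast

lemma smooth_funD: "smooth_fun A f \<Longrightarrow> (U, c) \<in> A \<Longrightarrow> Ck_on k (c ` U) (\<lambda>x. f (inv_into U c x))"
  unfolding smooth_fun_def smooth_on_def comp_def by blast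

lemma smooth_funI: "(\<And>U c k. (U, c) \<in> A \<Longrightarrow> Ck_on k (c ` U) (\<lambda>x. f (inv_into U c x))) \<Longrightarrow> smooth_fun A f"
  unfolding smooth_fun_def smooth_on_def comp_def by blast

lemma smooth_const [simp, intro]: "smooth_fun A (\<lambda>q. a)"
  by (rule smooth_funI) (simp add: Ck_on_const chart(2))

lemma smooth_mult [simp, intro]: "smooth_fun A f \<Longrightarrow> smooth_fun A h \<Longrightarrow> smooth_fun A (f * h)"
  by (rule smooth_funI) (simp add: Ck_on_mult smooth_funD chart(2))

lemma smooth_add [simp, intro]: "smooth_fun A f \<Longrightarrow> smooth_fun A h \<Longrightarrow> smooth_fun A (f + h)"
  by (rule smooth_funI) (simp add: Ck_on_add smooth_funD chart(2))

lemma smooth_lincomb: "smooth_fun A f \<Longrightarrow> smooth_fun A h \<Longrightarrow> smooth_fun A (\<lambda>q. a * f q + b * h q)"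
  using smooth_add[OF smooth_mult[OF smooth_const[of a]] smooth_mult[OF smooth_const[of b]], of f h]
  by (simp add: func_plus func_times)

lemma smooth_zero [simp, intro]: "smooth_fun A 0"
  using smooth_const[of 0] by (simp add: func_zero)

lemma smooth_minus [simp, intro]: "smooth_fun A f \<Longrightarrow> smooth_fun A (- f)"
  using smooth_lincomb[of f f "- 1" 0] by (simp add: fun_Compl_def)

lemma smooth_diff [simp, intro]: "smooth_fun A f \<Longrightarrow> smooth_fun A h \<Longrightarrow> smooth_fun A (f - h)"
  using smooth_add[of f "- h"] by simp

text \<open>Two open sets cover the manifold. On the preimage \<open>W\<close> of the ball of radius
  \<open>2 r\<close> the function is smooth through the transition maps. Off the preimage
  \<open>K\<close> of the closed ball of radius \<open>r\<close> it vanishes, and \<open>K\<close>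
  is closed because it is compact in a Hausdorff space. The doubled radius leaves the
  overlap.\<close>

lemma smooth_fun_bump_extension:
  assumes Uc: "(U, c) \<in> A" and p: "p \<in> U" and r: "0 < r" "ball (c p) (2 * r) \<subseteq> c ` U"
    and u: "\<And>k. Ck_on k (ball (c p) (2 * r)) u"
  shows "smooth_fun A (\<lambda>q. if q \<in> U then bump (c p) r (c q) * u (c q) else 0)" (is "smooth_fun A ?F")
proof (rule smooth_funI)
  fix V d k assume Vd: "(V, d) \<in> A"
  let ?i = "inv_into V d"
  define K where "K = inv_into U c ` cball (c p) r"
  have "cball (c p) r \<subseteq> ball (c p) (2 * r)" using r(1) by auto
  then have sub: "cball (c p) r \<subseteq> c ` U" using r(2) by blast
  have "continuous_on (c ` U) (inv_into U c)" using chart(3)[OF Uc] by (simp add: homeomorphism_def)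
  then have "compact K"
    unfolding K_def by (intro compact_continuous_image) (auto intro: continuous_on_subset[OF _ sub])
  then have "closed K" by (rule compact_imp_closed)
  define W where "W = U \<inter> c -` ball (c p) (2 * r)"
  have "open W"
    unfolding W_def using chart(3)[OF Uc]
    by (intro continuous_open_preimage chart(1)[OF Uc]) (auto simp: homeomorphism_def)
  show "Ck_on k (d ` V) (\<lambda>x. ?F (?i x))"
  proof (rule Ck_on_local)
    fix y assume "y \<in> d ` V"
    then obtain q where q: "q \<in> V" "y = d q" by auto
    have inv: "?i (d q') = q'" if "q' \<in> V" for q'
      using that chart(4)[OF Vd] by simp
    show "\<exists>N. open N \<and> y \<in> N \<and> Ck_on k N (\<lambda>x. ?F (?i x))"
    proof (cases "q \<in> W")
      case True
      let ?N = "d ` (V \<inter> W)"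
      have op: "open ?N" using chart(1)[OF Vd] \<open>open W\<close> by (intro chart_open_image[OF Vd]) auto
      have "?N \<subseteq> d ` (V \<inter> U)" by (auto simp: W_def)
      then have t: "Ck_on k ?N (\<lambda>x. c (?i x))"
        using Ck_on_subset[OF transition[OF Uc Vd, of k]] by (simp add: comp_def)
      have "Ck_on k ?N (\<lambda>x. bump (c p) r (c (?i x)) * u (c (?i x)))"
      proof (rule Ck_on_mult[OF op])
        show "Ck_on k ?N (\<lambda>x. bump (c p) r (c (?i x)))"
          by (rule Ck_on_compose[OF op open_UNIV subset_UNIV Ck_on_bump t])
        show "Ck_on k ?N (\<lambda>x. u (c (?i x)))"
          by (rule Ck_on_compose[OF op open_ball _ u t]) (auto simp: inv W_def)
      qed
      then have "Ck_on k ?N (\<lambda>x. ?F (?i x))"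
        by (rule Ck_on_cong[OF op, rotated]) (auto simp: inv W_def)
      then show ?thesis using op q True by blast
    next
      case False
      let ?N = "d ` (V \<inter> - K)"
      have op: "open ?N" using chart(1)[OF Vd] \<open>closed K\<close> by (intro chart_open_image[OF Vd]) auto
      have zero: "?F q' = 0" if "q' \<notin> K" for q'
      proof (cases "q' \<in> U")
        case True
        have "c q' \<notin> cball (c p) r"
        proof
          assume "c q' \<in> cball (c p) r"
          then have "inv_into U c (c q') \<in> K" unfolding K_def by (rule imageI)
          then show False using that True chart(4)[OF Uc] by simp
        qed
        then show ?thesis using r(1) by (simp add: bump_eq_0 del: mem_cball)
      qed simp
      have "q \<notin> K"
      proof
        assume "q \<in> K"
        then obtain x where x: "x \<in> cball (c p) r" "q = inv_into U c x" by (auto simp: K_def)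
        then have "x \<in> c ` U" using sub by blast
        then have "q \<in> U" "c q = x" using x(2) by (simp_all add: inv_into_into f_inv_into_f)
        then show False using False r(1) x(1) by (auto simp: W_def)
      qed
      moreover have "Ck_on k ?N (\<lambda>x. ?F (?i x))"
      proof (rule Ck_on_cong[OF op _ Ck_on_const[OF op]])
        fix x assume "x \<in> ?N"
        then have "?i x \<notin> K" by (auto simp: inv)
        then show "0 = ?F (?i x)" using zero by presburger
      qed
      ultimately show ?thesis using op q by blast
    qed
  qed
qed

section \<open>Tangent vectors as derivations\<close>

lemma tangent_lincomb:
  assumes "v \<in> TS p" "smooth_fun A f" "smooth_fun A h"
  shows "v (\<lambda>q. a * f q + b * h q) = a * v f + b * v h"
  using assms unfolding tangent_space_def by blast

lemma tangent_mult:
  assumes "v \<in> TS p" "smooth_fun A f" "smooth_fun A h"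
  shows "v (f * h) = f p * v h + h p * v f"
  using assms unfolding tangent_space_def by blast

lemma tangent_nonsmooth: "v \<in> TS p \<Longrightarrow> \<not> smooth_fun A f \<Longrightarrow> v f = 0"
  unfolding tangent_space_def by blast

lemma tangent_add: "v \<in> TS p \<Longrightarrow> smooth_fun A f \<Longrightarrow> smooth_fun A h \<Longrightarrow> v (f + h) = v f + v h"
  using tangent_lincomb[of v p f h 1 1] by (simp add: func_plus)

lemma tangent_diff: "v \<in> TS p \<Longrightarrow> smooth_fun A f \<Longrightarrow> smooth_fun A h \<Longrightarrow> v (f - h) = v f - v h"
  using tangent_lincomb[of v p f h 1 "- 1"] by (simp add: fun_diff_def)

lemma tangent_minus: "v \<in> TS p \<Longrightarrow> smooth_fun A f \<Longrightarrow> v (- f) = - v f"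
  using tangent_lincomb[of v p f f "- 1" 0] by (simp add: fun_Compl_def)

lemma tangent_zero: "v \<in> TS p \<Longrightarrow> v 0 = 0"
  using tangent_diff[of v p 0 0] by simp

lemma tangent_const:
  assumes "v \<in> TS p"
  shows "v (\<lambda>q. a) = 0"
proof -
  have one: "(1 :: 'a \<Rightarrow> real) = (\<lambda>q. 1)" by (simp add: func_one)
  have "v (1 * 1) = v 1 + v 1"
    using tangent_mult[OF assms, of 1 1] smooth_const[of 1] unfolding one by (simp add: func_times)
  then have "v 1 = 0" by simp
  then show ?thesis
    using tangent_lincomb[OF assms smooth_const[of 1] smooth_const[of 1], of a 0] unfolding one by simp
qed

lemma tangent_sum:
  assumes "v \<in> TS p" "finite I" "\<And>i. i \<in> I \<Longrightarrow> smooth_fun A (f i)"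
  shows "smooth_fun A (\<Sum>i\<in>I. f i) \<and> v (\<Sum>i\<in>I. f i) = (\<Sum>i\<in>I. v (f i))"
  using assms(2,3) by (induction I) (auto simp: tangent_zero[OF assms(1)] tangent_add[OF assms(1)])

lemma sum_fun_apply: "(\<Sum>i\<in>I. f i) x = (\<Sum>i\<in>I. f i x)"
  by (induction I rule: infinite_finite_induct) auto

text \<open>The chart coordinates centred at \<open>p\<close>, cut off by a bump. Hadamard's lemma
  writes \<open>f - f p\<close> near \<open>p\<close> as a combination of them with smooth
  coefficients. The product rule then gives \<open>v f = 0\<close>, since \<open>v\<close> kills the
  coordinates and the coordinates vanish at \<open>p\<close>.\<close>

lemma tangent_coordinates:
  "\<exists>x :: 'e \<Rightarrow> 'a \<Rightarrow> real. (\<forall>b. smooth_fun A (x b)) \<and>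
    (\<forall>v\<in>TS p. (\<forall>b\<in>Basis. v (x b) = 0) \<longrightarrow> v = 0)"
proof -
  obtain U c where Uc: "(U, c) \<in> A" "p \<in> U" using ex_chart by blast
  then have "c p \<in> c ` U" by blast
  then obtain s where s: "s > 0" "ball (c p) s \<subseteq> c ` U"
    using chart(2)[OF Uc(1)] open_contains_ball by blast
  define r where "r = s / 2"
  have r: "0 < r" "ball (c p) (2 * r) \<subseteq> c ` U" using s by (auto simp: r_def)
  define \<psi> where "\<psi> u q = (if q \<in> U then bump (c p) r (c q) * u (c q) else 0)" for u q
  have sm: "smooth_fun A (\<psi> u)" if "\<And>k. Ck_on k (ball (c p) (2 * r)) u" for u
    using smooth_fun_bump_extension[OF Uc r that] by (simp add: \<psi>_def[abs_def])
  have lin: "Ck_on k (ball (c p) (2 * r)) (\<lambda>x. (x - c p) \<bullet> b)" for k b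
  proof -
    have "Ck_on k (ball (c p) (2 * r)) (\<lambda>x. (x + - c p) \<bullet> b)"
      by (intro Ck_on_inner Ck_on_add Ck_on_bounded_linear[OF open_ball bounded_linear_ident] Ck_on_const open_ball)
    then show ?thesis by simp
  qed
  define x where "x b = \<psi> (\<lambda>y. (y - c p) \<bullet> b)" for b
  have vf: "v f = 0" if v: "v \<in> TS p" and v0: "\<And>b. b \<in> Basis \<Longrightarrow> v (x b) = 0" and f: "smooth_fun A f" for v f
  proof -
    let ?f = "\<lambda>y. f (inv_into U c y)"
    have Ckf: "Ck_on k (ball (c p) (2 * r)) ?f" for k
      using Ck_on_subset[OF smooth_funD[OF f Uc(1)] r(2)] .
    define g where "g b = moment (c p) 0 (\<lambda>x. frechet_derivative ?f (at x) b)" for b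
    have Ckg: "Ck_on k (ball (c p) (2 * r)) (g b)" for k b
      unfolding g_def by (intro Ck_on_moment Ck_on_SucD(2)[OF Ckf])
    let ?\<psi>1 = "\<psi> (\<lambda>_. 1)"
    have s1: "smooth_fun A ?\<psi>1" by (rule sm) (simp add: Ck_on_const)
    have sx: "smooth_fun A (x b)" for b unfolding x_def by (rule sm) (rule lin)
    have sigma_T: "smooth_fun A (\<psi> (g b))" for b by (rule sm) (rule Ckg)
    \<comment> \<open>The bump enters squared because each product on the right carries one from the
      coordinate and one from the coefficient. Where Hadamard's lemma does not apply, both sides are
      zero.\<close>
    have eq: "?\<psi>1 * ?\<psi>1 * (f - (\<lambda>_. f p)) = (\<Sum>b\<in>Basis. x b * \<psi> (g b))"
    proof
      fix q
      show "(?\<psi>1 * ?\<psi>1 * (f - (\<lambda>_. f p))) q = (\<Sum>b\<in>Basis. x b * \<psi> (g b)) q"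
      proof (cases "q \<in> U \<and> c q \<in> ball (c p) (2 * r)")
        case True
        have "f q - f p = (\<Sum>b\<in>Basis. ((c q - c p) \<bullet> b) * g b (c q))"
          using hadamard[OF Ckf, of "c q"] True Uc(2) chart(4)[OF Uc(1)] by (simp add: g_def)
        then show ?thesis
          using True by (simp add: \<psi>_def x_def sum_fun_apply sum_distrib_left mult_ac)
      next
        case False
        then have "q \<in> U \<Longrightarrow> bump (c p) r (c q) = 0" using r(1) by (intro bump_eq_0) auto
        then show ?thesis by (simp add: \<psi>_def x_def sum_fun_apply)
      qed
    qed
    have xp: "x b p = 0" for b by (simp add: x_def \<psi>_def)
    have "v (\<Sum>b\<in>Basis. x b * \<psi> (g b)) = (\<Sum>b\<in>Basis. v (x b * \<psi> (g b)))"
      using tangent_sum[OF v finite_Basis, of "\<lambda>b. x b * \<psi> (g b)"] sx sigma_T by blast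
    also have "\<dots> = 0"
      by (rule sum.neutral) (simp add: tangent_mult[OF v sx sigma_T] v0 xp)
    finally have "v (?\<psi>1 * ?\<psi>1 * (f - (\<lambda>_. f p))) = 0" by (simp only: eq)
    moreover have "v (?\<psi>1 * ?\<psi>1 * (f - (\<lambda>_. f p))) = ?\<psi>1 p * ?\<psi>1 p * v f"
      by (simp add: tangent_mult[OF v] tangent_diff[OF v] tangent_const[OF v] s1 f)
    moreover have "?\<psi>1 p > 0" using bump_pos[OF r(1), of "c p"] Uc(2) by (simp add: \<psi>_def)
    ultimately show ?thesis by simp
  qed
  have "v = 0" if "v \<in> TS p" "\<And>b. b \<in> Basis \<Longrightarrow> v (x b) = 0" for v
  proof
    fix f
    show "v f = 0 f"
      using vf[OF that, of f] tangent_nonsmooth[OF that(1), of f] by (cases "smooth_fun A f") auto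
  qed
  moreover have "smooth_fun A (x b)" for b unfolding x_def by (rule sm) (rule lin)
  ultimately show ?thesis by blast
qed

section \<open>Vector fields and the Lie bracket\<close>

lemma VF_tangent: "X \<in> VF \<Longrightarrow> X p \<in> TS p"
  by (simp add: vector_fields_def)

text \<open>On a non-smooth function every tangent vector has the default value 0, so the result is
  the zero function and no smoothness condition on \<open>f\<close> has to be carried along.\<close>

lemma smooth_vapply [simp, intro]: "X \<in> VF \<Longrightarrow> smooth_fun A (vapply X f)"
proof (cases "smooth_fun A f")
  case False
  assume "X \<in> VF"
  then have "vapply X f = 0" using False by (simp add: vapply_def fun_eq_iff tangent_nonsmooth[OF VF_tangent])
  then show ?thesis by simp
qed (auto simp: vector_fields_def)

lemma vapply_nonsmooth: "X \<in> VF \<Longrightarrow> \<not> smooth_fun A f \<Longrightarrow> vapply X f = 0"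
  by (simp add: vapply_def fun_eq_iff tangent_nonsmooth[OF VF_tangent])

lemma VF_I:
  assumes "\<And>p f h a b. smooth_fun A f \<Longrightarrow> smooth_fun A h \<Longrightarrow> X p (\<lambda>q. a * f q + b * h q) = a * X p f + b * X p h"
    and "\<And>p f h. smooth_fun A f \<Longrightarrow> smooth_fun A h \<Longrightarrow> X p (f * h) = f p * X p h + h p * X p f"
    and "\<And>p f. \<not> smooth_fun A f \<Longrightarrow> X p f = 0"
    and "\<And>f. smooth_fun A f \<Longrightarrow> smooth_fun A (vapply X f)"
  shows "X \<in> VF"
  using assms unfolding vector_fields_def tangent_space_def by blast

lemma tangent_spaceI:
  assumes "\<And>f h a b. smooth_fun A f \<Longrightarrow> smooth_fun A h \<Longrightarrow> v (\<lambda>q. a * f q + b * h q) = a * v f + b * v h"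
    and "\<And>f h. smooth_fun A f \<Longrightarrow> smooth_fun A h \<Longrightarrow> v (f * h) = f p * v h + h p * v f"
    and "\<And>f. \<not> smooth_fun A f \<Longrightarrow> v f = 0"
  shows "v \<in> TS p"
  using assms unfolding tangent_space_def by blast

lemma tangent_space_add [simp, intro]: "u \<in> TS p \<Longrightarrow> v \<in> TS p \<Longrightarrow> u + v \<in> TS p"
  by (rule tangent_spaceI) (simp_all add: tangent_lincomb tangent_mult tangent_nonsmooth algebra_simps)

lemma tangent_space_tscale [simp, intro]: "u \<in> TS p \<Longrightarrow> tscale a u \<in> TS p"
  by (rule tangent_spaceI)
    (simp_all add: tangent_lincomb tangent_mult tangent_nonsmooth tscale_def algebra_simps)

lemma tangent_space_minus [simp, intro]: "u \<in> TS p \<Longrightarrow> - u \<in> TS p"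
  by (rule tangent_spaceI) (simp_all add: tangent_lincomb tangent_mult tangent_nonsmooth algebra_simps)

lemma vapply_field_add: "vapply (X + Y) f = vapply X f + vapply Y f"
  and vapply_field_minus: "vapply (- X) f = - vapply X f"
  and vapply_field_diff: "vapply (X - Y) f = vapply X f - vapply Y f"
  and vapply_fscale: "vapply (fscale h X) f = h * vapply X f"
  by (simp_all add: vapply_def fun_eq_iff fscale_def tscale_def)

lemma VF_I':
  "(\<And>p. X p \<in> TS p) \<Longrightarrow> (\<And>f. smooth_fun A f \<Longrightarrow> smooth_fun A (vapply X f)) \<Longrightarrow> X \<in> VF"
  unfolding vector_fields_def by blast

lemma VF_add [simp, intro]: "X \<in> VF \<Longrightarrow> Y \<in> VF \<Longrightarrow> X + Y \<in> VF"
  by (rule VF_I') (simp_all add: VF_tangent vapply_field_add)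

lemma VF_minus [simp, intro]: "X \<in> VF \<Longrightarrow> - X \<in> VF"
  by (rule VF_I') (simp_all add: VF_tangent vapply_field_minus)

lemma VF_diff [simp, intro]: "X \<in> VF \<Longrightarrow> Y \<in> VF \<Longrightarrow> X - Y \<in> VF"
  using VF_add[of X "- Y"] by simp

lemma VF_fscale [simp, intro]: "smooth_fun A f \<Longrightarrow> X \<in> VF \<Longrightarrow> fscale f X \<in> VF"
  by (rule VF_I') (simp_all add: VF_tangent vapply_fscale, simp add: fscale_def VF_tangent)

lemma VF_zero [simp, intro]: "0 \<in> VF"
  by (rule VF_I) (simp_all add: vapply_def flip: func_zero)

lemma vapply_add:
  "X \<in> VF \<Longrightarrow> smooth_fun A f \<Longrightarrow> smooth_fun A h \<Longrightarrow> vapply X (f + h) = vapply X f + vapply X h"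
  by (simp add: vapply_def fun_eq_iff tangent_add[OF VF_tangent])

lemma vapply_diff:
  "X \<in> VF \<Longrightarrow> smooth_fun A f \<Longrightarrow> smooth_fun A h \<Longrightarrow> vapply X (f - h) = vapply X f - vapply X h"
  by (simp add: vapply_def fun_eq_iff tangent_diff[OF VF_tangent])

lemma vapply_minus: "X \<in> VF \<Longrightarrow> smooth_fun A f \<Longrightarrow> vapply X (- f) = - vapply X f"
  by (simp add: vapply_def fun_eq_iff tangent_minus[OF VF_tangent])

lemma vapply_mult:
  "X \<in> VF \<Longrightarrow> smooth_fun A f \<Longrightarrow> smooth_fun A h \<Longrightarrow> vapply X (f * h) = f * vapply X h + h * vapply X f"
  by (simp add: vapply_def fun_eq_iff tangent_mult[OF VF_tangent])

lemma vapply_zero: "X \<in> VF \<Longrightarrow> vapply X 0 = 0"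
  using vapply_diff[of X 0 0] by simp

lemma vapply_lincomb:
  assumes "X \<in> VF" "smooth_fun A f" "smooth_fun A h"
  shows "vapply X (\<lambda>q. a * f q + b * h q) = (\<lambda>q. a * vapply X f q + b * vapply X h q)"
  by (simp add: vapply_def fun_eq_iff tangent_lincomb[OF VF_tangent[OF assms(1)] assms(2,3)])

lemma vapply_lie_bracket: "vapply (lie_bracket X Y) f = vapply X (vapply Y f) - vapply Y (vapply X f)"
  by (simp add: vapply_def lie_bracket_def fun_eq_iff)

lemma VF_lie_bracket [simp, intro]:
  assumes X: "X \<in> VF" and Y: "Y \<in> VF"
  shows "lie_bracket X Y \<in> VF"
proof (rule VF_I)
  have at: "lie_bracket X Y p f = vapply (lie_bracket X Y) f p" for p f by (simp add: vapply_def)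
  show "lie_bracket X Y p (\<lambda>q. a * f q + b * h q) = a * lie_bracket X Y p f + b * lie_bracket X Y p h"
    if "smooth_fun A f" "smooth_fun A h" for p f h a b
    unfolding at vapply_lie_bracket
    by (simp add: vapply_lincomb[OF X] vapply_lincomb[OF Y] that X Y algebra_simps)
  show "lie_bracket X Y p (f * h) = f p * lie_bracket X Y p h + h p * lie_bracket X Y p f"
    if "smooth_fun A f" "smooth_fun A h" for p f h
    unfolding at vapply_lie_bracket
    by (simp add: vapply_mult vapply_add that X Y algebra_simps)
  show "lie_bracket X Y p f = 0" if "\<not> smooth_fun A f" for p f
    unfolding at vapply_lie_bracket by (simp add: vapply_nonsmooth that X Y vapply_zero)
  show "smooth_fun A (vapply (lie_bracket X Y) f)" for f
    unfolding vapply_lie_bracket using X Y by blast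
qed

lemma vfield_eqI: "(\<And>f. vapply X f = vapply Y f) \<Longrightarrow> X = Y"
  by (simp add: vapply_def fun_eq_iff)

lemma lie_bracket_swap: "lie_bracket X Y = - lie_bracket Y X"
  by (simp add: lie_bracket_def fun_eq_iff)

lemma lie_bracket_add:
  assumes "X \<in> VF" "Y \<in> VF" "Z \<in> VF"
  shows "lie_bracket (X + Y) Z = lie_bracket X Z + lie_bracket Y Z"
    and "lie_bracket Z (X + Y) = lie_bracket Z X + lie_bracket Z Y"
  using assms
  by (intro vfield_eqI; simp add: vapply_lie_bracket vapply_field_add vapply_add)+

lemma lie_bracket_minus:
  assumes "X \<in> VF" "Z \<in> VF"
  shows "lie_bracket (- X) Z = - lie_bracket X Z"
    and "lie_bracket Z (- X) = - lie_bracket Z X"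
  using assms
  by (intro vfield_eqI; simp add: vapply_lie_bracket vapply_field_minus vapply_minus)+

lemma lie_bracket_jacobi:
  assumes "X \<in> VF" "Y \<in> VF" "Z \<in> VF"
  shows "lie_bracket X (lie_bracket Y Z) + lie_bracket Y (lie_bracket Z X) + lie_bracket Z (lie_bracket X Y) = 0"
  using assms
  by (intro vfield_eqI)
    (simp add: vapply_lie_bracket vapply_field_add vapply_diff, simp add: vapply_def fun_eq_iff)

end

section \<open>Sasaki with torsion manifolds\<close>

locale sasaki_torsion =
  fixes A :: "('a::{t2_space, second_countable_topology}, 'e::euclidean_space) atlas"
    and \<phi> :: "'a \<Rightarrow> 'a tvec \<Rightarrow> 'a tvec" and \<xi> :: "'a vfield"
    and \<eta> :: "'a \<Rightarrow> 'a tvec \<Rightarrow> real" and g :: "'a \<Rightarrow> 'a tvec \<Rightarrow> 'a tvec \<Rightarrow> real"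
    and D :: "'a vfield \<Rightarrow> 'a vfield \<Rightarrow> 'a vfield"
  assumes sasaki: "sasaki_with_torsion A \<phi> \<xi> \<eta> g D"

sublocale sasaki_torsion \<subseteq> smooth_manifold A
  using sasaki by unfold_locales (simp add: sasaki_with_torsion_def connected_manifold_def)

context sasaki_torsion
begin

section \<open>Algebra of the almost contact metric structure\<close>

abbreviation "G \<equiv> ap2 g"
abbreviation "\<Phi> \<equiv> apE \<phi>"
abbreviation "et \<equiv> ap1 \<eta>"
abbreviation "T \<equiv> torsion D"

lemma tscale_one: "tscale 1 v = v" and tscale_zero: "tscale 0 v = 0" and tscale_minus: "tscale (- 1) v = - v"
  by (simp_all add: tscale_def fun_eq_iff)

lemma almost_contact: "endo_field A \<phi>" "\<xi> \<in> VF" "one_form A \<eta>" "riemannian_metric A g"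
  "u \<in> TS p \<Longrightarrow> \<phi> p (\<phi> p u) = - u + tscale (\<eta> p u) (\<xi> p)" "\<eta> p (\<xi> p) = 1"
  "u \<in> TS p \<Longrightarrow> v \<in> TS p \<Longrightarrow> g p (\<phi> p u) (\<phi> p v) = g p u v - \<eta> p u * \<eta> p v"
  using sasaki unfolding sasaki_with_torsion_def almost_contact_metric_def by blast+

lemma xi_VF [simp, intro]: "\<xi> \<in> VF" by (rule almost_contact)

lemma g_lin: "u \<in> TS p \<Longrightarrow> v \<in> TS p \<Longrightarrow> w \<in> TS p \<Longrightarrow> g p (tscale a u + tscale b v) w = a * g p u w + b * g p v w"
  using almost_contact(4)[unfolded riemannian_metric_def, THEN conjunct1] by blast

lemma g_sym: "u \<in> TS p \<Longrightarrow> v \<in> TS p \<Longrightarrow> g p u v = g p v u"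
  using almost_contact(4)[unfolded riemannian_metric_def, THEN conjunct2, THEN conjunct1] by blast

lemma g_pos: "u \<in> TS p \<Longrightarrow> u \<noteq> 0 \<Longrightarrow> g p u u > 0"
  using almost_contact(4)[unfolded riemannian_metric_def, THEN conjunct2, THEN conjunct2, THEN conjunct1] by blast

lemma G_smooth [simp, intro]: "X \<in> VF \<Longrightarrow> Y \<in> VF \<Longrightarrow> smooth_fun A (G X Y)"
  using almost_contact(4)[unfolded riemannian_metric_def, THEN conjunct2, THEN conjunct2, THEN conjunct2] by blast

lemma G_sym: "X \<in> VF \<Longrightarrow> Y \<in> VF \<Longrightarrow> G X Y = G Y X"
  unfolding ap2_def by (rule ext) (rule g_sym; rule VF_tangent)

lemma G_add [simp]:
  assumes "X \<in> VF" "Y \<in> VF" "Z \<in> VF"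
  shows "G (X + Y) Z = G X Z + G Y Z"
  using g_lin[OF assms[THEN VF_tangent], of _ 1 1] by (simp add: ap2_def fun_eq_iff tscale_one)

lemma G_fscale [simp]:
  assumes "X \<in> VF" "Z \<in> VF"
  shows "G (fscale f X) Z = f * G X Z"
  using g_lin[OF assms(1,1,2)[THEN VF_tangent], of p "f p" 0 for p]
  by (simp add: ap2_def fun_eq_iff tscale_zero fscale_def)

lemma G_minus [simp]:
  assumes "X \<in> VF" "Z \<in> VF"
  shows "G (- X) Z = - G X Z"
  using g_lin[OF assms(1,1,2)[THEN VF_tangent], of _ "- 1" 0]
  by (simp add: ap2_def fun_eq_iff tscale_zero tscale_minus)

lemma G_diff [simp]: "X \<in> VF \<Longrightarrow> Y \<in> VF \<Longrightarrow> Z \<in> VF \<Longrightarrow> G (X - Y) Z = G X Z - G Y Z"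
  using G_add[of X "- Y" Z] by simp

lemma G_add2 [simp]: "X \<in> VF \<Longrightarrow> Y \<in> VF \<Longrightarrow> Z \<in> VF \<Longrightarrow> G Z (X + Y) = G Z X + G Z Y"
  by (simp add: G_sym[of Z])

lemma G_minus2 [simp]: "X \<in> VF \<Longrightarrow> Z \<in> VF \<Longrightarrow> G Z (- X) = - G Z X"
  by (simp add: G_sym[of Z])

lemma G_diff2 [simp]: "X \<in> VF \<Longrightarrow> Y \<in> VF \<Longrightarrow> Z \<in> VF \<Longrightarrow> G Z (X - Y) = G Z X - G Z Y"
  by (simp add: G_sym[of Z])

lemma G_fscale2 [simp]: "X \<in> VF \<Longrightarrow> Z \<in> VF \<Longrightarrow> smooth_fun A f \<Longrightarrow> G Z (fscale f X) = f * G Z X"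
  by (simp add: G_sym[of Z])

lemma G_nondegenerate:
  assumes "X \<in> VF" "G X X p = 0"
  shows "X p = 0"
  using g_pos[OF VF_tangent[OF assms(1)], of p] assms(2) by (auto simp: ap2_def)

lemma G_zero [simp]: "Z \<in> VF \<Longrightarrow> G 0 Z = 0" "Z \<in> VF \<Longrightarrow> G Z 0 = 0"
  using G_diff[of 0 0 Z] G_diff2[of 0 0 Z] by simp_all

lemma vfield_eq_0I: "X \<in> VF \<Longrightarrow> (\<And>Y. Y \<in> VF \<Longrightarrow> G X Y = 0) \<Longrightarrow> X = 0"
  by (rule ext) (simp add: G_nondegenerate func_zero)

lemma Phi_VF [simp, intro]: "X \<in> VF \<Longrightarrow> \<Phi> X \<in> VF"
  using almost_contact(1)[unfolded endo_field_def, THEN conjunct2, THEN conjunct2] by blast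

lemma phi_tangent: "u \<in> TS p \<Longrightarrow> \<phi> p u \<in> TS p"
  using almost_contact(1)[unfolded endo_field_def, THEN conjunct1] by blast

lemma phi_lin: "u \<in> TS p \<Longrightarrow> v \<in> TS p \<Longrightarrow>
    \<phi> p (tscale a u + tscale b v) = tscale a (\<phi> p u) + tscale b (\<phi> p v)"
  using almost_contact(1)[unfolded endo_field_def, THEN conjunct2, THEN conjunct1] by blast

lemma Phi_add:
  assumes "X \<in> VF" "Y \<in> VF"
  shows "\<Phi> (X + Y) = \<Phi> X + \<Phi> Y"
  using phi_lin[OF assms[THEN VF_tangent], of _ 1 1] by (intro ext) (simp add: apE_def tscale_one)

lemma Phi_minus:
  assumes "X \<in> VF"
  shows "\<Phi> (- X) = - \<Phi> X"
  using phi_lin[OF assms(1,1)[THEN VF_tangent], of _ "- 1" 0]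
  by (intro ext) (simp add: apE_def tscale_minus tscale_zero)

lemma Phi_diff: "X \<in> VF \<Longrightarrow> Y \<in> VF \<Longrightarrow> \<Phi> (X - Y) = \<Phi> X - \<Phi> Y"
  using Phi_add[of X "- Y"] by (simp add: Phi_minus)

lemma et_smooth [simp, intro]: "X \<in> VF \<Longrightarrow> smooth_fun A (et X)"
  using almost_contact(3)[unfolded one_form_def, THEN conjunct2] by blast

lemma PhiPhi: "X \<in> VF \<Longrightarrow> \<Phi> (\<Phi> X) = - X + fscale (et X) \<xi>"
  by (rule ext) (simp add: apE_def ap1_def fscale_def almost_contact(5)[OF VF_tangent] fun_eq_iff)

text \<open>For \<open>w = \<phi> \<xi>\<close> one has \<open>\<phi> w = 0\<close>, as
  \<open>\<phi>^2 \<xi> = 0\<close>. Applying \<open>\<phi>^2\<close> to \<open>w\<close> gives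
  \<open>w = \<eta>(w) \<xi>\<close>, so \<open>0 = \<phi> w = \<eta>(w) w\<close>, and either
  factor being zero forces \<open>w = 0\<close>.\<close>

lemma phi_xi: "\<phi> p (\<xi> p) = 0"
proof -
  let ?x = "\<xi> p" let ?w = "\<phi> p ?x"
  have x: "?x \<in> TS p" by (rule VF_tangent) simp
  have w: "?w \<in> TS p" by (rule phi_tangent[OF x])
  have pw: "\<phi> p ?w = 0" using almost_contact(5)[OF x] by (simp add: almost_contact(6) tscale_one)
  have p0: "\<phi> p 0 = 0" using phi_lin[OF x x, of 0 0] by (simp add: tscale_zero)
  have w2: "?w = tscale (\<eta> p ?w) ?x" using almost_contact(5)[OF w] by (simp add: pw p0 eq_neg_iff_add_eq_0)
  have "\<phi> p ?w = tscale (\<eta> p ?w) ?w"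
    using phi_lin[OF x x, of "\<eta> p ?w" 0] w2 by (simp add: tscale_zero)
  then have "tscale (\<eta> p ?w) ?w = 0" using pw by simp
  then have "\<eta> p ?w = 0 \<or> ?w = 0" by (auto simp: tscale_def fun_eq_iff)
  then show ?thesis using w2 by (metis tscale_zero)
qed

lemma Phi_xi [simp]: "\<Phi> \<xi> = 0"
  by (simp add: apE_def fun_eq_iff phi_xi)

lemma et_xi [simp]: "et \<xi> = 1"
  by (simp add: ap1_def fun_eq_iff almost_contact(6))

lemma G_Phi_Phi: "X \<in> VF \<Longrightarrow> Y \<in> VF \<Longrightarrow> G (\<Phi> X) (\<Phi> Y) = G X Y - et X * et Y"
  by (rule ext) (simp add: ap2_def apE_def ap1_def almost_contact(7)[OF VF_tangent VF_tangent])

lemma et_eq: "X \<in> VF \<Longrightarrow> et X = G X \<xi>"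
  using G_Phi_Phi[of X \<xi>] by simp

lemma G_xi_xi [simp]: "G \<xi> \<xi> = 1"
  using et_eq[of \<xi>] by simp

text \<open>The cube of \<open>\<Phi>\<close> is computed as the square applied to
  \<open>\<Phi> X\<close> and as \<open>\<Phi>\<close> applied to the square; with
  \<open>\<Phi> \<xi> = 0\<close> the difference is the \<open>\<xi>\<close>-term.\<close>

lemma et_Phi [simp]: "X \<in> VF \<Longrightarrow> et (\<Phi> X) = 0"
proof -
  assume X: "X \<in> VF"
  have "\<Phi> (\<Phi> (\<Phi> X)) = - \<Phi> X + fscale (et (\<Phi> X)) \<xi>" by (rule PhiPhi[OF Phi_VF[OF X]])
  moreover have "\<Phi> (\<Phi> (\<Phi> X)) = - \<Phi> X"
  proof -
    have "\<Phi> (fscale (et X) \<xi>) = 0"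
    proof
      fix p
      have "\<phi> p (tscale (et X p) (\<xi> p) + tscale 0 (\<xi> p)) = 0"
        using phi_lin[OF xi_VF[THEN VF_tangent] xi_VF[THEN VF_tangent], of p "et X p" 0] by (simp add: phi_xi tscale_zero tscale_def fun_eq_iff)
      then show "\<Phi> (fscale (et X) \<xi>) p = 0 p" by (simp add: apE_def fscale_def tscale_zero)
    qed
    then show ?thesis using X by (simp add: PhiPhi[OF X] Phi_diff)
  qed
  ultimately have "fscale (et (\<Phi> X)) \<xi> = 0" by simp
  then have "G (fscale (et (\<Phi> X)) \<xi>) \<xi> = 0" by simp
  then show ?thesis using X by simp
qed

lemma G_Phi_xi [simp]: "X \<in> VF \<Longrightarrow> G (\<Phi> X) \<xi> = 0"
  using et_eq[of "\<Phi> X"] by simp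

lemma G_Phi_skew: "X \<in> VF \<Longrightarrow> Y \<in> VF \<Longrightarrow> G X (\<Phi> Y) = - G (\<Phi> X) Y"
proof -
  assume X: "X \<in> VF" and Y: "Y \<in> VF"
  have "G (\<Phi> X) (\<Phi> (\<Phi> Y)) = G X (\<Phi> Y)" using X Y by (simp add: G_Phi_Phi)
  then show ?thesis using X Y by (simp add: PhiPhi)
qed

section \<open>The connection, its torsion and the form H\<close>

lemma connection: "affine_connection A D"
  "\<forall>X\<in>VF. \<forall>Y\<in>VF. \<forall>Z\<in>VF. vapply X (G Y Z) = G (D X Y) Z + G Y (D X Z)"
  "skew_torsion A g D"
  "\<forall>X\<in>VF. \<forall>Y\<in>VF. nabla_endo D \<phi> X Y = 0"
  "\<forall>X\<in>VF. \<forall>Y\<in>VF. nabla_form1 D et X Y = 0"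
  "normal_structure A \<phi> \<xi> \<eta>"
  using sasaki unfolding sasaki_with_torsion_def metric_connection_def by blast+

lemma D_VF [simp, intro]: "X \<in> VF \<Longrightarrow> Y \<in> VF \<Longrightarrow> D X Y \<in> VF"
  and D_add1: "X \<in> VF \<Longrightarrow> Y \<in> VF \<Longrightarrow> Z \<in> VF \<Longrightarrow> D (X + Y) Z = D X Z + D Y Z"
  and D_add2: "X \<in> VF \<Longrightarrow> Y \<in> VF \<Longrightarrow> Z \<in> VF \<Longrightarrow> D X (Y + Z) = D X Y + D X Z"
  using connection(1)[unfolded affine_connection_def] by blast+

lemma D_metric: "X \<in> VF \<Longrightarrow> Y \<in> VF \<Longrightarrow> Z \<in> VF \<Longrightarrow> vapply X (G Y Z) = G (D X Y) Z + G Y (D X Z)"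
  using connection(2) by blast

lemma D_minus1: "X \<in> VF \<Longrightarrow> Z \<in> VF \<Longrightarrow> D (- X) Z = - D X Z"
  using D_add1[of X "- X" Z] D_add1[of 0 0 Z] by (simp add: eq_neg_iff_add_eq_0 add.commute)

lemma D_minus2: "X \<in> VF \<Longrightarrow> Z \<in> VF \<Longrightarrow> D X (- Z) = - D X Z"
  using D_add2[of X Z "- Z"] D_add2[of X 0 0] by (simp add: eq_neg_iff_add_eq_0 add.commute)

lemma D_diff1: "X \<in> VF \<Longrightarrow> Y \<in> VF \<Longrightarrow> Z \<in> VF \<Longrightarrow> D (X - Y) Z = D X Z - D Y Z"
  using D_add1[of X "- Y" Z] by (simp add: D_minus1)

lemma D_diff2: "X \<in> VF \<Longrightarrow> Y \<in> VF \<Longrightarrow> Z \<in> VF \<Longrightarrow> D X (Y - Z) = D X Y - D X Z"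
  using D_add2[of X Y "- Z"] by (simp add: D_minus2)

lemma T_VF [simp, intro]: "X \<in> VF \<Longrightarrow> Y \<in> VF \<Longrightarrow> T X Y \<in> VF"
  by (simp add: torsion_def)

lemma T_swap: "T Y X = - T X Y"
  by (simp add: torsion_def lie_bracket_swap[of Y X])

lemma T_add: "X \<in> VF \<Longrightarrow> Y \<in> VF \<Longrightarrow> Z \<in> VF \<Longrightarrow> T (X + Y) Z = T X Z + T Y Z"
  "X \<in> VF \<Longrightarrow> Y \<in> VF \<Longrightarrow> Z \<in> VF \<Longrightarrow> T Z (X + Y) = T Z X + T Z Y"
  by (simp_all add: torsion_def D_add1 D_add2 lie_bracket_add)

lemma T_minus: "X \<in> VF \<Longrightarrow> Z \<in> VF \<Longrightarrow> T (- X) Z = - T X Z" "X \<in> VF \<Longrightarrow> Z \<in> VF \<Longrightarrow> T Z (- X) = - T Z X"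
  by (simp_all add: torsion_def D_minus1 D_minus2 lie_bracket_minus)

lemma T_diff: "X \<in> VF \<Longrightarrow> Y \<in> VF \<Longrightarrow> Z \<in> VF \<Longrightarrow> T (X - Y) Z = T X Z - T Y Z"
  "X \<in> VF \<Longrightarrow> Y \<in> VF \<Longrightarrow> Z \<in> VF \<Longrightarrow> T Z (X - Y) = T Z X - T Z Y"
  using T_add(1)[of X "- Y" Z] T_add(2)[of X "- Y" Z] by (simp_all add: T_minus)

definition t :: "'a vfield \<Rightarrow> 'a vfield \<Rightarrow> 'a vfield \<Rightarrow> 'a \<Rightarrow> real" where
  "t X Y Z = G (T X Y) Z"

lemma t12: "X \<in> VF \<Longrightarrow> Y \<in> VF \<Longrightarrow> Z \<in> VF \<Longrightarrow> t Y X Z = - t X Y Z"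
  by (simp add: t_def T_swap[of Y X])

lemma t23: "X \<in> VF \<Longrightarrow> Y \<in> VF \<Longrightarrow> Z \<in> VF \<Longrightarrow> t X Z Y = - t X Y Z"
  using connection(3) unfolding skew_torsion_def t_def by fastforce

lemma Phi_parallel: "X \<in> VF \<Longrightarrow> Y \<in> VF \<Longrightarrow> D X (\<Phi> Y) = \<Phi> (D X Y)"
  using connection(4) unfolding nabla_endo_def by simp

lemma et_parallel: "X \<in> VF \<Longrightarrow> Y \<in> VF \<Longrightarrow> vapply X (et Y) = et (D X Y)"
  using connection(5) unfolding nabla_form1_def by simp

lemma t_cyc: "X \<in> VF \<Longrightarrow> Y \<in> VF \<Longrightarrow> Z \<in> VF \<Longrightarrow> t X Y Z = t Y Z X"
  by (metis t12 t23 minus_minus)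

lemma t_G: "X \<in> VF \<Longrightarrow> Y \<in> VF \<Longrightarrow> Z \<in> VF \<Longrightarrow> t X Y Z = G (T Y Z) X"
  using t_cyc[of X Y Z] by (simp add: t_def)

lemma t_smooth [simp, intro]: "X \<in> VF \<Longrightarrow> Y \<in> VF \<Longrightarrow> Z \<in> VF \<Longrightarrow> smooth_fun A (t X Y Z)"
  by (simp add: t_def)

lemma t_diff:
  assumes "X \<in> VF" "X' \<in> VF" "Y \<in> VF" "Z \<in> VF"
  shows "t (X - X') Y Z = t X Y Z - t X' Y Z" "t Y (X - X') Z = t Y X Z - t Y X' Z"
    "t Y Z (X - X') = t Y Z X - t Y Z X'"
  using assms by (simp_all add: t_def T_diff)

lemma t_PhiPhi: "X \<in> VF \<Longrightarrow> Y \<in> VF \<Longrightarrow> Z \<in> VF \<Longrightarrow> t X Y (\<Phi> (\<Phi> Z)) = - t X Y Z + et Z * t X Y \<xi>"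
  by (simp add: t_def PhiPhi)

lemma lie_eq: "lie_bracket X Y = D X Y - D Y X - T X Y"
  by (simp add: torsion_def)

lemma ext_d1_et: "X \<in> VF \<Longrightarrow> Y \<in> VF \<Longrightarrow> ext_d1 et X Y = t X Y \<xi>"
  by (simp add: ext_d1_def et_parallel lie_eq) (simp add: t_def et_eq)

lemma G_Phi_left: "X \<in> VF \<Longrightarrow> Y \<in> VF \<Longrightarrow> G (\<Phi> X) Y = - G X (\<Phi> Y)"
  by (simp add: G_Phi_skew)

text \<open>As \<open>\<phi>\<close> is parallel, all covariant derivatives cancel in the Nijenhuis
  tensor and only torsion terms remain. Pairing normality with \<open>Z\<close>, the
  \<open>\<xi>\<close>-term of \<open>\<Phi> (\<Phi> (T X Y))\<close> cancels against
  \<open>d\<eta>\<close> times \<open>\<xi>\<close>, and what is left is the type condition.\<close>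

lemma t_type:
  assumes "X \<in> VF" "Y \<in> VF" "Z \<in> VF"
  shows "t X Y Z = t (\<Phi> X) (\<Phi> Y) Z + t (\<Phi> X) Y (\<Phi> Z) + t X (\<Phi> Y) (\<Phi> Z)"
proof -
  have n0: "nijenhuis \<phi> X Y + fscale (ext_d1 et X Y) \<xi> = 0"
    using connection(6)[unfolded normal_structure_def, rule_format, OF assms(1,2)] .
  have n1: "nijenhuis \<phi> X Y = - \<Phi> (\<Phi> (T X Y)) - T (\<Phi> X) (\<Phi> Y) + \<Phi> (T (\<Phi> X) Y) + \<Phi> (T X (\<Phi> Y))"
  proof -
    have 1: "\<Phi> (\<Phi> (lie_bracket X Y)) = \<Phi> (\<Phi> (D X Y)) - \<Phi> (\<Phi> (D Y X)) - \<Phi> (\<Phi> (T X Y))"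
      using assms by (simp add: lie_eq Phi_diff)
    have 2: "lie_bracket (\<Phi> X) (\<Phi> Y) = \<Phi> (D (\<Phi> X) Y) - \<Phi> (D (\<Phi> Y) X) - T (\<Phi> X) (\<Phi> Y)"
      using assms by (simp add: lie_eq Phi_parallel)
    have 3: "\<Phi> (lie_bracket (\<Phi> X) Y) = \<Phi> (D (\<Phi> X) Y) - \<Phi> (\<Phi> (D Y X)) - \<Phi> (T (\<Phi> X) Y)"
      using assms by (simp add: lie_eq Phi_diff Phi_parallel)
    have 4: "\<Phi> (lie_bracket X (\<Phi> Y)) = \<Phi> (\<Phi> (D X Y)) - \<Phi> (D (\<Phi> Y) X) - \<Phi> (T X (\<Phi> Y))"
      using assms by (simp add: lie_eq Phi_diff Phi_parallel)
    show ?thesis unfolding nijenhuis_def 1 2 3 4 by (simp add: algebra_simps)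
  qed
  have "- \<Phi> (\<Phi> (T X Y)) - T (\<Phi> X) (\<Phi> Y) + \<Phi> (T (\<Phi> X) Y) + \<Phi> (T X (\<Phi> Y))
      + fscale (t X Y \<xi>) \<xi> = 0"
    using n0 unfolding n1 ext_d1_et[OF assms(1,2)] .
  then have "G (- \<Phi> (\<Phi> (T X Y)) - T (\<Phi> X) (\<Phi> Y) + \<Phi> (T (\<Phi> X) Y) + \<Phi> (T X (\<Phi> Y))
      + fscale (t X Y \<xi>) \<xi>) Z = 0"
    using assms by (simp only: G_zero)
  then have "- G (\<Phi> (\<Phi> (T X Y))) Z - G (T (\<Phi> X) (\<Phi> Y)) Z + G (\<Phi> (T (\<Phi> X) Y)) Z
      + G (\<Phi> (T X (\<Phi> Y))) Z + t X Y \<xi> * G \<xi> Z = 0"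
    using assms by simp
  moreover have "G (\<Phi> (\<Phi> (T X Y))) Z = - t X Y Z + t X Y \<xi> * et Z"
    using assms G_sym[of \<xi> Z] by (simp add: PhiPhi et_eq t_def)
  moreover have "G (\<Phi> (T (\<Phi> X) Y)) Z = - t (\<Phi> X) Y (\<Phi> Z)" "G (\<Phi> (T X (\<Phi> Y))) Z = - t X (\<Phi> Y) (\<Phi> Z)"
    using assms by (simp_all add: G_Phi_left t_def)
  moreover have "G (T (\<Phi> X) (\<Phi> Y)) Z = t (\<Phi> X) (\<Phi> Y) Z" "G \<xi> Z = et Z"
    using assms G_sym[of \<xi> Z] by (simp_all add: t_def et_eq)
  ultimately show ?thesis
    using assms by (simp add: algebra_simps)
qed

lemma ext_d2_F:
  assumes "X \<in> VF" "Y \<in> VF" "Z \<in> VF"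
  shows "ext_d2 (fundamental_form \<phi> g) X Y Z = t X Y (\<Phi> Z) + t Y Z (\<Phi> X) + t Z X (\<Phi> Y)"
proof -
  have F: "fundamental_form \<phi> g U V = G U (\<Phi> V)" for U V
    by (simp add: fundamental_form_def)
  have v: "vapply X (G Y (\<Phi> Z)) = G (D X Y) (\<Phi> Z) - G (D X Z) (\<Phi> Y)"
    if "X \<in> VF" "Y \<in> VF" "Z \<in> VF" for X Y Z
  proof -
    have "G Y (\<Phi> (D X Z)) = - G (D X Z) (\<Phi> Y)"
      using that G_Phi_skew[of Y "D X Z"] G_sym[of "\<Phi> Y" "D X Z"] by simp
    then show ?thesis using that by (simp add: D_metric Phi_parallel)
  qed
  have l: "G (lie_bracket X Y) (\<Phi> Z) = G (D X Y) (\<Phi> Z) - G (D Y X) (\<Phi> Z) - t X Y (\<Phi> Z)"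
    if "X \<in> VF" "Y \<in> VF" "Z \<in> VF" for X Y Z
    using that by (simp add: lie_eq t_def)
  show ?thesis
    unfolding ext_d2_def F v[OF assms] v[OF assms(2,1,3)] v[OF assms(3,1,2)]
      l[OF assms] l[OF assms(1,3,2)] l[OF assms(2,3,1)] t12[OF assms(3,1) Phi_VF[OF assms(2)]]
    by (simp add: algebra_simps)
qed

text \<open>In \<open>dF\<close> at \<open>\<Phi> X, \<Phi> Y, \<Phi> Z\<close> each summand
  contains a double \<open>\<Phi>\<close>, hence a term with \<open>\<eta>\<close>. The three such
  terms cancel the wedge product, and the rest is the right-hand side of
  \<open>t_type\<close>.\<close>

lemma torsion_form_eq:
  assumes "X \<in> VF" "Y \<in> VF" "Z \<in> VF"
  shows "torsion_form \<phi> \<eta> g X Y Z = t X Y Z"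
proof -
  have xi: "t (\<Phi> X) (\<Phi> Y) \<xi> = t X Y \<xi>" if "X \<in> VF" "Y \<in> VF" for X Y
    using t_type[of X Y \<xi>] that by (simp add: t_def)
  note [simp] = assms
  have c: "t (\<Phi> Y) (\<Phi> Z) X = t X (\<Phi> Y) (\<Phi> Z)" "t (\<Phi> Z) (\<Phi> X) Y = t (\<Phi> X) Y (\<Phi> Z)"
    by (simp_all add: t_cyc[of X "\<Phi> Y"] t_cyc[of "\<Phi> Z"])
  have e: "ext_d2 (fundamental_form \<phi> g) (\<Phi> X) (\<Phi> Y) (\<Phi> Z) =
      - t (\<Phi> X) (\<Phi> Y) Z + et Z * t X Y \<xi> - t X (\<Phi> Y) (\<Phi> Z) + et X * t Y Z \<xi>
      - t (\<Phi> X) Y (\<Phi> Z) + et Y * t Z X \<xi>"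
    by (simp add: ext_d2_F t_PhiPhi xi c)
  show ?thesis
    unfolding torsion_form_def wedge12_def d_phi_F_def e t_type[OF assms]
      ext_d1_et[OF assms(1,2)] ext_d1_et[OF assms(2,3)] ext_d1_et[OF assms(3,1)]
    by (simp add: algebra_simps)
qed

text \<open>
  \<open>nabla_T\<close> and \<open>a\<close> are \<open>\<nabla>T\<close> as a vector-valued and as a scalar tensor, and \<open>q\<close> below is the second
  covariant derivative of \<open>T\<close>.
\<close>

definition nabla_T :: "'a vfield \<Rightarrow> 'a vfield \<Rightarrow> 'a vfield \<Rightarrow> 'a vfield" where
  "nabla_T W X Y = D W (T X Y) - T (D W X) Y - T X (D W Y)"

definition a :: "'a vfield \<Rightarrow> 'a vfield \<Rightarrow> 'a vfield \<Rightarrow> 'a vfield \<Rightarrow> 'a \<Rightarrow> real" where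
  "a W X Y Z = G (nabla_T W X Y) Z"

definition sigma_T :: "'a vfield \<Rightarrow> 'a vfield \<Rightarrow> 'a vfield \<Rightarrow> 'a vfield \<Rightarrow> 'a \<Rightarrow> real" where
  "sigma_T X Y Z W = G (T X Y) (T Z W) + G (T Y Z) (T X W) + G (T Z X) (T Y W)"

lemma nabla_T_VF [simp, intro]: "W \<in> VF \<Longrightarrow> X \<in> VF \<Longrightarrow> Y \<in> VF \<Longrightarrow> nabla_T W X Y \<in> VF"
  by (simp add: nabla_T_def)

lemma a_smooth [simp, intro]: "W \<in> VF \<Longrightarrow> X \<in> VF \<Longrightarrow> Y \<in> VF \<Longrightarrow> Z \<in> VF \<Longrightarrow> smooth_fun A (a W X Y Z)"
  by (simp add: a_def)

lemma a_nabla: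
  "W \<in> VF \<Longrightarrow> X \<in> VF \<Longrightarrow> Y \<in> VF \<Longrightarrow> Z \<in> VF \<Longrightarrow>
    a W X Y Z = vapply W (t X Y Z) - t (D W X) Y Z - t X (D W Y) Z - t X Y (D W Z)"
  by (simp add: a_def nabla_T_def t_def D_metric)

lemma a_nabla': "W \<in> VF \<Longrightarrow> X \<in> VF \<Longrightarrow> Y \<in> VF \<Longrightarrow> Z \<in> VF \<Longrightarrow>
    a W X Y Z = nabla_form3 D (torsion_form \<phi> \<eta> g) W X Y Z"
  by (simp add: nabla_form3_def torsion_form_eq a_nabla)

lemma a23: "W \<in> VF \<Longrightarrow> X \<in> VF \<Longrightarrow> Y \<in> VF \<Longrightarrow> Z \<in> VF \<Longrightarrow> a W Y X Z = - a W X Y Z"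
  by (simp add: a_nabla t12[of X Y] t12[of "D W X" Y] t12[of X "D W Y"] vapply_minus)

lemma a34: "W \<in> VF \<Longrightarrow> X \<in> VF \<Longrightarrow> Y \<in> VF \<Longrightarrow> Z \<in> VF \<Longrightarrow> a W X Z Y = - a W X Y Z"
  by (simp add: a_nabla t23[of X Y Z] t23[of X "D W Y" Z] t23[of X Y "D W Z"] t23[of "D W X" Y Z] vapply_minus)

text \<open>The Jacobi identity with every bracket rewritten as
  \<open>D X Y - D Y X - T X Y\<close>.\<close>

lemma bianchi_identity:
  assumes "X \<in> VF" "Y \<in> VF" "Z \<in> VF"
  shows "curvature D X Y Z + curvature D Y Z X + curvature D Z X Y =
    nabla_T X Y Z + nabla_T Y Z X + nabla_T Z X Y + T (T X Y) Z + T (T Y Z) X + T (T Z X) Y"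
proof -
  have T': "T (D Y X) Z = - T Z (D Y X)" for X Y Z by (rule T_swap)
  have "lie_bracket X (lie_bracket Y Z) + lie_bracket Y (lie_bracket Z X) + lie_bracket Z (lie_bracket X Y) = 0"
    using assms by (rule lie_bracket_jacobi)
  then have j: "D X (lie_bracket Y Z) - D (lie_bracket Y Z) X - T X (lie_bracket Y Z)
     + (D Y (lie_bracket Z X) - D (lie_bracket Z X) Y - T Y (lie_bracket Z X))
     + (D Z (lie_bracket X Y) - D (lie_bracket X Y) Z - T Z (lie_bracket X Y)) = 0"
    by (simp only: lie_eq[of X "lie_bracket Y Z"] lie_eq[of Y "lie_bracket Z X"] lie_eq[of Z "lie_bracket X Y"])
  have D': "D X (lie_bracket Y Z) = D X (D Y Z) - D X (D Z Y) - D X (T Y Z)"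
    if "X \<in> VF" "Y \<in> VF" "Z \<in> VF" for X Y Z using that by (simp add: lie_eq[of Y Z] D_diff2)
  have T'': "T X (lie_bracket Y Z) = T X (D Y Z) - T X (D Z Y) + T (T Y Z) X"
    if "X \<in> VF" "Y \<in> VF" "Z \<in> VF" for X Y Z using that by (simp add: lie_eq[of Y Z] T_diff T_swap[of X "T Y Z"])
  show ?thesis
    using j assms by (simp add: curvature_def nabla_T_def D' T'' T'[of X Y Z] T'[of X Z Y] T'[of Y Z X] T'[of Z X Y] T'[of Z Y X] T'[of Y X Z] algebra_simps)
qed

lemma bianchi_form:
  assumes "X \<in> VF" "Y \<in> VF" "Z \<in> VF" "W \<in> VF"
  shows "G (curvature D X Y Z + curvature D Y Z X + curvature D Z X Y) W =
    a X Y Z W + a Y Z X W + a Z X Y W + sigma_T X Y Z W"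
proof -
  have "G (T (T X Y) Z) W = G (T X Y) (T Z W)" if "X \<in> VF" "Y \<in> VF" "Z \<in> VF" for X Y Z
    using t_G[of "T X Y" Z W] that assms(4) by (simp add: t_def G_sym)
  then show ?thesis
    unfolding bianchi_identity[OF assms(1-3)] using assms by (simp add: a_def sigma_T_def)
qed

lemma curvature_VF [simp, intro]: "X \<in> VF \<Longrightarrow> Y \<in> VF \<Longrightarrow> Z \<in> VF \<Longrightarrow> curvature D X Y Z \<in> VF"
  by (simp add: curvature_def)

lemma first_bianchi_iff:
  "first_bianchi A D \<longleftrightarrow> (\<forall>X\<in>VF. \<forall>Y\<in>VF. \<forall>Z\<in>VF. \<forall>W\<in>VF. a X Y Z W + a Y Z X W + a Z X Y W + sigma_T X Y Z W = 0)"
proof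
  assume "first_bianchi A D"
  then show "\<forall>X\<in>VF. \<forall>Y\<in>VF. \<forall>Z\<in>VF. \<forall>W\<in>VF. a X Y Z W + a Y Z X W + a Z X Y W + sigma_T X Y Z W = 0"
    unfolding first_bianchi_def by (simp flip: bianchi_form)
next
  assume r: "\<forall>X\<in>VF. \<forall>Y\<in>VF. \<forall>Z\<in>VF. \<forall>W\<in>VF. a X Y Z W + a Y Z X W + a Z X Y W + sigma_T X Y Z W = 0"
  show "first_bianchi A D"
    unfolding first_bianchi_def
    by (intro ballI vfield_eq_0I) (simp_all only: bianchi_form r VF_add curvature_VF)
qed

text \<open>Rewriting brackets by \<open>D\<close> and \<open>T\<close> turns the derivative terms
  into \<open>a\<close>. Each of the six bracket terms also yields one product of two torsions, and
  by symmetry of \<open>G\<close> these form the three terms of \<open>\<sigma>\<close>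
  twice.\<close>

lemma ext_d3_t:
  assumes "X \<in> VF" "Y \<in> VF" "Z \<in> VF" "W \<in> VF"
  shows "ext_d3 (torsion_form \<phi> \<eta> g) X Y Z W =
    a X Y Z W - a Y X Z W + a Z X Y W - a W X Y Z + 2 * sigma_T X Y Z W"
proof -
  have p: "t (D X Y) Z W = t Z W (D X Y)" if "X \<in> VF" "Y \<in> VF" "Z \<in> VF" "W \<in> VF" for X Y Z W
    using that by (simp add: t_cyc)
  have p2: "t Z (D X Y) W = - t Z W (D X Y)" if "X \<in> VF" "Y \<in> VF" "Z \<in> VF" "W \<in> VF" for X Y Z W
    using that by (simp add: t23[of Z W "D X Y"])
  have l: "t (lie_bracket X Y) Z W = t Z W (D X Y) - t Z W (D Y X) - G (T Z W) (T X Y)"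
    if "X \<in> VF" "Y \<in> VF" "Z \<in> VF" "W \<in> VF" for X Y Z W
    using that unfolding t_G[OF VF_lie_bracket[OF that(1,2)] that(3,4)] by (simp add: lie_eq t_def)
  show ?thesis
    using assms
    by (simp add: ext_d3_def torsion_form_eq a_nabla l p p2 sigma_T_def
        G_sym[of "T _ _" "T _ _"] t12[of X Y] t12[of X Z] t12[of X W] t12[of Y Z] t12[of Y W] t12[of Z W]
        T_swap[of X Z] algebra_simps)
qed

lemma sigma_T_swap:
  assumes "X \<in> VF" "Y \<in> VF" "Z \<in> VF" "W \<in> VF"
  shows "sigma_T Y X Z W = - sigma_T X Y Z W" "sigma_T X Z Y W = - sigma_T X Y Z W" "sigma_T X Y W Z = - sigma_T X Y Z W"
proof -
  show "sigma_T Y X Z W = - sigma_T X Y Z W"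
    using assms by (simp add: sigma_T_def T_swap[of X Y] T_swap[of X Z] T_swap[of Y Z] algebra_simps)
  show "sigma_T X Z Y W = - sigma_T X Y Z W"
    using assms by (simp add: sigma_T_def T_swap[of X Y] T_swap[of X Z] T_swap[of Y Z] algebra_simps)
  show "sigma_T X Y W Z = - sigma_T X Y Z W"
    using assms G_sym[of "T X W" "T Y Z"] G_sym[of "T Y W" "T X Z"]
    by (simp add: sigma_T_def T_swap[of X Z] T_swap[of X W] T_swap[of Y W] T_swap[of Z W] T_swap[of Y Z] algebra_simps)
qed

lemma a_type:
  assumes "W \<in> VF" "X \<in> VF" "Y \<in> VF" "Z \<in> VF"
  shows "a W X Y Z = a W (\<Phi> X) (\<Phi> Y) Z + a W (\<Phi> X) Y (\<Phi> Z) + a W X (\<Phi> Y) (\<Phi> Z)"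
proof -
  note [simp] = assms
  show ?thesis
    unfolding a_nabla[OF assms] t_type[OF assms(2-4)] t_type[OF D_VF[OF assms(1,2)] assms(3,4)]
      t_type[OF assms(2) D_VF[OF assms(1,3)] assms(4)] t_type[OF assms(2,3) D_VF[OF assms(1,4)]]
    by (simp add: a_nabla Phi_parallel vapply_add algebra_simps)
qed

lemma a_add:
  assumes "X \<in> VF" "X' \<in> VF" "Y \<in> VF" "Z \<in> VF" "W \<in> VF"
  shows "a (X - X') Y Z W = a X Y Z W - a X' Y Z W"
  using assms by (simp add: a_nabla vapply_field_diff D_diff1 t_diff algebra_simps)

section \<open>Curvature, second derivative of the torsion and Ricci identity\<close>

lemma curvature_skew12: "X \<in> VF \<Longrightarrow> Y \<in> VF \<Longrightarrow> Z \<in> VF \<Longrightarrow> curvature D Y X Z = - curvature D X Y Z"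
  by (simp add: curvature_def lie_bracket_swap[of Y X] D_minus1)

lemma curvature_skew34:
  assumes "X \<in> VF" "Y \<in> VF" "Z \<in> VF" "W \<in> VF"
  shows "G (curvature D X Y W) Z = - G (curvature D X Y Z) W"
proof -
  note [simp] = assms
  have "vapply X (vapply Y (G Z W)) - vapply Y (vapply X (G Z W)) = vapply (lie_bracket X Y) (G Z W)"
    by (simp add: vapply_lie_bracket)
  then have "G (curvature D X Y Z) W + G Z (curvature D X Y W) = 0"
    by (simp add: D_metric vapply_add curvature_def algebra_simps)
  then show ?thesis
    by (simp add: G_sym[of Z] eq_neg_iff_add_eq_0 add.commute)
qed

lemma et_curvature:
  assumes "X \<in> VF" "Y \<in> VF" "Z \<in> VF"
  shows "et (curvature D X Y Z) = 0"
proof -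
  note [simp] = assms
  have "vapply X (vapply Y (et Z)) - vapply Y (vapply X (et Z)) = vapply (lie_bracket X Y) (et Z)"
    by (simp add: vapply_lie_bracket)
  then have "et (D X (D Y Z)) - et (D Y (D X Z)) = et (D (lie_bracket X Y) Z)"
    by (simp add: et_parallel)
  then show ?thesis
    by (simp add: et_eq curvature_def)
qed

lemma curvature_Phi: "X \<in> VF \<Longrightarrow> Y \<in> VF \<Longrightarrow> Z \<in> VF \<Longrightarrow> curvature D X Y (\<Phi> Z) = \<Phi> (curvature D X Y Z)"
  by (simp add: curvature_def Phi_parallel Phi_diff)

definition q :: "'a vfield \<Rightarrow> 'a vfield \<Rightarrow> 'a vfield \<Rightarrow> 'a vfield \<Rightarrow> 'a vfield \<Rightarrow> 'a \<Rightarrow> real" where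
  "q V X Y Z W = vapply V (a X Y Z W) - a (D V X) Y Z W - a X (D V Y) Z W - a X Y (D V Z) W - a X Y Z (D V W)"

lemma q_type:
  assumes "V \<in> VF" "X \<in> VF" "Y \<in> VF" "Z \<in> VF" "W \<in> VF"
  shows "q V X Y Z W = q V X (\<Phi> Y) (\<Phi> Z) W + q V X (\<Phi> Y) Z (\<Phi> W) + q V X Y (\<Phi> Z) (\<Phi> W)"
proof -
  note [simp] = assms
  show ?thesis
    unfolding q_def a_type[OF assms(2-5)] a_type[OF D_VF[OF assms(1,2)] assms(3-5)]
      a_type[OF assms(2) D_VF[OF assms(1,3)] assms(4,5)] a_type[OF assms(2,3) D_VF[OF assms(1,4)] assms(5)]
      a_type[OF assms(2-4) D_VF[OF assms(1,5)]]
    by (simp add: Phi_parallel vapply_add algebra_simps)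
qed

lemma ricci_identity:
  assumes "X \<in> VF" "Y \<in> VF" "U \<in> VF" "V \<in> VF" "W \<in> VF"
  shows "q X Y U V W - q Y X U V W + a (T X Y) U V W =
    - (t (curvature D X Y U) V W + t U (curvature D X Y V) W + t U V (curvature D X Y W))"
proof -
  note [simp] = assms
  have f1: "a (T X Y) U V W = a (D X Y) U V W - a (D Y X) U V W - a (lie_bracket X Y) U V W"
    by (simp add: torsion_def a_add)
  have f2: "a (lie_bracket X Y) U V W = vapply X (vapply Y (t U V W)) - vapply Y (vapply X (t U V W))
      - t (D (lie_bracket X Y) U) V W - t U (D (lie_bracket X Y) V) W - t U V (D (lie_bracket X Y) W)"
    by (simp add: a_nabla vapply_lie_bracket)
  have f3: "vapply X (a Y U V W) = vapply X (vapply Y (t U V W)) - vapply X (t (D Y U) V W)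
      - vapply X (t U (D Y V) W) - vapply X (t U V (D Y W))"
    if "X \<in> VF" "Y \<in> VF" for X Y using that by (simp add: a_nabla vapply_diff)
  have f4: "a Y (D X U) V W = vapply Y (t (D X U) V W) - t (D Y (D X U)) V W - t (D X U) (D Y V) W - t (D X U) V (D Y W)"
    "a Y U (D X V) W = vapply Y (t U (D X V) W) - t (D Y U) (D X V) W - t U (D Y (D X V)) W - t U (D X V) (D Y W)"
    "a Y U V (D X W) = vapply Y (t U V (D X W)) - t (D Y U) V (D X W) - t U (D Y V) (D X W) - t U V (D Y (D X W))"
    if "X \<in> VF" "Y \<in> VF" for X Y using that by (simp_all add: a_nabla)
  have f5: "t (curvature D X Y U) V W = t (D X (D Y U)) V W - t (D Y (D X U)) V W - t (D (lie_bracket X Y) U) V W"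
    "t U (curvature D X Y V) W = t U (D X (D Y V)) W - t U (D Y (D X V)) W - t U (D (lie_bracket X Y) V) W"
    "t U V (curvature D X Y W) = t U V (D X (D Y W)) - t U V (D Y (D X W)) - t U V (D (lie_bracket X Y) W)"
    by (simp_all add: curvature_def t_diff)
  show ?thesis
    unfolding q_def f1 f2 f3[OF assms(1,2)] f3[OF assms(2,1)] f4[OF assms(1,2)] f4[OF assms(2,1)] f5
    by (simp add: algebra_simps)
qed

text \<open>The relation \<open>3 a = - \<sigma>\<close> differentiated; each of the three products
  in \<open>\<sigma>\<close> gives two terms. It enters as a hypothesis because it depends on the
  Bianchi identity.\<close>

lemma q_eq:
  assumes "V \<in> VF" "X \<in> VF" "Y \<in> VF" "Z \<in> VF" "W \<in> VF"
    and a_sigma: "\<And>X Y Z W. X \<in> VF \<Longrightarrow> Y \<in> VF \<Longrightarrow> Z \<in> VF \<Longrightarrow> W \<in> VF \<Longrightarrow> a X Y Z W + a X Y Z W + a X Y Z W = - sigma_T X Y Z W"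
  shows "q V X Y Z W + q V X Y Z W + q V X Y Z W = - (G (nabla_T V X Y) (T Z W) + G (nabla_T V Z W) (T X Y)
      + G (nabla_T V Y Z) (T X W) + G (nabla_T V X W) (T Y Z) + G (nabla_T V Z X) (T Y W) + G (nabla_T V Y W) (T Z X))"
proof -
  note [simp] = assms(1-5)
  have v: "vapply V (G (T X Y) (T Z W)) = G (nabla_T V X Y) (T Z W) + G (T (D V X) Y) (T Z W) + G (T X (D V Y)) (T Z W)
      + G (nabla_T V Z W) (T X Y) + G (T X Y) (T (D V Z) W) + G (T X Y) (T Z (D V W))"
    if "X \<in> VF" "Y \<in> VF" "Z \<in> VF" "W \<in> VF" for X Y Z W
    using that by (simp add: D_metric nabla_T_def G_sym[of _ "T X Y"])
  have "vapply V (a X Y Z W) + vapply V (a X Y Z W) + vapply V (a X Y Z W) = - vapply V (sigma_T X Y Z W)"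
  proof -
    have "smooth_fun A (sigma_T X Y Z W)" by (simp add: sigma_T_def)
    then have "vapply V (a X Y Z W + a X Y Z W + a X Y Z W) = - vapply V (sigma_T X Y Z W)"
      by (simp only: a_sigma assms vapply_minus)
    then show ?thesis by (simp only: vapply_add a_smooth smooth_add assms(1-5))
  qed
  moreover have "vapply V (sigma_T X Y Z W) = vapply V (G (T X Y) (T Z W)) + vapply V (G (T Y Z) (T X W)) + vapply V (G (T Z X) (T Y W))"
    by (simp add: sigma_T_def vapply_add)
  moreover have "q V X Y Z W + q V X Y Z W + q V X Y Z W = vapply V (a X Y Z W) + vapply V (a X Y Z W) + vapply V (a X Y Z W)
     + sigma_T (D V X) Y Z W + sigma_T X (D V Y) Z W + sigma_T X Y (D V Z) W + sigma_T X Y Z (D V W)"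
    using a_sigma[of "D V X" Y Z W] a_sigma[of X "D V Y" Z W] a_sigma[of X Y "D V Z" W] a_sigma[of X Y Z "D V W"]
    by (simp add: q_def algebra_simps)
  ultimately show ?thesis
    by (simp add: v) (simp add: sigma_T_def algebra_simps)
qed

section \<open>Horizontal fields and their frames\<close>

definition horizontal :: "'a vfield set" where
  "horizontal = {X \<in> VF. et X = 0}"

lemma horizontal_VF [simp, intro]: "X \<in> horizontal \<Longrightarrow> X \<in> VF" and horizontal_et [simp]: "X \<in> horizontal \<Longrightarrow> et X = 0"
  by (simp_all add: horizontal_def)

lemma horizontalI: "X \<in> VF \<Longrightarrow> et X = 0 \<Longrightarrow> X \<in> horizontal"
  unfolding horizontal_def by blast

lemma horizontal_Phi [simp, intro]: "X \<in> horizontal \<Longrightarrow> \<Phi> X \<in> horizontal"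
  by (rule horizontalI) simp_all

lemma horizontal_PhiPhi [simp]: "X \<in> horizontal \<Longrightarrow> \<Phi> (\<Phi> X) = - X"
  by (simp add: PhiPhi) (simp add: fscale_def tscale_def fun_eq_iff)

lemma et_minus: "X \<in> VF \<Longrightarrow> et (- X) = - et X"
  and et_add: "X \<in> VF \<Longrightarrow> Y \<in> VF \<Longrightarrow> et (X + Y) = et X + et Y"
  and et_fscale: "X \<in> VF \<Longrightarrow> smooth_fun A f \<Longrightarrow> et (fscale f X) = f * et X"
  by (simp_all add: et_eq)

lemma horizontal_zero [simp, intro]: "0 \<in> horizontal"
  by (rule horizontalI) (simp_all add: et_eq)

lemma horizontal_minus [simp, intro]: "X \<in> horizontal \<Longrightarrow> - X \<in> horizontal"
  using et_minus[of X] by (intro horizontalI) simp_all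

text \<open>Constant coefficients suffice, as frames are only used at one point. The combination is
  recorded by its action on functions and by its pairings, the form in which
  \<open>finite_parseval_frame\<close> asks for linear structure.\<close>

lemma horizontal_lincomb:
  assumes "finite F" "F \<subseteq> horizontal"
  shows "\<exists>Z\<in>horizontal. (\<forall>p f. Z p f = (\<Sum>E\<in>F. u E * E p f)) \<and> (\<forall>Y\<in>VF. \<forall>p. G Z Y p = (\<Sum>E\<in>F. u E * G E Y p))"
  using assms
proof (induction F)
  case empty
  have "\<forall>p f. (0 :: 'a vfield) p f = (\<Sum>E\<in>{}. u E * E p f)"
    and "\<forall>Y\<in>VF. \<forall>p. G 0 Y p = (\<Sum>E\<in>{}. u E * G E Y p)" by simp_all
  then show ?case using horizontal_zero by blast
next
  case (insert E F)
  then obtain Z where Z: "Z \<in> horizontal" "\<And>p f. Z p f = (\<Sum>E\<in>F. u E * E p f)"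
    "\<And>Y p. Y \<in> VF \<Longrightarrow> G Z Y p = (\<Sum>E\<in>F. u E * G E Y p)" by auto
  have E [simp]: "E \<in> horizontal" using insert by auto
  let ?Z = "fscale (\<lambda>_. u E) E + Z"
  have "et ?Z = 0"
    using Z(1) by (simp add: et_add et_fscale)
  then have "?Z \<in> horizontal" using Z(1) by (intro horizontalI) auto
  moreover have "?Z p f = (\<Sum>E\<in>insert E F. u E * E p f)" for p f
    using insert.hyps by (simp add: fscale_def tscale_def Z(2))
  moreover have "G ?Z Y p = (\<Sum>E\<in>insert E F. u E * G E Y p)" if "Y \<in> VF" for Y p
    using insert.hyps that Z(1) by (simp add: Z(3))
  ultimately show ?case by blast
qed

lemma horizontal_frame:
  "\<exists>I\<subseteq>horizontal. finite I \<and> (\<forall>X\<in>horizontal. \<forall>Y\<in>horizontal. G X Y p = (\<Sum>E\<in>I. G X E p * G Y E p))"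
proof -
  from tangent_coordinates[of p] obtain x :: "'e \<Rightarrow> 'a \<Rightarrow> real"
    where "\<forall>v\<in>TS p. (\<forall>b\<in>Basis. v (x b) = 0) \<longrightarrow> v = 0"
    by (elim exE conjE)
  then have x: "v = 0" if "v \<in> TS p" "\<And>b. b \<in> Basis \<Longrightarrow> v (x b) = 0" for v
    using that by simp
  \<comment> \<open>The coordinate vector of \<open>X p\<close>. By the choice of \<open>x\<close>
    it vanishes only if \<open>X p\<close> does, so orthonormal families at \<open>p\<close> have at
    most \<open>DIM('e)\<close> members.\<close>
  define L :: "'a vfield \<Rightarrow> 'e" where "L X = (\<Sum>b\<in>Basis. X p (x b) *\<^sub>R b)" for X
  have G0: "G X Y p = 0" if "X \<in> VF" "Y \<in> VF" "X p = 0" for X Y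
    using g_lin[OF VF_tangent[OF that(2)] VF_tangent[OF that(2)] VF_tangent[OF that(2)], of p 0 0] that(3)
    by (simp add: ap2_def tscale_zero)
  show ?thesis
  proof (rule finite_parseval_frame[where S=horizontal and G="\<lambda>X Y. G X Y p" and L=L])
    show "G X Y p = G Y X p" if "X \<in> horizontal" "Y \<in> horizontal" for X Y
      by (rule fun_cong[OF G_sym[OF horizontal_VF[OF that(1)] horizontal_VF[OF that(2)]]])
    show "G X X p \<ge> 0" if "X \<in> horizontal" for X
    proof (cases "X p = 0")
      case True
      then show ?thesis using G0[OF horizontal_VF[OF that] horizontal_VF[OF that]] by simp
    next
      case False
      then show ?thesis using g_pos[OF VF_tangent[OF horizontal_VF[OF that]] False] by (simp add: ap2_def)
    qed
    show "G X Y p = 0" if "X \<in> horizontal" "Y \<in> horizontal" "G X X p = 0" for X Y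
      by (rule G0[OF horizontal_VF[OF that(1)] horizontal_VF[OF that(2)] G_nondegenerate[OF horizontal_VF[OF that(1)] that(3)]])
    show "G X Y p = 0" if "X \<in> horizontal" "Y \<in> horizontal" "L X = 0" for X Y
    proof -
      have "X p (x b) = 0" if b: "b \<in> Basis" for b
      proof -
        have "L X \<bullet> b = X p (x b)" unfolding L_def by (rule inner_sum_left_Basis[OF b])
        then show ?thesis using \<open>L X = 0\<close> by simp
      qed
      then have "X p = 0" by (rule x[OF VF_tangent[OF horizontal_VF[OF that(1)]]])
      then show ?thesis by (rule G0[OF horizontal_VF[OF that(1)] horizontal_VF[OF that(2)]])
    qed
    show "\<exists>Z\<in>horizontal. (\<forall>Y\<in>horizontal. G Z Y p = (\<Sum>E\<in>F. u E * G E Y p)) \<and> L Z = (\<Sum>E\<in>F. u E *\<^sub>R L E)"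
      if F: "finite F" "F \<subseteq> horizontal" for F u
    proof -
      from horizontal_lincomb[OF F, of u] obtain Z where Z: "Z \<in> horizontal"
        and Zp: "\<forall>p f. Z p f = (\<Sum>E\<in>F. u E * E p f)"
        and ZG: "\<forall>Y\<in>VF. \<forall>p. G Z Y p = (\<Sum>E\<in>F. u E * G E Y p)"
        by (elim bexE conjE)
      have "L Z = (\<Sum>b\<in>Basis. \<Sum>E\<in>F. (u E * E p (x b)) *\<^sub>R b)"
        unfolding L_def Zp[rule_format] by (simp only: scaleR_sum_left)
      also have "\<dots> = (\<Sum>E\<in>F. \<Sum>b\<in>Basis. (u E * E p (x b)) *\<^sub>R b)"
        by (rule sum.swap)
      also have "\<dots> = (\<Sum>E\<in>F. u E *\<^sub>R L E)"
        unfolding L_def by (simp only: scaleR_sum_right scaleR_scaleR)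
      finally have "L Z = (\<Sum>E\<in>F. u E *\<^sub>R L E)" .
      moreover have "\<forall>Y\<in>horizontal. G Z Y p = (\<Sum>E\<in>F. u E * G E Y p)" using ZG horizontal_VF by blast
      ultimately show ?thesis using Z by blast
    qed
  qed
qed

end

section \<open>The first Bianchi identity\<close>

text \<open>By skew-symmetry in the last three arguments, the four Bianchi identities with
  \<open>W\<close>, \<open>Z\<close>, \<open>Y\<close> and \<open>X\<close> in the last slot are
  linear equations for the four values of \<open>a\<close> distinguished by their first argument.
  They determine these values as \<open>s / 3\<close> with alternating signs, so \<open>a\<close> is
  totally skew.\<close>

lemma skew_bianchi:
  fixes a s :: "'v \<Rightarrow> 'v \<Rightarrow> 'v \<Rightarrow> 'v \<Rightarrow> real"
  assumes a23: "\<And>X Y Z W. a W Y X Z = - a W X Y Z" and a34: "\<And>X Y Z W. a W X Z Y = - a W X Y Z"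
    and s12: "\<And>X Y Z W. s Y X Z W = - s X Y Z W" and s23: "\<And>X Y Z W. s X Z Y W = - s X Y Z W"
    and s34: "\<And>X Y Z W. s X Y W Z = - s X Y Z W"
    and b: "\<And>X Y Z W. a X Y Z W + a Y Z X W + a Z X Y W + s X Y Z W = 0"
  shows "3 * a X Y Z W = - s X Y Z W" "a Y X Z W = - a X Y Z W"
proof -
  have cyc: "a X Y Z W = a X Z W Y" for X Y Z W
    using a23[of X Z Y W] a34[of X Z Y W] by linarith
  have 1: "a X Y Z W - a Y X Z W + a Z X Y W + s X Y Z W = 0"
    using b[of X Y Z W] a23[of Y Z X W] by linarith
  have 2: "- a X Y Z W + a Y X Z W + a W X Y Z - s X Y Z W = 0"
    using b[of X Y W Z] a34[of X Y Z W] cyc[of Y X Z W] cyc[of Y Z W X] s34[of X Y Z W]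
    by linarith
  have 3: "a X Y Z W + a Z X Y W - a W X Y Z + s X Y Z W = 0"
    using b[of X Z W Y] cyc[of X Y Z W] cyc[of Z W X Y] a34[of W X Y Z] s34[of X Z Y W] s23[of X Y Z W]
    by linarith
  have 4: "a Y X Z W - a Z X Y W + a W X Y Z - s X Y Z W = 0"
    using b[of Y Z W X] cyc[of Y X Z W] cyc[of Z X Y W] a34[of Z Y X W] a23[of Z X Y W]
      cyc[of Z W Y X] cyc[of W X Y Z] s12[of X Y Z W] s23[of Y X Z W] s34[of Y Z X W]
    by linarith
  show "3 * a X Y Z W = - s X Y Z W" "a Y X Z W = - a X Y Z W" using 1 2 3 4 by linarith+
qed

text \<open>The classical combination of four Bianchi identities, with each argument in turn in the
  last slot.\<close>

lemma pair_symmetry: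
  fixes R :: "'v \<Rightarrow> 'v \<Rightarrow> 'v \<Rightarrow> 'v \<Rightarrow> real"
  assumes R12: "\<And>X Y Z W. R Y X Z W = - R X Y Z W" and R34: "\<And>X Y Z W. R X Y W Z = - R X Y Z W"
    and b: "\<And>X Y Z W. R X Y Z W + R Y Z X W + R Z X Y W = 0"
  shows "R X Y Z W = R Z W X Y"
  using b[of X Y Z W] b[of Y Z W X] b[of Z W X Y] b[of W X Y Z]
    R12[of X Z Y W] R34[of Y Z X W] R12[of Y W Z X] R34[of Y W X Z]
    R12[of X W Z Y] R12[of X Z W Y] R34[of X Z Y W] R34[of X W Y Z] R12[of X W Y Z] R34[of X Y Z W]
    R34[of Z W X Y] R34[of Y W Z X] R12[of Z X W Y]
  by linarith

section \<open>Torsion and curvature under the Bianchi identity\<close>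

locale sasaki_bianchi = sasaki_torsion +
  assumes first_bianchi: "first_bianchi A D"
begin

lemma bianchi: "X \<in> VF \<Longrightarrow> Y \<in> VF \<Longrightarrow> Z \<in> VF \<Longrightarrow> W \<in> VF \<Longrightarrow>
    a X Y Z W + a Y Z X W + a Z X Y W + sigma_T X Y Z W = 0"
  using first_bianchi unfolding first_bianchi_iff by blast

lemma a_first:
  assumes "X \<in> VF" "Y \<in> VF" "Z \<in> VF" "W \<in> VF"
  shows "a X Y Z W + a X Y Z W + a X Y Z W = - sigma_T X Y Z W" "a Y X Z W = - a X Y Z W"
proof -
  \<comment> \<open>\<open>skew_bianchi\<close> ranges over a whole type. Sending everything outside
    \<open>VF\<close> to the zero field makes the symmetry laws hold without restriction.\<close>
  define r where "r X = (if X \<in> VF then X else 0)" for X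
  have r [simp]: "r X \<in> VF" and r_id: "X \<in> VF \<Longrightarrow> r X = X" for X by (simp_all add: r_def)
  have "3 * a X Y Z W p = - sigma_T X Y Z W p \<and> a Y X Z W p = - a X Y Z W p" for p
  proof -
    have f1: "a (r W) (r Y) (r X) (r Z) p = - a (r W) (r X) (r Y) (r Z) p" for X Y Z W
      by (simp add: a23[of "r W" "r X" "r Y" "r Z"])
    have f2: "a (r W) (r X) (r Z) (r Y) p = - a (r W) (r X) (r Y) (r Z) p" for X Y Z W
      by (simp add: a34[of "r W" "r X" "r Y" "r Z"])
    have f3: "sigma_T (r Y) (r X) (r Z) (r W) p = - sigma_T (r X) (r Y) (r Z) (r W) p" for X Y Z W
      by (simp add: sigma_T_swap(1)[of "r X" "r Y" "r Z" "r W"])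
    have f4: "sigma_T (r X) (r Z) (r Y) (r W) p = - sigma_T (r X) (r Y) (r Z) (r W) p" for X Y Z W
      by (simp add: sigma_T_swap(2)[of "r X" "r Y" "r Z" "r W"])
    have f5: "sigma_T (r X) (r Y) (r W) (r Z) p = - sigma_T (r X) (r Y) (r Z) (r W) p" for X Y Z W
      by (simp add: sigma_T_swap(3)[of "r X" "r Y" "r Z" "r W"])
    have f6: "a (r X) (r Y) (r Z) (r W) p + a (r Y) (r Z) (r X) (r W) p + a (r Z) (r X) (r Y) (r W) p
        + sigma_T (r X) (r Y) (r Z) (r W) p = 0" for X Y Z W
      using fun_cong[OF bianchi[of "r X" "r Y" "r Z" "r W"], of p] by simp
    show ?thesis
      using skew_bianchi[of "\<lambda>X Y Z W. a (r X) (r Y) (r Z) (r W) p" "\<lambda>X Y Z W. sigma_T (r X) (r Y) (r Z) (r W) p"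
          X Y Z W, OF f1 f2 f3 f4 f5 f6] by (simp add: r_id assms)
  qed
  then show "a X Y Z W + a X Y Z W + a X Y Z W = - sigma_T X Y Z W" "a Y X Z W = - a X Y Z W"
    by (auto simp: fun_eq_iff)
qed

lemmas a_sigma = a_first(1) and a12 = a_first(2)

lemma a_cyc: "X \<in> VF \<Longrightarrow> Y \<in> VF \<Longrightarrow> Z \<in> VF \<Longrightarrow> W \<in> VF \<Longrightarrow> a X Y Z W = a Y Z X W"
  by (simp add: a23[of Y X Z W] a12[of X Y Z W])

lemma a_G: "X \<in> VF \<Longrightarrow> Y \<in> VF \<Longrightarrow> Z \<in> VF \<Longrightarrow> W \<in> VF \<Longrightarrow> G (nabla_T X Y Z) W = - a W X Y Z"
  using a12[of X W Y Z] a23[of X Y W Z] a34[of X Y Z W] by (simp add: a_def)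

lemma bianchi_curvature:
  assumes "X \<in> VF" "Y \<in> VF" "Z \<in> VF" "W \<in> VF"
  shows "G (curvature D X Y Z) W + G (curvature D Y Z X) W + G (curvature D Z X Y) W = 0"
  using bianchi_form[OF assms] bianchi[OF assms] assms by simp

lemma curvature_pair:
  assumes "X \<in> VF" "Y \<in> VF" "Z \<in> VF" "W \<in> VF"
  shows "G (curvature D X Y Z) W = G (curvature D Z W X) Y"
proof
  fix p
  define r where "r X = (if X \<in> VF then X else 0)" for X
  have r [simp]: "r X \<in> VF" and r_id: "X \<in> VF \<Longrightarrow> r X = X" for X by (simp_all add: r_def)
  have 1: "G (curvature D (r Y) (r X) (r Z)) (r W) p = - G (curvature D (r X) (r Y) (r Z)) (r W) p" for X Y Z W
    by (simp add: curvature_skew12[of "r X" "r Y"])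
  have 2: "G (curvature D (r X) (r Y) (r W)) (r Z) p = - G (curvature D (r X) (r Y) (r Z)) (r W) p" for X Y Z W
    by (simp add: curvature_skew34[of "r X" "r Y" "r Z" "r W"])
  have 3: "G (curvature D (r X) (r Y) (r Z)) (r W) p + G (curvature D (r Y) (r Z) (r X)) (r W) p
      + G (curvature D (r Z) (r X) (r Y)) (r W) p = 0" for X Y Z W
    using fun_cong[OF bianchi_curvature[of "r X" "r Y" "r Z" "r W"], of p] by simp
  show "G (curvature D X Y Z) W p = G (curvature D Z W X) Y p"
    using pair_symmetry[of "\<lambda>X Y Z W. G (curvature D (r X) (r Y) (r Z)) (r W) p" X Y Z W, OF 1 2 3]
    by (simp add: r_id assms)
qed

text \<open>Pair symmetry moves \<open>\<Phi> X\<close> and \<open>\<Phi> Y\<close> to the other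
  pair, where the curvature commutes with \<open>\<Phi>\<close>. There \<open>\<Phi>\<close>
  preserves \<open>G\<close> up to an \<open>\<eta>\<close>-term, and \<open>\<eta>\<close> kills
  the values of the curvature.\<close>

lemma curvature_Phi_Phi:
  assumes "X \<in> VF" "Y \<in> VF" "Z \<in> VF"
  shows "curvature D (\<Phi> X) (\<Phi> Y) Z = curvature D X Y Z"
proof -
  note [simp] = assms
  have "curvature D (\<Phi> X) (\<Phi> Y) Z - curvature D X Y Z = 0"
  proof (rule vfield_eq_0I)
    fix W assume [simp]: "W \<in> VF"
    show "G (curvature D (\<Phi> X) (\<Phi> Y) Z - curvature D X Y Z) W = 0"
      by (simp add: curvature_pair[of "\<Phi> X"] curvature_pair[of X] curvature_Phi G_Phi_Phi et_curvature)
  qed simp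
  then show ?thesis by simp
qed

lemma a_zero [simp]: "X \<in> VF \<Longrightarrow> Y \<in> VF \<Longrightarrow> Z \<in> VF \<Longrightarrow> a X Y Z 0 = 0"
  by (simp add: a_def)

lemma a_PhiPhi: "X \<in> VF \<Longrightarrow> Y \<in> VF \<Longrightarrow> Z \<in> VF \<Longrightarrow> W \<in> VF \<Longrightarrow>
    a X Y Z (\<Phi> (\<Phi> W)) = - a X Y Z W + et W * a X Y Z \<xi>"
  by (simp add: a_def PhiPhi)

lemma a_cyc3: "X \<in> VF \<Longrightarrow> Y \<in> VF \<Longrightarrow> Z \<in> VF \<Longrightarrow> W \<in> VF \<Longrightarrow> a X Y Z W = a X Z W Y"
  by (simp add: a34[of X Z Y W] a23[of X Y Z W])

text \<open>With \<open>\<xi>\<close> inserted, \<open>a\<close> is a 3-form that by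
  \<open>a_type\<close> and \<open>\<Phi> \<xi> = 0\<close> does not change when
  \<open>\<Phi>\<close> is applied to two arguments. Using this for the pairs (1,2), (2,3) and (1,3)
  hits the second argument twice before the third use, so the value equals its own negative.\<close>

lemma a_xi [simp]:
  assumes "X \<in> VF" "Y \<in> VF" "Z \<in> VF"
  shows "a X Y Z \<xi> = 0"
proof -
  note [simp] = assms
  have b: "a X Y Z \<xi> = a X (\<Phi> Y) (\<Phi> Z) \<xi>" if "X \<in> VF" "Y \<in> VF" "Z \<in> VF" for X Y Z
    using a_type[of X Y Z \<xi>] that by simp
  have "a X Z \<xi> \<xi> p = 0" if "X \<in> VF" "Z \<in> VF" for X Z p
    using fun_cong[OF a34[of X Z \<xi> \<xi>], of p] that by simp
  then have xx: "a X Z \<xi> \<xi> = 0" if "X \<in> VF" "Z \<in> VF" for X Z using that by (simp add: fun_eq_iff)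
  have "a X Y Z \<xi> = a Y Z X \<xi>" by (rule a_cyc) simp_all
  also have "\<dots> = a Z X Y \<xi>" by (rule a_cyc) simp_all
  also have "\<dots> = a Z (\<Phi> X) (\<Phi> Y) \<xi>" by (rule b) simp_all
  also have "\<dots> = a (\<Phi> X) (\<Phi> Y) Z \<xi>" by (rule a_cyc) simp_all
  also have "\<dots> = a (\<Phi> X) (\<Phi> (\<Phi> Y)) (\<Phi> Z) \<xi>" by (rule b) simp_all
  also have "\<dots> = a (\<Phi> X) (\<Phi> Z) \<xi> (\<Phi> (\<Phi> Y))" by (rule a_cyc3) simp_all
  also have "\<dots> = - a (\<Phi> X) (\<Phi> Z) \<xi> Y" by (simp add: a_PhiPhi xx)
  also have "a (\<Phi> X) (\<Phi> Z) \<xi> Y = a (\<Phi> X) Y (\<Phi> Z) \<xi>" by (rule a_cyc3[symmetric]) simp_all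
  also have "\<dots> = a Y (\<Phi> Z) (\<Phi> X) \<xi>" by (rule a_cyc) simp_all
  also have "\<dots> = a Y Z X \<xi>" by (rule b[symmetric]) simp_all
  also have "\<dots> = a X Y Z \<xi>" by (rule a_cyc[symmetric]) simp_all
  finally show ?thesis by (simp add: fun_eq_iff)
qed

lemma a_xi1 [simp]:
  assumes "X \<in> VF" "Y \<in> VF" "Z \<in> VF"
  shows "a \<xi> X Y Z = 0" "a X \<xi> Y Z = 0" "a X Y \<xi> Z = 0"
proof -
  note [simp] = assms
  show "a X Y \<xi> Z = 0" using a34[of X Y Z \<xi>] by simp
  then show 1: "a X \<xi> Y Z = 0" using a23[of X Y \<xi> Z] by simp
  then show "a \<xi> X Y Z = 0" using a12[of X \<xi> Y Z] by simp
qed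

lemma et_nabla_T [simp]: "X \<in> VF \<Longrightarrow> Y \<in> VF \<Longrightarrow> Z \<in> VF \<Longrightarrow> et (nabla_T X Y Z) = 0"
  using a_xi[of X Y Z] by (simp add: a_def et_eq)

lemma D_xi: "X \<in> VF \<Longrightarrow> D X \<xi> = 0"
proof (rule vfield_eq_0I)
  fix Y assume X [simp]: "X \<in> VF" and [simp]: "Y \<in> VF"
  have "vapply X (G \<xi> Y) = et (D X Y)" using et_parallel[of X Y] G_sym[of \<xi> Y] by (simp add: et_eq)
  then show "G (D X \<xi>) Y = 0" using G_sym[of \<xi> "D X Y"] by (simp add: D_metric et_eq)
qed simp

text \<open>In the Ricci identity for \<open>\<xi>\<close> and \<open>Y\<close> everything else
  vanishes: \<open>T\<close>, and with it \<open>\<sigma>\<close>, is parallel along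
  \<open>\<xi>\<close>; \<open>\<xi>\<close> is parallel and annihilated by \<open>a\<close>; and
  \<open>R(\<xi>, Y) = 0\<close> by pair symmetry. This disposes of the products of
  \<open>d\<eta>\<close> in \<open>norm\<close>.\<close>

lemma a_torsion_xi:
  assumes "Y \<in> VF" "U \<in> VF" "V \<in> VF" "W \<in> VF"
  shows "a (T \<xi> Y) U V W = 0"
proof -
  note [simp] = assms
  have "nabla_T \<xi> X Y = 0" if "X \<in> VF" "Y \<in> VF" for X Y
    by (rule vfield_eq_0I) (use that in \<open>simp_all flip: a_def\<close>)
  then have "q \<xi> Y U V W + q \<xi> Y U V W + q \<xi> Y U V W = 0"
    by (subst q_eq[OF _ _ _ _ _ a_sigma]) simp_all
  then have 1: "q \<xi> Y U V W = 0" by (simp add: fun_eq_iff)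
  have a0: "a 0 U V W = 0" using a_G[of U V W 0] by simp
  have 2: "q Y \<xi> U V W = 0" by (simp add: q_def D_xi vapply_zero a0)
  have R: "curvature D \<xi> Y Z = 0" if [simp]: "Z \<in> VF" for Z
  proof (rule vfield_eq_0I)
    fix X assume [simp]: "X \<in> VF"
    have "D X 0 = 0" if "X \<in> VF" for X using D_diff2[of X 0 0] that by simp
    then have "curvature D Z X \<xi> = 0" by (simp add: curvature_def D_xi)
    then show "G (curvature D \<xi> Y Z) X = 0" by (simp add: curvature_pair[of \<xi>])
  qed simp
  have t0: "t 0 X Y = 0" "t X 0 Y = 0" "t X Y 0 = 0" if "X \<in> VF" "Y \<in> VF" for X Y
    using t_diff[of 0 0 X Y] that by simp_all
  show ?thesis
    using ricci_identity[of \<xi> Y U V W] by (simp add: 1 2 R t0)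
qed

text \<open>At each point the frame turns all contractions into finite sums, so the hypotheses of
  \<open>bianchi_torsion\<close> can be checked there. Its conclusion concerns frame vectors only,
  and the frame expansion extends it to all fields.\<close>

lemma a_eq_zero:
  assumes W: "X \<in> VF" "Y \<in> VF" "Z \<in> VF" "W \<in> VF"
  shows "a X Y Z W = 0"
proof
  fix p
  obtain I where I: "I \<subseteq> horizontal" "finite I" and parseval: "\<And>X Y. X \<in> horizontal \<Longrightarrow> Y \<in> horizontal \<Longrightarrow> G X Y p = (\<Sum>E\<in>I. G X E p * G Y E p)"
    using horizontal_frame[of p] by blast
  have IV [simp]: "E \<in> VF" and IH [simp]: "E \<in> horizontal" if "E \<in> I" for E using I that by auto
  \<comment> \<open>\<open>- \<Phi> (\<Phi> U)\<close> is the horizontal part of \<open>U\<close>.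
    Parseval applies to it, and the \<open>\<xi>\<close>-components account for the subtracted
    product.\<close>
  have frame: "(\<Sum>E\<in>I. G U E p * G V E p) = G U V p - et U p * et V p" if "U \<in> VF" "V \<in> VF" for U V
  proof -
    note [simp] = that
    let ?h = "\<lambda>U. - \<Phi> (\<Phi> U)"
    have h: "?h U \<in> horizontal" if "U \<in> VF" for U using that by (intro horizontal_minus horizontalI) auto
    have hE: "G (?h U) E = G U E" if "U \<in> VF" "E \<in> horizontal" for U E
      using that G_sym[of \<xi> E] horizontal_et[OF that(2)] et_eq[of E] by (simp add: PhiPhi)
    have "(\<Sum>E\<in>I. G U E p * G V E p) = (\<Sum>E\<in>I. G (?h U) E p * G (?h V) E p)"
      using hE by (intro sum.cong) simp_all
    also have "\<dots> = G (?h U) (?h V) p" using h by (simp only: parseval that)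
    also have "G (?h U) (?h V) = G (\<Phi> (\<Phi> U)) (\<Phi> (\<Phi> V))" by simp
    also have "\<dots> = G U V - et U * et V" by (simp add: G_Phi_Phi[of "\<Phi> U"]  G_Phi_Phi[of U])
    finally show ?thesis by simp
  qed
  have frame_a: "(\<Sum>E\<in>I. a X Y Z E p * G V E p) = a X Y Z V p" if "X \<in> VF" "Y \<in> VF" "Z \<in> VF" "V \<in> VF" for X Y Z V
    using frame[of "nabla_T X Y Z" V] that by (simp add: a_def)
  \<comment> \<open>The frame expansion applies to the last argument. The slots are freed one at a
    time, skew-symmetry bringing each to the last place; no \<open>\<xi>\<close>-term appears
    because \<open>a\<close> is horizontal.\<close>
  have a_all: "a X Y Z W p = 0"
    if 0: "\<And>i j k l. i \<in> I \<Longrightarrow> j \<in> I \<Longrightarrow> k \<in> I \<Longrightarrow> l \<in> I \<Longrightarrow> a i j k l p = 0"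
  proof -
    have e: "a X Y Z V p = 0" if "\<And>E. E \<in> I \<Longrightarrow> a X Y Z E p = 0" "X \<in> VF" "Y \<in> VF" "Z \<in> VF" "V \<in> VF"
      for X Y Z V
      using frame_a[OF that(2-5)] sum.neutral[of I "\<lambda>E. a X Y Z E p * G V E p"] that(1) by simp
    have 1: "a i j k W p = 0" if "i \<in> I" "j \<in> I" "k \<in> I" "W \<in> VF" for i j k W
      by (rule e) (use 0 that in auto)
    have 2: "a i j Z W p = 0" if "i \<in> I" "j \<in> I" "Z \<in> VF" "W \<in> VF" for i j Z W
    proof (rule e)
      show "a i j Z E p = 0" if E: "E \<in> I" for E
        using 1[of i j E Z] fun_cong[OF a34[of i j E Z], of p] E \<open>i \<in> I\<close> \<open>j \<in> I\<close> \<open>Z \<in> VF\<close> by simp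
    qed (use that in auto)
    have 3: "a i Y Z W p = 0" if "i \<in> I" "Y \<in> VF" "Z \<in> VF" "W \<in> VF" for i Y Z W
    proof (rule e)
      show "a i Y Z E p = 0" if E: "E \<in> I" for E
        using 2[of i E Y Z] fun_cong[OF a_cyc3[of i E Y Z], of p] E \<open>i \<in> I\<close> \<open>Y \<in> VF\<close> \<open>Z \<in> VF\<close> by simp
    qed (use that in auto)
    show ?thesis
    proof (rule e)
      show "a X Y Z E p = 0" if E: "E \<in> I" for E
        using 3[of E X Y Z] fun_cong[OF a_G[of X Y Z E], of p] E W by (simp add: a_def)
    qed (use W in auto)
  qed
  \<comment> \<open>\<open>r\<close> makes the tensors total functions, so that the pointwise algebra needs no carrier sets.\<close>
  define r where "r X = (if X \<in> horizontal then X else 0)" for X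
  have r [simp]: "r X \<in> horizontal" and r_id [simp]: "X \<in> horizontal \<Longrightarrow> r X = X" for X by (simp_all add: r_def)
  define T' where "T' X Y Z = t (r X) (r Y) (r Z) p" for X Y Z
  define a' where "a' X Y Z W = a (r X) (r Y) (r Z) (r W) p" for X Y Z W
  define J where "J X = \<Phi> (r X)" for X
  have rJ [simp]: "r (J X) = \<Phi> (r X)" for X by (simp add: J_def)
  have rJJ [simp]: "r (J (J X)) = - r X" for X by (simp add: J_def)
  have frameJ: "(\<Sum>E\<in>I. G U (\<Phi> E) p * G V (\<Phi> E) p) = (\<Sum>E\<in>I. G U E p * G V E p)"
    if [simp]: "U \<in> VF" "V \<in> VF" for U V
  proof -
    have "(\<Sum>E\<in>I. G U (\<Phi> E) p * G V (\<Phi> E) p) = (\<Sum>E\<in>I. G (\<Phi> U) E p * G (\<Phi> V) E p)"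
      by (intro sum.cong) (simp_all add: G_Phi_skew[of U] G_Phi_skew[of V])
    also have "\<dots> = G (\<Phi> U) (\<Phi> V) p" by (simp add: frame)
    also have "\<dots> = (\<Sum>E\<in>I. G U E p * G V E p)" by (simp add: frame G_Phi_Phi)
    finally show ?thesis .
  qed
  \<comment> \<open>Half the derivative of \<open>|T|^2\<close> along \<open>X\<close>. Inserting
    \<open>3 a = - \<sigma>\<close> splits it into three sums that agree up to relabelling, each
    zero by skewness of \<open>T\<close>.\<close>
  have ortho: "(\<Sum>k\<in>I. \<Sum>j\<in>I. \<Sum>i\<in>I. a X i j k p * t i j k p) = 0" if X: "X \<in> horizontal" for X
  proof -
    note [simp] = horizontal_VF[OF X]
    \<comment> \<open>The argument needs a full frame; \<open>a\<close> does not see the added vector.\<close>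
    let ?I = "insert \<xi> I"
    have "\<xi> \<notin> I"
    proof
      assume "\<xi> \<in> I"
      then have "et \<xi> p = 0" using horizontal_et[OF IH] by (simp only: zero_fun_apply)
      then show False by simp
    qed
    have full: "(\<Sum>E\<in>?I. G U E p * G V E p) = G U V p" if "U \<in> VF" "V \<in> VF" for U V
      using \<open>\<xi> \<notin> I\<close> frame[OF that] et_eq[OF that(1)] et_eq[OF that(2)] I(2) by simp
    have V: "E \<in> VF" if "E \<in> ?I" for E using that by auto
    have tVV: "t V X V p = 0" if "V \<in> VF" for V
      using fun_cong[OF t23[OF that horizontal_VF[OF X] that], of p] fun_cong[OF t12[OF that that horizontal_VF[OF X]], of p]
      unfolding fun_Compl_def by linarith
    \<comment> \<open>With \<open>V = T j k\<close>, the Parseval sum over \<open>i\<close> is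
      \<open>t V X V\<close>. As \<open>V\<close> need not be horizontal, the sum must include
      \<open>\<xi>\<close>.\<close>
    have S: "(\<Sum>i\<in>?I. G (T X i) (T j k) p * t i j k p) = 0" if "j \<in> ?I" "k \<in> ?I" for j k
    proof -
      note [simp] = V[OF that(1)] V[OF that(2)]
      have "(\<Sum>i\<in>?I. G (T X i) (T j k) p * t i j k p) = (\<Sum>i\<in>?I. G (T (T j k) X) i p * G (T j k) i p)"
      proof (rule sum.cong)
        fix i assume "i \<in> ?I"
        note [simp] = V[OF this]
        have "G (T X i) (T j k) = G (T (T j k) X) i"
          using t_cyc[of "T j k" X i] by (simp add: t_def)
        moreover have "t i j k = G (T j k) i" by (rule t_G) simp_all
        ultimately show "G (T X i) (T j k) p * t i j k p = G (T (T j k) X) i p * G (T j k) i p" by simp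
      qed simp
      also have "\<dots> = 0" using full[of "T (T j k) X" "T j k"] tVV[of "T j k"] by (simp add: t_def)
      finally show ?thesis .
    qed
    define F where "F i j k = a X i j k p * t i j k p" for i j k
    have F0: "F \<xi> j k = 0" "F j \<xi> k = 0" "F j k \<xi> = 0" if "j \<in> ?I" "k \<in> ?I" for j k
      using V[OF that(1)] V[OF that(2)] by (simp_all add: F_def)
    have r1: "(\<Sum>i\<in>?I. F i j k) = (\<Sum>i\<in>I. F i j k)" if "j \<in> ?I" "k \<in> ?I" for j k
      using \<open>\<xi> \<notin> I\<close> I(2) F0(1)[OF that] by simp
    have r2: "(\<Sum>j\<in>?I. \<Sum>i\<in>?I. F i j k) = (\<Sum>j\<in>I. \<Sum>i\<in>I. F i j k)" if k: "k \<in> ?I" for k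
    proof -
      have "(\<Sum>j\<in>?I. \<Sum>i\<in>?I. F i j k) = (\<Sum>i\<in>?I. F i \<xi> k) + (\<Sum>j\<in>I. \<Sum>i\<in>?I. F i j k)"
        by (rule sum.insert[OF I(2) \<open>\<xi> \<notin> I\<close>])
      also have "(\<Sum>i\<in>?I. F i \<xi> k) = 0" by (rule sum.neutral) (use F0(2) k in blast)
      also have "(\<Sum>j\<in>I. \<Sum>i\<in>?I. F i j k) = (\<Sum>j\<in>I. \<Sum>i\<in>I. F i j k)"
        by (rule sum.cong[OF refl], rule r1) (use k in blast)+
      finally show ?thesis by simp
    qed
    have red: "(\<Sum>k\<in>I. \<Sum>j\<in>I. \<Sum>i\<in>I. a X i j k p * t i j k p) = (\<Sum>k\<in>?I. \<Sum>j\<in>?I. \<Sum>i\<in>?I. a X i j k p * t i j k p)"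
    proof -
      have "(\<Sum>k\<in>?I. \<Sum>j\<in>?I. \<Sum>i\<in>?I. F i j k) = (\<Sum>j\<in>?I. \<Sum>i\<in>?I. F i j \<xi>) + (\<Sum>k\<in>I. \<Sum>j\<in>?I. \<Sum>i\<in>?I. F i j k)"
        by (rule sum.insert[OF I(2) \<open>\<xi> \<notin> I\<close>])
      also have "(\<Sum>j\<in>?I. \<Sum>i\<in>?I. F i j \<xi>) = 0" by (intro sum.neutral ballI) (use F0(3) in blast)
      also have "(\<Sum>k\<in>I. \<Sum>j\<in>?I. \<Sum>i\<in>?I. F i j k) = (\<Sum>k\<in>I. \<Sum>j\<in>I. \<Sum>i\<in>I. F i j k)"
        by (rule sum.cong[OF refl], rule r2) blast
      finally show ?thesis by (simp only: F_def add_0)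
    qed
    have gen: "3 * (x * y) = - (b * y + c * y1 + d * y2)" if "3 * x = - (b + c - d)" "y1 = y" "y2 = - y"
      for x y b c d y1 y2 :: real
      using arg_cong[OF that(1), of "\<lambda>u. u * y"] that(2,3) by (simp add: algebra_simps)
    have "3 * (\<Sum>k\<in>?I. \<Sum>j\<in>?I. \<Sum>i\<in>?I. a X i j k p * t i j k p) =
      - ((\<Sum>k\<in>?I. \<Sum>j\<in>?I. \<Sum>i\<in>?I. G (T X i) (T j k) p * t i j k p)
       + (\<Sum>k\<in>?I. \<Sum>j\<in>?I. \<Sum>i\<in>?I. G (T X k) (T i j) p * t k i j p)
       + (\<Sum>k\<in>?I. \<Sum>j\<in>?I. \<Sum>i\<in>?I. G (T X j) (T i k) p * t j i k p))"
      unfolding sum_distrib_left sum.distrib[symmetric] sum_negf[symmetric]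
    proof (intro sum.cong refl)
      fix i j k assume "i \<in> ?I" "j \<in> ?I" "k \<in> ?I"
      note [simp] = this[THEN V]
      have s: "3 * a X i j k p = - (G (T X i) (T j k) p + G (T X k) (T i j) p - G (T X j) (T i k) p)"
        using fun_cong[OF a_sigma[of X i j k], of p] G_sym[of "T i j" "T X k"]
        by (simp add: sigma_T_def T_swap[of X j])
      have e: "t k i j p = t i j k p" "t j i k p = - t i j k p"
        using t_cyc[of k i j] t12[of i j k] by simp_all
      show "3 * (a X i j k p * t i j k p) = - (G (T X i) (T j k) p * t i j k p
          + G (T X k) (T i j) p * t k i j p + G (T X j) (T i k) p * t j i k p)"
        by (rule gen[OF s e])
    qed
    moreover have "(\<Sum>k\<in>?I. \<Sum>j\<in>?I. \<Sum>i\<in>?I. G (T X i) (T j k) p * t i j k p) = 0"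
      by (rule sum.neutral, rule ballI, rule sum.neutral, rule ballI, rule S)
    moreover have "(\<Sum>k\<in>?I. \<Sum>j\<in>?I. \<Sum>i\<in>?I. G (T X k) (T i j) p * t k i j p) = 0"
    proof -
      have "(\<Sum>k\<in>?I. \<Sum>j\<in>?I. \<Sum>i\<in>?I. G (T X k) (T i j) p * t k i j p) =
          (\<Sum>i\<in>?I. \<Sum>k\<in>?I. \<Sum>j\<in>?I. G (T X k) (T i j) p * t k i j p)"
        by (rule sum_rotate)
      also have "\<dots> = (\<Sum>j\<in>?I. \<Sum>i\<in>?I. \<Sum>k\<in>?I. G (T X k) (T i j) p * t k i j p)"
        by (rule sum_rotate)
      also have "\<dots> = 0"
        by (rule sum.neutral, rule ballI, rule sum.neutral, rule ballI, rule S)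
      finally show ?thesis .
    qed
    moreover have "(\<Sum>k\<in>?I. \<Sum>j\<in>?I. \<Sum>i\<in>?I. G (T X j) (T i k) p * t j i k p) = 0"
    proof -
      have "(\<Sum>k\<in>?I. \<Sum>j\<in>?I. \<Sum>i\<in>?I. G (T X j) (T i k) p * t j i k p) =
          (\<Sum>i\<in>?I. \<Sum>k\<in>?I. \<Sum>j\<in>?I. G (T X j) (T i k) p * t j i k p)"
        by (rule sum_rotate)
      also have "\<dots> = 0"
        by (rule sum.neutral, rule ballI, rule sum.neutral, rule ballI, rule S)
      finally show ?thesis .
    qed
    ultimately show ?thesis unfolding red by linarith
  qed
  have norm: "(\<Sum>l\<in>I. \<Sum>k\<in>I. \<Sum>j\<in>I. \<Sum>i\<in>I. (a i j k l p)\<^sup>2) =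
      - (\<Sum>l\<in>I. \<Sum>k\<in>I. \<Sum>j\<in>I. \<Sum>i\<in>I. a i j k l p * (\<Sum>m\<in>I. t i j m p * t k l m p))"
  proof -
    define f where "f i j k l = a i j k l p * G (T i j) (T k l) p" for i j k l
    \<comment> \<open>The horizontal sum over \<open>m\<close> misses the product of the
      \<open>\<eta>\<close>-components of the two torsions. Since \<open>\<eta>(T i j)\<close> is
      the pairing of \<open>T j \<xi>\<close> with \<open>i\<close>, summing over \<open>i\<close>
      inserts \<open>T j \<xi>\<close> into \<open>a\<close>, and \<open>a_torsion_xi\<close>
      applies.\<close>
    have Z: "(\<Sum>i\<in>I. a i j k l p * (et (T i j) p * u)) = 0" if "j \<in> I" "k \<in> I" "l \<in> I" for j k l u
    proof -
      have "(\<Sum>i\<in>I. a i j k l p * (et (T i j) p * u)) = - u * (\<Sum>i\<in>I. G (nabla_T j k l) i p * G (T j \<xi>) i p)"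
        unfolding sum_distrib_left
      proof (rule sum.cong)
        fix i assume i: "i \<in> I"
        have "G (nabla_T j k l) i p = - a i j k l p" using fun_cong[OF a_G[of j k l i], of p] i that by simp
        moreover have "et (T i j) p = G (T j \<xi>) i p"
          using t_G[of i j \<xi>] i that by (simp add: et_eq t_def)
        ultimately show "a i j k l p * (et (T i j) p * u) = - u * (G (nabla_T j k l) i p * G (T j \<xi>) i p)" by simp
      qed simp
      also have "(\<Sum>i\<in>I. G (nabla_T j k l) i p * G (T j \<xi>) i p) = G (nabla_T j k l) (T j \<xi>) p"
        using that by (simp add: frame)
      also have "\<dots> = 0"
        using a_torsion_xi[of j j k l] a_G[of j k l "T \<xi> j"] that by (simp add: T_swap[of \<xi> j])
      finally show ?thesis by simp
    qed
    have "(\<Sum>l\<in>I. \<Sum>k\<in>I. \<Sum>j\<in>I. \<Sum>i\<in>I. a i j k l p * (\<Sum>m\<in>I. t i j m p * t k l m p)) =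
      (\<Sum>l\<in>I. \<Sum>k\<in>I. \<Sum>j\<in>I. \<Sum>i\<in>I. f i j k l - a i j k l p * (et (T i j) p * et (T k l) p))"
    proof (intro sum.cong refl)
      fix i j k l assume [simp]: "i \<in> I" "j \<in> I" "k \<in> I" "l \<in> I"
      have "(\<Sum>m\<in>I. t i j m p * t k l m p) = G (T i j) (T k l) p - et (T i j) p * et (T k l) p"
        using frame[of "T i j" "T k l"] by (simp add: t_def)
      then show "a i j k l p * (\<Sum>m\<in>I. t i j m p * t k l m p) =
          f i j k l - a i j k l p * (et (T i j) p * et (T k l) p)"
        by (simp add: f_def right_diff_distrib)
    qed
    also have "\<dots> = (\<Sum>l\<in>I. \<Sum>k\<in>I. \<Sum>j\<in>I. \<Sum>i\<in>I. f i j k l)"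
      by (rule sum.cong[OF refl], rule sum.cong[OF refl], rule sum.cong[OF refl]) (simp add: sum_subtractf Z)
    finally have 1: "(\<Sum>l\<in>I. \<Sum>k\<in>I. \<Sum>j\<in>I. \<Sum>i\<in>I. a i j k l p * (\<Sum>m\<in>I. t i j m p * t k l m p)) =
      (\<Sum>l\<in>I. \<Sum>k\<in>I. \<Sum>j\<in>I. \<Sum>i\<in>I. f i j k l)" .
    have "3 * (\<Sum>l\<in>I. \<Sum>k\<in>I. \<Sum>j\<in>I. \<Sum>i\<in>I. (a i j k l p)\<^sup>2) =
      - ((\<Sum>l\<in>I. \<Sum>k\<in>I. \<Sum>j\<in>I. \<Sum>i\<in>I. f i j k l) + (\<Sum>l\<in>I. \<Sum>k\<in>I. \<Sum>j\<in>I. \<Sum>i\<in>I. f j k i l)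
        + (\<Sum>l\<in>I. \<Sum>k\<in>I. \<Sum>j\<in>I. \<Sum>i\<in>I. f k i j l))"
      unfolding sum_distrib_left sum.distrib[symmetric] sum_negf[symmetric]
    proof (intro sum.cong refl)
      fix i j k l assume [simp]: "i \<in> I" "j \<in> I" "k \<in> I" "l \<in> I"
      have s: "3 * a i j k l p = - (G (T i j) (T k l) p + G (T j k) (T i l) p + G (T k i) (T j l) p)"
        using fun_cong[OF a_sigma[of i j k l], of p] by (simp add: sigma_T_def)
      have "a j k i l = a i j k l" "a k i j l = a i j k l"
        using a_cyc[of i j k l] a_cyc[of k i j l] by simp_all
      then have "f i j k l + f j k i l + f k i j l
          = a i j k l p * (G (T i j) (T k l) p + G (T j k) (T i l) p + G (T k i) (T j l) p)"
        by (simp add: f_def algebra_simps)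
      then show "3 * (a i j k l p)\<^sup>2 = - (f i j k l + f j k i l + f k i j l)"
        unfolding power2_eq_square using arg_cong[OF s, of "\<lambda>u. a i j k l p * u"]
        by (simp add: algebra_simps)
    qed
    also have "(\<Sum>l\<in>I. \<Sum>k\<in>I. \<Sum>j\<in>I. \<Sum>i\<in>I. f j k i l) = (\<Sum>l\<in>I. \<Sum>k\<in>I. \<Sum>j\<in>I. \<Sum>i\<in>I. f i j k l)"
      by (rule sum.cong[OF refl], rule sum_rotate)
    also have "(\<Sum>l\<in>I. \<Sum>k\<in>I. \<Sum>j\<in>I. \<Sum>i\<in>I. f k i j l) = (\<Sum>l\<in>I. \<Sum>k\<in>I. \<Sum>j\<in>I. \<Sum>i\<in>I. f i j k l)"
      by (rule sum.cong[OF refl], rule trans[OF sum_rotate sum_rotate])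
    finally show ?thesis unfolding 1 by simp
  qed
  interpret P: pointwise_torsion T' a' J "\<lambda>E. E" I
  proof
    fix x y z w u v
    show "T' y x z = - T' x y z" by (simp add: T'_def t12[of "r x" "r y"])
    show "T' x z y = - T' x y z" by (simp add: T'_def t23[of "r x" "r y"])
    show "a' y x z w = - a' x y z w" by (simp add: a'_def a12[of "r x" "r y"])
    show "a' x z y w = - a' x y z w" by (simp add: a'_def a23[of "r x" "r y"])
    show "a' x y w z = - a' x y z w" by (simp add: a'_def a34[of "r x" "r y" "r z"])
    show "T' (J (J x)) y z = - T' x y z"
      by (simp add: T'_def t_def T_minus)
    show "a' (J (J x)) y z w = - a' x y z w"
    proof -
      have "a (- r x) (r y) (r z) (r w) = - a (r x) (r y) (r z) (r w)"
        using a_G[of "r y" "r z" "r w" "- r x"] a_G[of "r y" "r z" "r w" "r x"] by simp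
      then show ?thesis by (simp add: a'_def)
    qed
    show "T' x y z = T' (J x) (J y) z + T' (J x) y (J z) + T' x (J y) (J z)"
      using fun_cong[OF t_type[of "r x" "r y" "r z"], of p] by (simp add: T'_def)
    show "a' w x y z = a' w (J x) (J y) z + a' w (J x) y (J z) + a' w x (J y) (J z)"
      using fun_cong[OF a_type[of "r w" "r x" "r y" "r z"], of p] by (simp add: a'_def)
    show "(\<Sum>i\<in>I. T' x y (J i) * T' z w (J i)) = (\<Sum>i\<in>I. T' x y i * T' z w i)"
      using frameJ[of "T (r x) (r y)" "T (r z) (r w)"] by (simp add: T'_def t_def)
    show "(\<Sum>i\<in>I. a' x y z (J i) * T' u v (J i)) = (\<Sum>i\<in>I. a' x y z i * T' u v i)"
      using frameJ[of "nabla_T (r x) (r y) (r z)" "T (r u) (r v)"] by (simp add: T'_def t_def a'_def a_def)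
  qed
  have K: "P.K x y z u v = G (nabla_T (r x) (r y) (r z)) (T (r u) (r v)) p" for x y z u v
    using frame[of "nabla_T (r x) (r y) (r z)" "T (r u) (r v)"]
    by (simp add: P.K_def T'_def t_def a'_def a_def)
  \<comment> \<open>The algebraic derivative of \<open>\<sigma>\<close> is the geometric one,
    because differentiating \<open>3 a = - \<sigma>\<close> gives \<open>q_eq\<close>. Its type and
    its commutator then follow from \<open>q_type\<close> and \<open>ricci_identity\<close>.\<close>
  have dsigma: "P.dsigma w x y z v = - 3 * q (r w) (r x) (r y) (r z) (r v) p" for w x y z v
    using fun_cong[OF q_eq[OF _ _ _ _ _ a_sigma, of "r w" "r x" "r y" "r z" "r v"], of p]
    by (simp add: P.dsigma_def K)
  interpret Q: bianchi_torsion T' a' J "\<lambda>E. E" I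
  proof
    fix w x y z v u
    show "P.dsigma w x y z v = P.dsigma w x (J y) (J z) v + P.dsigma w x (J y) z (J v) + P.dsigma w x y (J z) (J v)"
      using fun_cong[OF q_type[of "r w" "r x" "r y" "r z" "r v"], of p] by (simp add: dsigma algebra_simps)
    show "P.dsigma (J y) (J x) u v w - P.dsigma (J x) (J y) u v w - 3 * P.K u v w (J x) (J y)
      = P.dsigma y x u v w - P.dsigma x y u v w - 3 * P.K u v w x y"
    proof -
      \<comment> \<open>The curvature side takes the same value at \<open>\<Phi> X, \<Phi> Y\<close>
        as at \<open>X, Y\<close>, so comparing the two instances eliminates the curvature.\<close>
      have N: "q X Y (r u) (r v) (r w) p - q Y X (r u) (r v) (r w) p - G (nabla_T (r u) (r v) (r w)) (T X Y) p =
        - (t (curvature D X Y (r u)) (r v) (r w) p + t (r u) (curvature D X Y (r v)) (r w) p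
         + t (r u) (r v) (curvature D X Y (r w)) p)" if "X \<in> VF" "Y \<in> VF" for X Y
        using fun_cong[OF ricci_identity[of X Y "r u" "r v" "r w"], of p] that
          a_G[of "r u" "r v" "r w" "T X Y"] by simp
      show ?thesis
        using N[of "r x" "r y"] N[of "\<Phi> (r x)" "\<Phi> (r y)"]
        by (simp add: dsigma K curvature_Phi_Phi)
    qed
    show "(\<Sum>k\<in>I. \<Sum>j\<in>I. \<Sum>i\<in>I. a' x i j k * T' i j k) = 0"
      using ortho[of "r x"] by (simp add: a'_def T'_def cong: sum.cong)
    show "(\<Sum>l\<in>I. \<Sum>k\<in>I. \<Sum>j\<in>I. \<Sum>i\<in>I. (a' i j k l)\<^sup>2) =
      - (\<Sum>l\<in>I. \<Sum>k\<in>I. \<Sum>j\<in>I. \<Sum>i\<in>I. a' i j k l * (\<Sum>m\<in>I. T' i j m * T' k l m))"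
      using norm by (simp add: a'_def T'_def cong: sum.cong)
  qed
  show "a X Y Z W p = 0 p"
    using a_all Q.a_eq_0[OF I(2)] by (simp add: a'_def)
qed

end

theorem theorem1p1:
  fixes A :: "('a::{t2_space, second_countable_topology}, 'e::euclidean_space) atlas"
    and \<phi> :: "'a \<Rightarrow> 'a tvec \<Rightarrow> 'a tvec"
    and \<xi> :: "'a vfield"
    and \<eta> :: "'a \<Rightarrow> 'a tvec \<Rightarrow> real"
    and g :: "'a \<Rightarrow> 'a tvec \<Rightarrow> 'a tvec \<Rightarrow> real"
    and D :: "'a vfield \<Rightarrow> 'a vfield \<Rightarrow> 'a vfield"
  assumes "sasaki_with_torsion A \<phi> \<xi> \<eta> g D"
  shows "first_bianchi A D \<longleftrightarrow>
    closed_form3 A (torsion_form \<phi> \<eta> g) \<and> parallel_form3 A D (torsion_form \<phi> \<eta> g)"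
proof -
  interpret S: sasaki_torsion A \<phi> \<xi> \<eta> g D by unfold_locales (rule assms)
  have parallel: "parallel_form3 A D (torsion_form \<phi> \<eta> g) \<longleftrightarrow>
      (\<forall>W\<in>S.VF. \<forall>X\<in>S.VF. \<forall>Y\<in>S.VF. \<forall>Z\<in>S.VF. S.a W X Y Z = 0)"
    unfolding parallel_form3_def by (simp add: S.a_nabla')
  show ?thesis
  proof
    assume fb: "first_bianchi A D"
    interpret B: sasaki_bianchi A \<phi> \<xi> \<eta> g D by unfold_locales (rule fb)
    have a: "S.a X Y Z W = 0" if "X \<in> S.VF" "Y \<in> S.VF" "Z \<in> S.VF" "W \<in> S.VF" for X Y Z W
      using that by (rule B.a_eq_zero)
    \<comment> \<open>With \<open>a = 0\<close> the relation \<open>3 a = - \<sigma>\<close> also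
      gives \<open>\<sigma> = 0\<close>, and these two make up \<open>dH\<close>.\<close>
    then have "S.sigma_T X Y Z W = 0" if "X \<in> S.VF" "Y \<in> S.VF" "Z \<in> S.VF" "W \<in> S.VF" for X Y Z W
      using B.a_sigma[OF that] that by simp
    then have "closed_form3 A (torsion_form \<phi> \<eta> g)"
      unfolding closed_form3_def by (simp add: S.ext_d3_t a)
    then show "closed_form3 A (torsion_form \<phi> \<eta> g) \<and> parallel_form3 A D (torsion_form \<phi> \<eta> g)"
      using a by (simp add: parallel)
  next
    assume r: "closed_form3 A (torsion_form \<phi> \<eta> g) \<and> parallel_form3 A D (torsion_form \<phi> \<eta> g)"
    then have a: "S.a X Y Z W = 0" if "X \<in> S.VF" "Y \<in> S.VF" "Z \<in> S.VF" "W \<in> S.VF" for X Y Z W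
      using that by (simp add: parallel)
    \<comment> \<open>For parallel \<open>H\<close> the exterior derivative reduces to
      \<open>2 \<sigma>\<close>; evaluation at a point allows division by 2.\<close>
    have "S.sigma_T X Y Z W p = 0" if "X \<in> S.VF" "Y \<in> S.VF" "Z \<in> S.VF" "W \<in> S.VF" for X Y Z W p
    proof -
      have "ext_d3 (torsion_form \<phi> \<eta> g) X Y Z W = 0" using r that unfolding closed_form3_def by blast
      then show ?thesis using fun_cong[OF S.ext_d3_t[OF that], of p] that by (simp add: a)
    qed
    then show "first_bianchi A D"
      by (simp add: S.first_bianchi_iff a fun_eq_iff)
  qed
qed

end
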